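(* Let $X$ be an essentially periodic graph and $Y$ a density zero perturbation of $X$. Suppose that $\|A_Y\|>\|A_X\|$. Then $Y$ has hidden spectrum, i.e. $E_0(H)<E_m(H)$ for $H=\|A_Y\|I-A_Y$. In addition, for every $\beta>0$, $$\rho^Y_c(\beta)=\rho^X(\beta,\mu),\qquad \mu=\|A_X\|-\|A_Y\|<0 .$$
   Context: Graphs are simple, countable and of bounded degree; $A_X$ is the adjacency operator on $\ell^2(VX)$. An amenable exhaustion of an infinite graph $X$ is an increasing exhaustion by finite subgraphs $K_n$ with $|\mathcal FK_n|/|VK_n|\to0$, where $\mathcal FK_n=\{v\in VK_n: d(v,VX\setminus VK_n)=1\}$; $P_n$ is the projection onto $\ell^2(VK_n)$. A periodic amenable graph is an infinite graph with a countable discrete amenable group $\Gamma$ of automorphisms acting freely with finite quotient, with fundamental domain $F\subset VX$, and with an amenable exhaustion $K_n$ such that $VK_n\setminus\mathcal FK_n\subseteq E_nF\subseteq VK_n$ for suitable finite $E_n\subset\Gamma$. If $VX=VY$, $Y$ is a density zero perturbation of $X$ if $A_X-A_Y$ is essentially zero, i.e. $\frac{1}{|VK_n|}\mathrm{Tr}((A_X-A_Y)^2P_n)\to0$; equivalently $\frac{1}{|VK_n|}|\{\{u,v\}\in EX\triangle EY: u\in VK_n\}|\to0$. An essentially periodic graph is a graph obtained from a periodic amenable graph by a density zero perturbation and/or a finite perturbation (adding or removing finitely many vertices and edges), endowed with the (correspondingly modified) exhaustion. $\tau(\varphi(T))=\lim_n\frac{1}{|VK_n|}\mathrm{Tr}(\varphi(T)P_n)$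 for $T$ a positive operator built from the adjacency, $\varphi$ continuous; $dN_T$ is the measure with $\tau(\varphi(T))=\int\varphi\,dN_T$. $E_0(H)=\lim_n\min\sigma(P_nHP_n|_{\ell^2(VK_n)})$ and $E_m(H)=\inf\mathrm{supp}(dN_H)$. For $H_X=\|A_X\|I-A_X$, $\beta>0$, $\mu\le0$: $\rho^X(\beta,\mu)=\int\frac{dN_{H_X}(h)}{e^{\beta(h-\mu)}-1}$ and $\rho^X_c(\beta)=\rho^X(\beta,0)$ (critical density); similarly for $Y$. *)

theory Defs
  imports
    "HOL-Analysis.Analysis"
    "HOL-Algebra.Bij"
    "HOL-Algebra.Coset"
    "HOL-Computational_Algebra.Polynomial"
    "HOL-Library.Extended_Nat"
begin

section \<open>The Hilbert space of square-summable complex functions\<close>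

typedef 'v ell2 = "{f :: 'v \<Rightarrow> complex. (\<lambda>v. (cmod (f v))\<^sup>2) summable_on UNIV}"
  morphisms coord Abs_ell2
  by (rule exI[of _ "\<lambda>_. 0"]) simp

setup_lifting type_definition_ell2

lemma inner_le_squares: "\<bar>z \<bullet> w\<bar> \<le> (cmod z)\<^sup>2 + (cmod w)\<^sup>2" for z w :: complex
proof -
  have "2 * (cmod z * cmod w) \<le> (cmod z)\<^sup>2 + (cmod w)\<^sup>2"
    using sum_squares_bound[of "cmod z" "cmod w"] by (simp add: mult.assoc)
  moreover have "\<bar>z \<bullet> w\<bar> \<le> cmod z * cmod w" by (rule Cauchy_Schwarz_ineq2)
  moreover have "0 \<le> cmod z * cmod w" by simp
  ultimately show ?thesis by linarith
qed

lemma summable_on_inner: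
  fixes f g :: "'v \<Rightarrow> complex"
  assumes "(\<lambda>v. (cmod (f v))\<^sup>2) summable_on UNIV" "(\<lambda>v. (cmod (g v))\<^sup>2) summable_on UNIV"
  shows "(\<lambda>v. f v \<bullet> g v) summable_on UNIV"
proof -
  have "(\<lambda>v. \<bar>f v \<bullet> g v\<bar>) summable_on UNIV"
    by (rule summable_on_comparison_test[OF summable_on_add[OF assms]])
      (auto intro: inner_le_squares)
  then show ?thesis
    by (subst summable_on_iff_abs_summable_on_real) (simp only: real_norm_def)
qed

lemma square_summable_add:
  fixes f g :: "'v \<Rightarrow> complex"
  assumes "(\<lambda>v. (cmod (f v))\<^sup>2) summable_on UNIV" "(\<lambda>v. (cmod (g v))\<^sup>2) summable_on UNIV"
  shows "(\<lambda>v. (cmod (f v + g v))\<^sup>2) summable_on UNIV"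
proof -
  have eq: "(cmod (f v + g v))\<^sup>2 = ((cmod (f v))\<^sup>2 + (cmod (g v))\<^sup>2) + 2 * (f v \<bullet> g v)" for v
    by (simp add: power2_norm_eq_inner inner_add_left inner_add_right inner_commute[of "g v" "f v"])
  show ?thesis unfolding eq
    by (intro summable_on_add summable_on_cmult_right summable_on_inner assms)
qed

instantiation ell2 :: (type) real_vector
begin

lift_definition zero_ell2 :: "'a ell2" is "\<lambda>_. 0" by simp

lift_definition plus_ell2 :: "'a ell2 \<Rightarrow> 'a ell2 \<Rightarrow> 'a ell2" is "\<lambda>f g v. f v + g v"
  by (simp add: square_summable_add)

lift_definition uminus_ell2 :: "'a ell2 \<Rightarrow> 'a ell2" is "\<lambda>f v. - f v" by simp

lift_definition minus_ell2 :: "'a ell2 \<Rightarrow> 'a ell2 \<Rightarrow> 'a ell2" is "\<lambda>f g v. f v - g v"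
proof -
  fix f g :: "'a \<Rightarrow> complex"
  assume "(\<lambda>v. (cmod (f v))\<^sup>2) summable_on UNIV" "(\<lambda>v. (cmod (g v))\<^sup>2) summable_on UNIV"
  then show "(\<lambda>v. (cmod (f v - g v))\<^sup>2) summable_on UNIV"
    using square_summable_add[of f "\<lambda>v. - g v"] by simp
qed

lift_definition scaleR_ell2 :: "real \<Rightarrow> 'a ell2 \<Rightarrow> 'a ell2" is "\<lambda>r f v. r *\<^sub>R f v"
  by (simp add: power_mult_distrib summable_on_cmult_right)

instance
proof
  fix f g h :: "'a ell2" and a b :: real
  show "f + g + h = f + (g + h)" by transfer (simp add: add.assoc)
  show "f + g = g + f" by transfer (simp add: add.commute)
  show "0 + f = f" by transfer simp
  show "- f + f = 0" by transfer simp
  show "f - g = f + - g" by transfer simp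
  show "a *\<^sub>R (f + g) = a *\<^sub>R f + a *\<^sub>R g" by transfer (simp add: scaleR_add_right)
  show "(a + b) *\<^sub>R f = a *\<^sub>R f + b *\<^sub>R f" by transfer (simp add: scaleR_add_left)
  show "a *\<^sub>R b *\<^sub>R f = (a * b) *\<^sub>R f" by transfer simp
  show "1 *\<^sub>R f = f" by transfer simp
qed

end

instantiation ell2 :: (type) real_inner
begin

text \<open>The real part of the usual Hermitian inner product: it induces the same norm.\<close>

lift_definition inner_ell2 :: "'a ell2 \<Rightarrow> 'a ell2 \<Rightarrow> real" is "\<lambda>f g. \<Sum>\<^sub>\<infinity>v. f v \<bullet> g v" .

definition norm_ell2 :: "'a ell2 \<Rightarrow> real" where "norm_ell2 f = sqrt (f \<bullet> f)"

definition dist_ell2 :: "'a ell2 \<Rightarrow> 'a ell2 \<Rightarrow> real" where "dist_ell2 f g = norm (f - g)"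

definition sgn_ell2 :: "'a ell2 \<Rightarrow> 'a ell2" where "sgn_ell2 f = f /\<^sub>R norm f"

definition uniformity_ell2 :: "('a ell2 \<times> 'a ell2) filter" where
  "uniformity_ell2 = (INF e\<in>{0<..}. principal {(f, g). dist f g < e})"

definition open_ell2 :: "'a ell2 set \<Rightarrow> bool" where
  "open_ell2 U = (\<forall>f\<in>U. \<forall>\<^sub>F (f', g) in uniformity. f' = f \<longrightarrow> g \<in> U)"

instance
proof
  fix f g h :: "'a ell2" and U :: "'a ell2 set" and a :: real
  show "sgn f = f /\<^sub>R norm f" by (fact sgn_ell2_def)
  show "dist f g = norm (f - g)" by (fact dist_ell2_def)
  show "uniformity = (INF e\<in>{0<..}. principal {(f :: 'a ell2, g). dist f g < e})"
    by (fact uniformity_ell2_def)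
  show "open U = (\<forall>f\<in>U. \<forall>\<^sub>F (f', g) in uniformity. f' = f \<longrightarrow> g \<in> U)"
    by (fact open_ell2_def)
  show "f \<bullet> g = g \<bullet> f" by transfer (simp add: inner_commute)
  show "(f + g) \<bullet> h = f \<bullet> h + g \<bullet> h"
    by transfer (simp add: inner_add_left infsum_add summable_on_inner)
  show "(a *\<^sub>R f) \<bullet> g = a * (f \<bullet> g)"
    by transfer (simp add: infsum_cmult_right')
  show "0 \<le> f \<bullet> f" by transfer (simp add: infsum_nonneg)
  show "f \<bullet> f = 0 \<longleftrightarrow> f = 0"
  proof transfer
    fix f :: "'a \<Rightarrow> complex"
    assume "(\<lambda>v. (cmod (f v))\<^sup>2) summable_on UNIV"
    then have s: "(\<lambda>v. f v \<bullet> f v) summable_on UNIV" by (simp add: power2_norm_eq_inner)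
    show "(\<Sum>\<^sub>\<infinity>v. f v \<bullet> f v) = 0 \<longleftrightarrow> f = (\<lambda>_. 0)"
    proof
      assume "(\<Sum>\<^sub>\<infinity>v. f v \<bullet> f v) = 0"
      then have "f v \<bullet> f v = 0" for v
        using nonneg_infsum_le_0D[of "\<lambda>v. f v \<bullet> f v" UNIV v] s by simp
      then show "f = (\<lambda>_. 0)" by (simp add: fun_eq_iff)
    qed simp
  qed
  show "norm f = sqrt (f \<bullet> f)" by (fact norm_ell2_def)
qed

end

lift_definition basis_vector :: "'v \<Rightarrow> 'v ell2" is "\<lambda>v w. if w = v then 1 else 0"
proof -
  fix v :: 'v
  have "finite {w. (cmod (if w = v then 1 else 0))\<^sup>2 \<noteq> 0}"
    by (rule finite_subset[of _ "{v}"]) auto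
  then show "(\<lambda>w. (cmod (if w = v then 1 else 0))\<^sup>2) summable_on UNIV"
    by (simp add: finite_nonzero_values_imp_summable_on)
qed

type_synonym 'v operator = "'v ell2 \<Rightarrow>\<^sub>L 'v ell2"

lift_definition restrict_ell2 :: "'v set \<Rightarrow> 'v ell2 \<Rightarrow> 'v ell2" is "\<lambda>S f v. if v \<in> S then f v else 0"
proof -
  fix S :: "'v set" and f :: "'v \<Rightarrow> complex"
  assume "(\<lambda>v. (cmod (f v))\<^sup>2) summable_on UNIV"
  then show "(\<lambda>v. (cmod (if v \<in> S then f v else 0))\<^sup>2) summable_on UNIV"
    by (rule summable_on_comparison_test) auto
qed

text \<open>
  For a set of vertices \<open>V\<close>, the space \<open>\<ell>\<^sup>2(V)\<close> is the closed subspace of functions supported in \<open>V\<close>,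
  and an operator \<open>T\<close> on it is represented by its extension by \<open>0\<close> to the orthogonal complement,
  so \<open>proj_on V\<close> plays the role of the identity operator of \<open>\<ell>\<^sup>2(V)\<close>.
\<close>

lift_definition proj_on :: "'v set \<Rightarrow> 'v operator" is restrict_ell2
proof (rule bounded_linear_intro[where K = 1])
  fix S :: "'v set" and f g :: "'v ell2" and r :: real
  show "restrict_ell2 S (f + g) = restrict_ell2 S f + restrict_ell2 S g" by transfer auto
  show "restrict_ell2 S (r *\<^sub>R f) = r *\<^sub>R restrict_ell2 S f" by transfer auto
  have "restrict_ell2 S f \<bullet> restrict_ell2 S f \<le> f \<bullet> f"
  proof transfer
    fix S :: "'v set" and f :: "'v \<Rightarrow> complex"
    assume "(\<lambda>v. (cmod (f v))\<^sup>2) summable_on UNIV"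
    then have s: "(\<lambda>v. f v \<bullet> f v) summable_on UNIV" by (simp add: power2_norm_eq_inner)
    have "(\<lambda>v. (if v \<in> S then f v else 0) \<bullet> (if v \<in> S then f v else 0)) summable_on UNIV"
      using s by (rule summable_on_comparison_test) auto
    then show "(\<Sum>\<^sub>\<infinity>v. (if v \<in> S then f v else 0) \<bullet> (if v \<in> S then f v else 0)) \<le> (\<Sum>\<^sub>\<infinity>v. f v \<bullet> f v)"
      using s by (rule infsum_mono) auto
  qed
  then show "norm (restrict_ell2 S f) \<le> norm f * 1" by (simp add: norm_le)
qed

text \<open>
  The spectrum of \<open>T\<close> as an operator on \<open>\<ell>\<^sup>2(V)\<close>. Only real spectral parameters are recorded, since the
  notion is used for self-adjoint operators alone.
\<close>

definition spectrum :: "'v set \<Rightarrow> 'v operator \<Rightarrow> real set" where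
  "spectrum V T =
     {z. \<not> (\<exists>R. proj_on V o\<^sub>L R o\<^sub>L proj_on V = R
              \<and> R o\<^sub>L (z *\<^sub>R proj_on V - T) = proj_on V
              \<and> (z *\<^sub>R proj_on V - T) o\<^sub>L R = proj_on V)}"

definition poly_op :: "'v set \<Rightarrow> real poly \<Rightarrow> 'v operator \<Rightarrow> 'v operator" where
  "poly_op V p T = (\<Sum>i\<le>degree p. coeff p i *\<^sub>R (((o\<^sub>L) T ^^ i) (proj_on V)))"

text \<open>
  Continuous functional calculus on \<open>\<ell>\<^sup>2(V)\<close>: \<open>\<phi>(T)\<close> is the norm limit of \<open>p\<^sub>k(T)\<close> for all polynomials
  \<open>p\<^sub>k \<rightarrow> \<phi>\<close> uniformly on the spectrum of the self-adjoint operator \<open>T\<close>.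
\<close>

definition functional_calculus :: "'v set \<Rightarrow> (real \<Rightarrow> real) \<Rightarrow> 'v operator \<Rightarrow> 'v operator" where
  "functional_calculus V \<phi> T =
     (THE S. \<forall>p. uniform_limit (spectrum V T) (\<lambda>k. poly (p k)) \<phi> sequentially
                 \<longrightarrow> (\<lambda>k. poly_op V (p k) T) \<longlonglongrightarrow> S)"

text \<open>\<open>trace_on S T\<close> is \<open>Tr (T P)\<close> for the projection \<open>P\<close> onto \<open>\<ell>\<^sup>2(S)\<close>, with \<open>S\<close> finite.\<close>

definition trace_on :: "'v set \<Rightarrow> 'v operator \<Rightarrow> complex" where
  "trace_on S T = (\<Sum>v\<in>S. coord (blinfun_apply T (basis_vector v)) v)"


section \<open>Graphs and amenable exhaustions\<close>

record 'v graph =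
  verts :: "'v set"
  edges :: "'v set set"

definition adj :: "'v graph \<Rightarrow> 'v \<Rightarrow> 'v \<Rightarrow> bool" where
  "adj X u v \<longleftrightarrow> {u, v} \<in> edges X"

definition is_graph :: "'v graph \<Rightarrow> bool" where
  "is_graph X \<longleftrightarrow>
     countable (verts X)
     \<and> (\<forall>e\<in>edges X. \<exists>u\<in>verts X. \<exists>v\<in>verts X. u \<noteq> v \<and> e = {u, v})
     \<and> (\<exists>d. \<forall>v\<in>verts X. finite {w. adj X v w} \<and> card {w. adj X v w} \<le> d)"

text \<open>Bounded degree makes this operator bounded, so that \<^const>\<open>Blinfun\<close> is meaningful.\<close>

definition adjacency :: "'v graph \<Rightarrow> 'v operator" where
  "adjacency X = Blinfun (\<lambda>f. Abs_ell2 (\<lambda>v. \<Sum>w | adj X v w. coord f w))"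

definition dist_to_set :: "'v graph \<Rightarrow> 'v \<Rightarrow> 'v set \<Rightarrow> enat" where
  "dist_to_set X v S = Inf {enat n | n. \<exists>w\<in>S. (v, w) \<in> {(a, b). adj X a b} ^^ n}"

definition boundary :: "'v graph \<Rightarrow> 'v set \<Rightarrow> 'v set" where
  "boundary X S = {v \<in> S. dist_to_set X v (verts X - S) = 1}"

text \<open>
  A sequence of finite subgraphs enters all the notions below only through the vertex sets, so
  exhaustions are given by vertex sets (with the induced subgraphs understood).
\<close>

definition exhaustion :: "'v graph \<Rightarrow> (nat \<Rightarrow> 'v set) \<Rightarrow> bool" where
  "exhaustion X K \<longleftrightarrow> incseq K \<and> (\<forall>n. finite (K n)) \<and> (\<Union>n. K n) = verts X"

definition amenable_exhaustion :: "'v graph \<Rightarrow> (nat \<Rightarrow> 'v set) \<Rightarrow> bool" where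
  "amenable_exhaustion X K \<longleftrightarrow>
     exhaustion X K \<and> (\<lambda>n. real (card (boundary X (K n))) / real (card (K n))) \<longlonglongrightarrow> 0"

definition amenable_group :: "('g, 'm) monoid_scheme \<Rightarrow> bool" where
  "amenable_group G \<longleftrightarrow> group G \<and>
     (\<exists>m :: 'g set \<Rightarrow> real.
        (\<forall>A\<subseteq>carrier G. 0 \<le> m A) \<and> m (carrier G) = 1
        \<and> (\<forall>A\<subseteq>carrier G. \<forall>B\<subseteq>carrier G. A \<inter> B = {} \<longrightarrow> m (A \<union> B) = m A + m B)
        \<and> (\<forall>g\<in>carrier G. \<forall>A\<subseteq>carrier G. m (g <#\<^bsub>G\<^esub> A) = m A))"

definition graph_automorphism :: "'v graph \<Rightarrow> ('v \<Rightarrow> 'v) \<Rightarrow> bool" where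
  "graph_automorphism X g \<longleftrightarrow>
     g \<in> Bij (verts X) \<and> (\<forall>u\<in>verts X. \<forall>v\<in>verts X. adj X (g u) (g v) \<longleftrightarrow> adj X u v)"

definition orbit_of :: "('v \<Rightarrow> 'v) set \<Rightarrow> 'v \<Rightarrow> 'v set" where
  "orbit_of \<Gamma> v = {g v | g. g \<in> \<Gamma>}"

text \<open>
  A group acting freely on a non-empty vertex set acts faithfully, hence is given by a subgroup of the
  group of all bijections of the vertex set.
\<close>

definition periodic_amenable_graph :: "'v graph \<Rightarrow> (nat \<Rightarrow> 'v set) \<Rightarrow> bool" where
  "periodic_amenable_graph X K \<longleftrightarrow>
     is_graph X \<and> infinite (verts X) \<and> amenable_exhaustion X K \<and>
     (\<exists>\<Gamma> F E.
        subgroup \<Gamma> (BijGroup (verts X)) \<and> countable \<Gamma>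
        \<and> amenable_group (BijGroup (verts X)\<lparr>carrier := \<Gamma>\<rparr>)
        \<and> (\<forall>g\<in>\<Gamma>. graph_automorphism X g)
        \<and> (\<forall>g\<in>\<Gamma>. \<forall>v\<in>verts X. g v = v \<longrightarrow> g = \<one>\<^bsub>BijGroup (verts X)\<^esub>)
        \<and> finite (orbit_of \<Gamma> ` verts X)
        \<and> F \<subseteq> verts X \<and> (\<forall>v\<in>verts X. \<exists>!w. w \<in> F \<inter> orbit_of \<Gamma> v)
        \<and> (\<forall>n. E n \<subseteq> \<Gamma> \<and> finite (E n)
                \<and> K n - boundary X (K n) \<subseteq> (\<Union>g\<in>E n. g ` F)
                \<and> (\<Union>g\<in>E n. g ` F) \<subseteq> K n))"

definition essentially_zero :: "(nat \<Rightarrow> 'v set) \<Rightarrow> 'v operator \<Rightarrow> bool" where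
  "essentially_zero K T \<longleftrightarrow> (\<lambda>n. trace_on (K n) (T o\<^sub>L T) / of_nat (card (K n))) \<longlonglongrightarrow> 0"

definition density_zero_perturbation :: "(nat \<Rightarrow> 'v set) \<Rightarrow> 'v graph \<Rightarrow> 'v graph \<Rightarrow> bool" where
  "density_zero_perturbation K X Y \<longleftrightarrow>
     is_graph Y \<and> verts Y = verts X \<and> essentially_zero K (adjacency X - adjacency Y)"

text \<open>
  The modified exhaustion \<open>L\<close> of \<open>Y\<close> agrees with \<open>K\<close> on the common vertices; the finitely many new
  vertices may enter at any stage.
\<close>

definition finite_perturbation ::
  "'v graph \<Rightarrow> (nat \<Rightarrow> 'v set) \<Rightarrow> 'v graph \<Rightarrow> (nat \<Rightarrow> 'v set) \<Rightarrow> bool" where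
  "finite_perturbation X K Y L \<longleftrightarrow>
     is_graph Y \<and> finite (sym_diff (verts X) (verts Y)) \<and> finite (sym_diff (edges X) (edges Y))
     \<and> exhaustion Y L \<and> (\<forall>n. L n \<inter> verts X = K n \<inter> verts Y)"

inductive essentially_periodic :: "'v graph \<Rightarrow> (nat \<Rightarrow> 'v set) \<Rightarrow> bool" where
  periodic: "essentially_periodic X K" if "periodic_amenable_graph X K"
| density_zero: "essentially_periodic Y K"
    if "essentially_periodic X K" "density_zero_perturbation K X Y"
| finite_pert: "essentially_periodic Y L"
    if "essentially_periodic X K" "finite_perturbation X K Y L"


section \<open>Spectral measure, hidden spectrum and density\<close>

text \<open>
  The measure \<open>dN\<^sub>T\<close>, characterised by \<open>\<tau>(\<phi>(T)) = \<integral>\<phi> dN\<^sub>T\<close> for all continuous \<open>\<phi>\<close>, where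
  \<open>\<tau>(S) = lim\<^sub>n Tr(S P\<^sub>n) / |K\<^sub>n|\<close> and \<open>T\<close> is an operator on \<open>\<ell>\<^sup>2(V)\<close>.
\<close>

definition spectral_measure :: "'v set \<Rightarrow> (nat \<Rightarrow> 'v set) \<Rightarrow> 'v operator \<Rightarrow> real measure" where
  "spectral_measure V K T =
     (THE N. sets N = sets borel \<and>
        (\<forall>\<phi>. continuous_on UNIV \<phi> \<longrightarrow>
           integrable N \<phi> \<and>
           (\<lambda>n. trace_on (K n) (functional_calculus V \<phi> T) / of_nat (card (K n)))
             \<longlonglongrightarrow> complex_of_real (\<integral>h. \<phi> h \<partial>N)))"

definition measure_support :: "real measure \<Rightarrow> real set" where
  "measure_support N = {h. \<forall>U. open U \<and> h \<in> U \<longrightarrow> emeasure N U > 0}"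

text \<open>The compressed operator acts on a finite-dimensional space, so \<^const>\<open>Inf\<close> is a minimum.\<close>

definition E0 :: "(nat \<Rightarrow> 'v set) \<Rightarrow> 'v operator \<Rightarrow> real" where
  "E0 K H = lim (\<lambda>n. Inf (spectrum (K n) (proj_on (K n) o\<^sub>L H o\<^sub>L proj_on (K n))))"

definition Em :: "'v set \<Rightarrow> (nat \<Rightarrow> 'v set) \<Rightarrow> 'v operator \<Rightarrow> real" where
  "Em V K H = Inf (measure_support (spectral_measure V K H))"

definition hamiltonian :: "'v graph \<Rightarrow> 'v operator" where
  "hamiltonian X = norm (adjacency X) *\<^sub>R proj_on (verts X) - adjacency X"

definition hidden_spectrum :: "'v graph \<Rightarrow> (nat \<Rightarrow> 'v set) \<Rightarrow> bool" where
  "hidden_spectrum X K \<longleftrightarrow> E0 K (hamiltonian X) < Em (verts X) K (hamiltonian X)"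

text \<open>
  The density is an extended real, as the critical density may be infinite; in \<^typ>\<open>ennreal\<close> the
  integrand takes its mathematical value \<open>\<infinity>\<close> at \<open>h = \<mu>\<close>.
\<close>

definition particle_density :: "'v graph \<Rightarrow> (nat \<Rightarrow> 'v set) \<Rightarrow> real \<Rightarrow> real \<Rightarrow> ennreal" where
  "particle_density X K \<beta> \<mu> =
     (\<integral>\<^sup>+h. 1 / ennreal (exp (\<beta> * (h - \<mu>)) - 1) \<partial>spectral_measure (verts X) K (hamiltonian X))"

definition critical_density :: "'v graph \<Rightarrow> (nat \<Rightarrow> 'v set) \<Rightarrow> real \<Rightarrow> ennreal" where
  "critical_density X K \<beta> = particle_density X K \<beta> 0"

end

(*
  Closed walks determine the density of states: the moments of dN_A are the limits of the mean
  numbers of closed walks at the vertices of K_n. For a periodic graph these limits exist because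
  the numbers are constant on orbits and the boundary is negligible. Comparing the walks of X
  confined to K_n with those of X and of Y shows that every perturbation allowed here changes the
  means by o(1). Hence A_X and A_Y have the same density of states N, carried by
  [-|A_X|, |A_X|], and the measures of the two Hamiltonians are the images of N under
  x |-> |A_X| - x and x |-> |A_Y| - x. They differ by the shift |A_Y| - |A_X|, which gives both
  the density formula and E_m >= |A_Y| - |A_X|. On the other hand E_0 = 0, since A_Y has
  nonnegative entries, so |A_Y| is the supremum of the quadratic form of A_Y over finitely
  supported unit vectors.

  N itself comes from a Hausdorff moment problem, and the functional calculus from the bound of
  |p(T)| by the supremum of |p| on the spectrum of a self-adjoint operator T.
*)
theory Submission
  imports Defs "HOL-Probability.Levy" "HOL-Computational_Algebra.Fundamental_Theorem_Algebra"
begin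

section \<open>The Hilbert space\<close>

text \<open>\<open>functional_calculus\<close> and \<open>spectral_measure\<close> are definite
  descriptions, so neither can be used before existence and uniqueness are settled. Existence of the
  measure is the moment problem; uniqueness comes from characteristic functions.
  \<open>spectrum\<close> records real parameters only, so the bound on p(T) cannot pass through
  complex resolvents. Real polynomials are split over the reals instead: a linear factor with root
  outside the spectrum is bounded below by definition, a quadratic factor without real roots by
  completing the square. "Bounded below" is the working form of invertibility throughout.
  Periodicity is lost after one perturbation, so the induction over
  \<open>essentially_periodic\<close> carries the weaker invariant \<open>homogeneous\<close>:
  negligible leakage of the exhaustion and convergent mean walk counts. A density zero perturbation
  is controlled only at vertices of \<open>K n\<close>, while walks starting there may leave; this
  is why confined walks mediate every comparison. The strict gap needs no exact knowledge of the
  support of N: any interval [-M, M] carrying N with M below the norm of A_Y will do.\<close>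

lemma ell2_eqI: "(\<And>v. coord f v = coord g v) \<Longrightarrow> f = g"
  by (metis coord_inject ext)

lemma coord_add [simp]: "coord (f + g) v = coord f v + coord g v"
  by transfer simp
lemma coord_diff [simp]: "coord (f - g) v = coord f v - coord g v"
  by transfer simp
lemma coord_zero [simp]: "coord 0 v = 0"
  by transfer simp
lemma coord_uminus [simp]: "coord (- f) v = - coord f v"
  by transfer simp
lemma coord_scaleR [simp]: "coord (r *\<^sub>R f) v = r *\<^sub>R coord f v"
  by transfer simp
lemma coord_sum [simp]: "coord (sum F S) v = (\<Sum>i\<in>S. coord (F i) v)"
  by (induction S rule: infinite_finite_induct) auto
lemma coord_basis [simp]: "coord (basis_vector v) w = (if w = v then 1 else 0)"
  by transfer simp
lemma coord_proj_on [simp]: "coord (blinfun_apply (proj_on S) f) v = (if v \<in> S then coord f v else 0)"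
  by (simp add: proj_on.rep_eq restrict_ell2.rep_eq)

lemma square_summable_coord: "(\<lambda>v. (cmod (coord f v))\<^sup>2) summable_on UNIV"
  using coord[of f] by simp

lemma inner_ell2_infsum: "f \<bullet> g = (\<Sum>\<^sub>\<infinity>v. coord f v \<bullet> coord g v)"
  by transfer simp

lemma inner_ell2_summable: "(\<lambda>v. coord f v \<bullet> coord g v) summable_on UNIV"
  by (intro summable_on_inner square_summable_coord)

lemma norm_ell2_infsum: "(norm f)\<^sup>2 = (\<Sum>\<^sub>\<infinity>v. (cmod (coord f v))\<^sup>2)"
  by (simp add: power2_norm_eq_inner inner_ell2_infsum)

lemma inner_ell2_finite_support:
  assumes "finite S" "\<And>v. v \<notin> S \<Longrightarrow> coord g v = 0"
  shows "f \<bullet> g = (\<Sum>v\<in>S. coord f v \<bullet> coord g v)"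
proof -
  have "(\<Sum>\<^sub>\<infinity>v. coord f v \<bullet> coord g v) = (\<Sum>\<^sub>\<infinity>v\<in>S. coord f v \<bullet> coord g v)"
    by (rule infsum_cong_neutral) (use assms in auto)
  then show ?thesis using assms(1) by (simp add: inner_ell2_infsum)
qed

lemma inner_basis_vector: "f \<bullet> basis_vector v = Re (coord f v)"
proof -
  have "f \<bullet> basis_vector v = (\<Sum>w\<in>{v}. coord f w \<bullet> coord (basis_vector v) w)"
    by (rule inner_ell2_finite_support) auto
  then show ?thesis by (simp add: inner_complex_def)
qed

lemma norm_basis_vector [simp]: "norm (basis_vector v) = 1"
  by (simp add: norm_eq_sqrt_inner inner_basis_vector)

lemma sum_coord_le_norm: "finite S \<Longrightarrow> (\<Sum>v\<in>S. (cmod (coord f v))\<^sup>2) \<le> (norm f)\<^sup>2"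
  unfolding norm_ell2_infsum
  by (rule finite_sum_le_infsum[OF square_summable_coord]) auto

lemma cmod_coord_le_norm: "cmod (coord f v) \<le> norm f"
  using sum_coord_le_norm[of "{v}" f] by (simp add: power2_le_iff_abs_le)

lemma bounded_linear_coord: "bounded_linear (\<lambda>f. coord f v)"
  by (rule bounded_linear_intro[where K = 1]) (auto simp: cmod_coord_le_norm)

lemma square_summableI:
  fixes x :: "'v \<Rightarrow> complex"
  assumes "\<And>S. finite S \<Longrightarrow> (\<Sum>v\<in>S. (cmod (x v))\<^sup>2) \<le> B"
  shows "(\<lambda>v. (cmod (x v))\<^sup>2) summable_on UNIV"
  by (rule nonneg_bdd_above_summable_on) (auto intro!: bdd_aboveI[of _ B] assms)

lemma coord_Abs_ell2:
  assumes "(\<lambda>v. (cmod (x v))\<^sup>2) summable_on UNIV"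
  shows "coord (Abs_ell2 x) = x"
  using assms by (simp add: Abs_ell2_inverse)

lemma norm_ell2_leI:
  assumes "\<And>S. finite S \<Longrightarrow> (\<Sum>v\<in>S. (cmod (coord f v))\<^sup>2) \<le> B\<^sup>2" "0 \<le> B"
  shows "norm f \<le> B"
proof -
  have "(norm f)\<^sup>2 \<le> B\<^sup>2" unfolding norm_ell2_infsum
    by (rule infsum_le_finite_sums[OF square_summable_coord]) (use assms in auto)
  then show ?thesis using assms(2) by (simp add: power2_le_iff_abs_le)
qed

text \<open>Completeness makes the operators a Banach space, which the Neumann series and the
  functional calculus need for their limits. The limit is taken coordinatewise and controlled
  through finite partial sums of squares.\<close>

instance ell2 :: (type) banach
proof
  fix X :: "nat \<Rightarrow> 'a ell2"
  assume C: "Cauchy X"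
  have "Cauchy (\<lambda>n. coord (X n) v)" for v
    by (rule bounded_linear.Cauchy[OF bounded_linear_coord C])
  then have "\<forall>v. \<exists>l. (\<lambda>n. coord (X n) v) \<longlonglongrightarrow> l"
    by (metis Cauchy_convergent_iff convergent_def)
  then obtain l where l: "\<And>v. (\<lambda>n. coord (X n) v) \<longlonglongrightarrow> l v" by metis
  \<comment> \<open>On a finite set the Cauchy estimate survives letting \<open>n\<close> tend to
    infinity, and the bound does not depend on the set. It yields both square summability of
    \<open>l\<close> and convergence in norm.\<close>
  have tail: "(\<Sum>v\<in>S. (cmod (coord (X m) v - l v))\<^sup>2) \<le> e\<^sup>2"
    if S: "finite S" and e: "0 < e" and M: "\<And>m n. m \<ge> M \<Longrightarrow> n \<ge> M \<Longrightarrow> dist (X m) (X n) < e" and m: "m \<ge> M"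
    for S e M m
  proof (rule LIMSEQ_le_const2)
    show "(\<lambda>n. \<Sum>v\<in>S. (cmod (coord (X m) v - coord (X n) v))\<^sup>2)
        \<longlonglongrightarrow> (\<Sum>v\<in>S. (cmod (coord (X m) v - l v))\<^sup>2)"
      by (intro tendsto_intros l)
    have "(\<Sum>v\<in>S. (cmod (coord (X m) v - coord (X n) v))\<^sup>2) \<le> e\<^sup>2" if "n \<ge> M" for n
    proof -
      have "(\<Sum>v\<in>S. (cmod (coord (X m - X n) v))\<^sup>2) \<le> (norm (X m - X n))\<^sup>2"
        by (rule sum_coord_le_norm[OF S])
      also have "\<dots> \<le> e\<^sup>2" using M[OF m that] by (intro power_mono) (auto simp: dist_norm)
      finally show ?thesis by simp
    qed
    then show "\<exists>N. \<forall>n\<ge>N. (\<Sum>v\<in>S. (cmod (coord (X m) v - coord (X n) v))\<^sup>2) \<le> e\<^sup>2" by blast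
  qed
  obtain M1 where M1: "\<And>m n. m \<ge> M1 \<Longrightarrow> n \<ge> M1 \<Longrightarrow> dist (X m) (X n) < 1"
    using metric_CauchyD[OF C, of 1] by auto
  have "(\<lambda>v. (cmod (coord (X M1) v - l v))\<^sup>2) summable_on UNIV"
    by (rule square_summableI[of _ "1\<^sup>2"], rule tail[OF _ _ M1]) auto
  from square_summable_add[OF this square_summable_coord[of "- X M1"]]
  have "(\<lambda>v. (cmod (l v))\<^sup>2) summable_on UNIV" by (simp add: norm_minus_commute)
  then have L: "coord (Abs_ell2 l) v = l v" for v by (simp add: coord_Abs_ell2)
  have "X \<longlonglongrightarrow> Abs_ell2 l"
  proof (rule metric_LIMSEQ_I)
    fix r :: real assume r: "0 < r"
    then obtain M where M: "\<And>m n. m \<ge> M \<Longrightarrow> n \<ge> M \<Longrightarrow> dist (X m) (X n) < r / 2"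
      using metric_CauchyD[OF C, of "r / 2"] by auto
    have "norm (X m - Abs_ell2 l) \<le> r / 2" if "m \<ge> M" for m
      by (rule norm_ell2_leI) (use r tail[OF _ _ M that] L in auto)
    then show "\<exists>no. \<forall>n\<ge>no. dist (X n) (Abs_ell2 l) < r"
      using r by (intro exI[of _ M]) (fastforce simp: dist_norm)
  qed
  then show "convergent X" by (auto simp: convergent_def)
qed

lemma norm_proj_on_le: "norm (blinfun_apply (proj_on S) f) \<le> norm f"
proof (rule norm_ell2_leI)
  fix F :: "'a set" assume F: "finite F"
  have "(\<Sum>v\<in>F. (cmod (coord (proj_on S f) v))\<^sup>2) \<le> (\<Sum>v\<in>F. (cmod (coord f v))\<^sup>2)"
    by (rule sum_mono) auto
  then show "(\<Sum>v\<in>F. (cmod (coord (proj_on S f) v))\<^sup>2) \<le> (norm f)\<^sup>2"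
    using sum_coord_le_norm[OF F, of f] by linarith
qed simp

lemma proj_on_idem [simp]: "proj_on S (proj_on S f) = proj_on S f"
  by (rule ell2_eqI) auto

lemma inner_proj_on: "proj_on S f \<bullet> g = f \<bullet> proj_on S g"
  unfolding inner_ell2_infsum by (rule infsum_cong) auto

text \<open>Density of finitely supported vectors, stated for all supersets \<open>T\<close>,
  infinite ones included: \<open>exhaustion_proj_on_tendsto\<close> applies it to a set containing
  the complement of the vertex set.\<close>

lemma norm_sub_proj_on_finite:
  assumes "0 < e"
  obtains S where "finite S" "\<And>T. S \<subseteq> T \<Longrightarrow> norm (f - proj_on T f) < e"
proof -
  have "((\<lambda>v. (cmod (coord f v))\<^sup>2) has_sum (norm f)\<^sup>2) UNIV"
    unfolding norm_ell2_infsum by (rule has_sum_infsum[OF square_summable_coord])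
  then have "\<forall>\<^sub>F S in finite_subsets_at_top UNIV. dist (\<Sum>v\<in>S. (cmod (coord f v))\<^sup>2) ((norm f)\<^sup>2) < (e/2)\<^sup>2"
    unfolding has_sum_def by (rule tendstoD) (use assms in auto)
  then obtain S where S: "finite S" "dist (\<Sum>v\<in>S. (cmod (coord f v))\<^sup>2) ((norm f)\<^sup>2) < (e/2)\<^sup>2"
    by (auto simp: eventually_finite_subsets_at_top)
  have "norm (f - proj_on T f) < e" if "S \<subseteq> T" for T
  proof -
    have "norm (f - proj_on T f) \<le> e / 2"
    proof (rule norm_ell2_leI)
      fix F :: "'a set" assume F: "finite F"
      have "(\<Sum>v\<in>F. (cmod (coord (f - proj_on T f) v))\<^sup>2)
          \<le> (\<Sum>v\<in>F. if v \<in> S then 0 else (cmod (coord f v))\<^sup>2)"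
        by (rule sum_mono) (use that in auto)
      also have "\<dots> = (\<Sum>v\<in>F-S. (cmod (coord f v))\<^sup>2)"
        by (rule sum.mono_neutral_cong_right) (use F in auto)
      finally have "(\<Sum>v\<in>F. (cmod (coord (f - proj_on T f) v))\<^sup>2) \<le> (\<Sum>v\<in>F-S. (cmod (coord f v))\<^sup>2)" .
      moreover have "(\<Sum>v\<in>F-S. (cmod (coord f v))\<^sup>2) + (\<Sum>v\<in>S. (cmod (coord f v))\<^sup>2) \<le> (norm f)\<^sup>2"
        using sum_coord_le_norm[of "(F - S) \<union> S" f] F S(1)
          sum.union_disjoint[of "F - S" S "\<lambda>v. (cmod (coord f v))\<^sup>2"]
        by (simp add: Diff_Int_distrib2)
      moreover have "(norm f)\<^sup>2 - (e/2)\<^sup>2 < (\<Sum>v\<in>S. (cmod (coord f v))\<^sup>2)"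
        using S(2) unfolding dist_real_def by linarith
      ultimately show "(\<Sum>v\<in>F. (cmod (coord (f - proj_on T f) v))\<^sup>2) \<le> (e/2)\<^sup>2" by linarith
    qed (use assms in auto)
    then show ?thesis using assms by linarith
  qed
  then show ?thesis by (rule that[OF S(1)])
qed


section \<open>Self-adjoint operators\<close>

text \<open>The inner product is the real part of the Hermitian one. For complex-linear
  \<open>T\<close> this is ordinary self-adjointness, as replacing \<open>g\<close> by i times
  \<open>g\<close> recovers the imaginary part.\<close>

definition self_adjoint :: "'v operator \<Rightarrow> bool" where
  "self_adjoint T \<longleftrightarrow> (\<forall>f g. T f \<bullet> g = f \<bullet> T g)"

text \<open>Expresses that \<open>T\<close> is an operator on the subspace of functions supported in
  \<open>V\<close>, extended by 0; \<open>proj_on V\<close> is then a two-sided unit for it.\<close>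

definition operator_on :: "'v set \<Rightarrow> 'v operator \<Rightarrow> bool" where
  "operator_on V T \<longleftrightarrow> (\<forall>f. proj_on V (T f) = T f \<and> T (proj_on V f) = T f)"

definition bounded_below :: "'v set \<Rightarrow> 'v operator \<Rightarrow> bool" where
  "bounded_below V T \<longleftrightarrow> (\<exists>c>0. \<forall>f. proj_on V f = f \<longrightarrow> c * norm f \<le> norm (T f))"

lemma self_adjointD: "self_adjoint T \<Longrightarrow> T f \<bullet> g = f \<bullet> T g"
  by (simp add: self_adjoint_def)

lemma operator_onD:
  assumes "operator_on V T"
  shows "proj_on V (T f) = T f" "T (proj_on V f) = T f"
  using assms by (auto simp: operator_on_def)

lemma operator_on_proj_on [simp]: "operator_on V (proj_on V)"
  by (simp add: operator_on_def)

lemma operator_on_add: "operator_on V S \<Longrightarrow> operator_on V T \<Longrightarrow> operator_on V (S + T)"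
  by (simp add: operator_on_def blinfun.bilinear_simps)

lemma operator_on_diff: "operator_on V S \<Longrightarrow> operator_on V T \<Longrightarrow> operator_on V (S - T)"
  by (simp add: operator_on_def blinfun.bilinear_simps)

lemma operator_on_scaleR: "operator_on V T \<Longrightarrow> operator_on V (r *\<^sub>R T)"
  by (simp add: operator_on_def blinfun.bilinear_simps)

lemma operator_on_compose: "operator_on V S \<Longrightarrow> operator_on V T \<Longrightarrow> operator_on V (S o\<^sub>L T)"
  by (simp add: operator_on_def)

lemma self_adjoint_proj_on [simp]: "self_adjoint (proj_on V)"
  by (simp add: self_adjoint_def inner_proj_on)

lemma self_adjoint_add: "self_adjoint S \<Longrightarrow> self_adjoint T \<Longrightarrow> self_adjoint (S + T)"
  by (simp add: self_adjoint_def blinfun.bilinear_simps inner_add_left inner_add_right)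

lemma self_adjoint_diff: "self_adjoint S \<Longrightarrow> self_adjoint T \<Longrightarrow> self_adjoint (S - T)"
  by (simp add: self_adjoint_def blinfun.bilinear_simps inner_diff_left inner_diff_right)

lemma self_adjoint_scaleR: "self_adjoint T \<Longrightarrow> self_adjoint (r *\<^sub>R T)"
  by (simp add: self_adjoint_def blinfun.bilinear_simps)

section \<open>Norms and inverses of self-adjoint operators\<close>

lemma norm_proj_on_blinfun: "norm (proj_on V) \<le> 1"
  by (rule norm_blinfun_bound) (auto simp: norm_proj_on_le)

text \<open>Polarization: 4 times \<open>T f \<bullet> g\<close> is the difference of the quadratic
  forms at \<open>f + g\<close> and \<open>f - g\<close>, and the parallelogram law bounds that
  difference.\<close>

lemma norm_self_adjoint_le:
  assumes sa: "self_adjoint T" and M: "0 \<le> M" and form: "\<And>f. \<bar>T f \<bullet> f\<bar> \<le> M * (norm f)\<^sup>2"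
  shows "norm T \<le> M"
proof (rule norm_blinfun_bound[OF M])
  fix f
  show "norm (T f) \<le> M * norm f"
  proof (cases "T f = 0")
    case True then show ?thesis using M by simp
  next
    case False
    then have f: "f \<noteq> 0" by auto
    \<comment> \<open>The direction of \<open>T f\<close> with the length of \<open>f\<close>: then
      \<open>T f \<bullet> g\<close> equals \<open>norm f * norm (T f)\<close>, and the
      parallelogram law gives exactly \<open>4 * (M * (norm f)\<^sup>2)\<close>.\<close>
    define g where "g = (norm f / norm (T f)) *\<^sub>R T f"
    have ng: "norm g = norm f" using False by (simp add: g_def)
    have "T f \<bullet> g = norm f * norm (T f)"
      using False by (simp add: g_def power2_norm_eq_inner[symmetric] power2_eq_square)
    moreover have "4 * (T f \<bullet> g) = T (f + g) \<bullet> (f + g) - T (f - g) \<bullet> (f - g)"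
      using self_adjointD[OF sa, of f g]
      by (simp add: blinfun.bilinear_simps inner_add_left inner_add_right inner_diff_left inner_diff_right
          inner_commute)
    moreover have "T (f + g) \<bullet> (f + g) \<le> M * (norm (f + g))\<^sup>2" using form[of "f + g"] by linarith
    moreover have "- (T (f - g) \<bullet> (f - g)) \<le> M * (norm (f - g))\<^sup>2" using form[of "f - g"] by linarith
    moreover have "M * (norm (f + g))\<^sup>2 + M * (norm (f - g))\<^sup>2 = 4 * (M * (norm f)\<^sup>2)"
    proof -
      have "(norm (f + g))\<^sup>2 + (norm (f - g))\<^sup>2 = 2 * (norm f)\<^sup>2 + 2 * (norm g)\<^sup>2"
        unfolding power2_norm_eq_inner
        by (simp add: inner_add_left inner_add_right inner_diff_left inner_diff_right inner_commute)
      then show ?thesis using ng by (simp add: distrib_left[symmetric])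
    qed
    ultimately have "norm f * norm (T f) \<le> norm f * (M * norm f)"
      by (simp add: power2_eq_square mult.left_commute)
    then show ?thesis using f by simp
  qed
qed

lemma neumann_inverse:
  assumes E: "operator_on V E" and n: "norm E < 1"
  obtains R where "operator_on V R" "R o\<^sub>L (proj_on V - E) = proj_on V" "(proj_on V - E) o\<^sub>L R = proj_on V"
proof -
  define a where "a i = ((o\<^sub>L) E ^^ i) (proj_on V)" for i
  have a0: "a 0 = proj_on V" and aS: "a (Suc i) = E o\<^sub>L a i" for i by (simp_all add: a_def)
  have aon: "operator_on V (a i)" for i
    by (induction i) (auto simp: a0 aS E operator_on_compose)
  have aE: "a i o\<^sub>L E = a (Suc i)" for i
  proof (induction i)
    case 0 show ?case by (rule blinfun_eqI) (simp add: a0 aS operator_onD[OF E])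
  next
    case (Suc i)
    have "a (Suc i) o\<^sub>L E = E o\<^sub>L (a i o\<^sub>L E)" by (rule blinfun_eqI) (simp add: aS)
    then show ?case using Suc by (simp add: aS)
  qed
  have "norm (a i) \<le> norm E ^ i" for i
  proof (induction i)
    case 0 then show ?case by (simp add: a0 norm_proj_on_blinfun)
  next
    case (Suc i)
    have "norm (a (Suc i)) \<le> norm E * norm (a i)" by (simp add: aS norm_blinfun_compose)
    also have "\<dots> \<le> norm E * norm E ^ i" using Suc by (intro mult_left_mono) auto
    finally show ?case by simp
  qed
  then have sm: "summable a"
    by (intro summable_comparison_test[OF _ summable_geometric[of "norm E"]]) (use n in auto)
  define R where "R = suminf a"
  have "E o\<^sub>L R = (\<Sum>i. a (Suc i))"
    unfolding R_def aS
    by (rule bounded_linear.suminf[OF bounded_bilinear.bounded_linear_right[OF bounded_bilinear_blinfun_compose] sm])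
  then have 1: "E o\<^sub>L R = R - proj_on V" using suminf_split_head[OF sm] by (simp add: R_def a0)
  have "R o\<^sub>L E = (\<Sum>i. a i o\<^sub>L E)" unfolding R_def
    by (rule bounded_linear.suminf[OF bounded_bilinear.bounded_linear_left[OF bounded_bilinear_blinfun_compose] sm])
  then have 2: "R o\<^sub>L E = R - proj_on V" using suminf_split_head[OF sm] by (simp add: R_def a0 aE)
  have "proj_on V o\<^sub>L R = (\<Sum>i. proj_on V o\<^sub>L a i)" unfolding R_def
    by (rule bounded_linear.suminf[OF bounded_bilinear.bounded_linear_right[OF bounded_bilinear_blinfun_compose] sm])
  also have "(\<lambda>i. proj_on V o\<^sub>L a i) = a" by (intro ext blinfun_eqI) (simp add: operator_onD[OF aon])
  finally have 3: "proj_on V o\<^sub>L R = R" by (simp add: R_def)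
  have "R o\<^sub>L proj_on V = (\<Sum>i. a i o\<^sub>L proj_on V)" unfolding R_def
    by (rule bounded_linear.suminf[OF bounded_bilinear.bounded_linear_left[OF bounded_bilinear_blinfun_compose] sm])
  also have "(\<lambda>i. a i o\<^sub>L proj_on V) = a" by (intro ext blinfun_eqI) (simp add: operator_onD[OF aon])
  finally have 4: "R o\<^sub>L proj_on V = R" by (simp add: R_def)
  show ?thesis
  proof
    show "operator_on V R" unfolding operator_on_def
      using arg_cong[OF 3, of blinfun_apply] arg_cong[OF 4, of blinfun_apply] by (auto simp: fun_eq_iff)
    show "R o\<^sub>L (proj_on V - E) = proj_on V"
      by (simp add: bounded_bilinear.diff_right[OF bounded_bilinear_blinfun_compose] 2 4)
    show "(proj_on V - E) o\<^sub>L R = proj_on V"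
      by (simp add: bounded_bilinear.diff_left[OF bounded_bilinear_blinfun_compose] 1 3)
  qed
qed

text \<open>The form of S^2 on the subspace lies between c^2 and norm(S)^2, so S^2, suitably scaled,
  is a perturbation of the identity of norm below 1 and the Neumann series inverts it. As that
  inverse commutes with S, a further factor S turns it into a two-sided inverse of S.\<close>

lemma self_adjoint_bounded_below_invertible:
  assumes sa: "self_adjoint S" and on: "operator_on V S" and bb: "bounded_below V S"
  obtains R where "operator_on V R" "R o\<^sub>L S = proj_on V" "S o\<^sub>L R = proj_on V"
proof -
  obtain c where c: "c > 0" "\<And>f. proj_on V f = f \<Longrightarrow> c * norm f \<le> norm (S f)"
    using bb by (auto simp: bounded_below_def)
  \<comment> \<open>Chosen to dominate both squares and to be positive even if \<open>S = 0\<close>: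
    the form of \<open>E\<close> then lies between 0 and 1 - c^2/C.\<close>
  define C where "C = (norm S)\<^sup>2 + c\<^sup>2"
  have C: "C > 0" "c\<^sup>2 \<le> C" "(norm S)\<^sup>2 \<le> C" using c(1) by (auto simp: C_def add_nonneg_pos)
  define E where "E = proj_on V - (1 / C) *\<^sub>R (S o\<^sub>L S)"
  have Eon: "operator_on V E" unfolding E_def
    by (intro operator_on_diff operator_on_scaleR operator_on_compose on operator_on_proj_on)
  have "self_adjoint (S o\<^sub>L S)" using sa by (simp add: self_adjoint_def)
  then have Esa: "self_adjoint E" unfolding E_def
    by (intro self_adjoint_diff self_adjoint_scaleR self_adjoint_proj_on)
  have "norm E \<le> 1 - c\<^sup>2 / C"
  proof (rule norm_self_adjoint_le[OF Esa])
    show "0 \<le> 1 - c\<^sup>2 / C" using C by simp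
    fix f
    let ?p = "proj_on V f"
    have "E f \<bullet> f = ?p \<bullet> f - (1 / C) * (S (S f) \<bullet> f)"
      by (simp add: E_def blinfun.bilinear_simps inner_diff_left)
    also have "?p \<bullet> f = (norm ?p)\<^sup>2"
      using inner_proj_on[of V "proj_on V f" f] by (simp add: power2_norm_eq_inner)
    also have "S (S f) \<bullet> f = (norm (S ?p))\<^sup>2"
      using self_adjointD[OF sa, of "S f" f] by (simp add: power2_norm_eq_inner operator_onD[OF on])
    finally have eq: "E f \<bullet> f = (norm ?p)\<^sup>2 - (1 / C) * (norm (S ?p))\<^sup>2" .
    have "(c * norm ?p)\<^sup>2 \<le> (norm (S ?p))\<^sup>2" using c by (intro power_mono) auto
    then have lo: "c\<^sup>2 / C * (norm ?p)\<^sup>2 \<le> (1 / C) * (norm (S ?p))\<^sup>2"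
      using C(1) by (simp add: power_mult_distrib divide_right_mono)
    have "(norm (S ?p))\<^sup>2 \<le> (norm S * norm ?p)\<^sup>2" by (intro power_mono norm_blinfun) auto
    also have "\<dots> \<le> C * (norm ?p)\<^sup>2" using C(3) by (simp add: power_mult_distrib mult_right_mono)
    finally have hi: "(1 / C) * (norm (S ?p))\<^sup>2 \<le> (norm ?p)\<^sup>2" using C(1) by (simp add: field_simps)
    have "\<bar>E f \<bullet> f\<bar> \<le> (1 - c\<^sup>2 / C) * (norm ?p)\<^sup>2" using eq lo hi by (simp add: left_diff_distrib)
    also have "\<dots> \<le> (1 - c\<^sup>2 / C) * (norm f)\<^sup>2"
      using C by (intro mult_left_mono power_mono norm_proj_on_le) auto
    finally show "\<bar>E f \<bullet> f\<bar> \<le> (1 - c\<^sup>2 / C) * (norm f)\<^sup>2" .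
  qed
  moreover have "c\<^sup>2 / C > 0" using c C by simp
  ultimately have "norm E < 1" by linarith
  then obtain R0 where R0: "operator_on V R0" "R0 o\<^sub>L (proj_on V - E) = proj_on V" "(proj_on V - E) o\<^sub>L R0 = proj_on V"
    using neumann_inverse[OF Eon] by blast
  have PE: "proj_on V - E = (1 / C) *\<^sub>R (S o\<^sub>L S)" by (simp add: E_def)
  have l: "(1 / C) *\<^sub>R R0 (S (S f)) = proj_on V f" for f
    using arg_cong[OF R0(2), of "\<lambda>T. blinfun_apply T f"] by (simp add: PE blinfun.bilinear_simps)
  have r: "(1 / C) *\<^sub>R S (S (R0 f)) = proj_on V f" for f
    using arg_cong[OF R0(3), of "\<lambda>T. blinfun_apply T f"] by (simp add: PE blinfun.bilinear_simps)
  \<comment> \<open>Insert the right inverse identity \<open>r\<close> behind \<open>S\<close>, then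
    cancel the left inverse identity \<open>l\<close> in front.\<close>
  have comm: "R0 (S f) = S (R0 f)" for f
  proof -
    have "R0 (S f) = R0 (S ((1 / C) *\<^sub>R S (S (R0 f))))" by (simp add: r operator_onD[OF on])
    also have "\<dots> = (1 / C) *\<^sub>R R0 (S (S (S (R0 f))))" by (simp add: blinfun.bilinear_simps)
    also have "\<dots> = S (R0 f)" by (simp only: l operator_onD[OF on])
    finally show ?thesis .
  qed
  show ?thesis
  proof
    show "operator_on V ((1 / C) *\<^sub>R (R0 o\<^sub>L S))"
      by (intro operator_on_scaleR operator_on_compose on R0)
    show "(1 / C) *\<^sub>R (R0 o\<^sub>L S) o\<^sub>L S = proj_on V"
      by (rule blinfun_eqI) (simp add: blinfun.bilinear_simps l)
    show "S o\<^sub>L (1 / C) *\<^sub>R (R0 o\<^sub>L S) = proj_on V"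
      by (rule blinfun_eqI) (simp add: blinfun.bilinear_simps comm r)
  qed
qed

section \<open>Location of the spectrum and lower bounds off the spectrum\<close>

lemma not_in_spectrumI:
  assumes "self_adjoint T" "operator_on V T"
    and c: "c > 0" "\<And>f. proj_on V f = f \<Longrightarrow> c * norm f \<le> norm (z *\<^sub>R f - T f)"
  shows "z \<notin> spectrum V T"
proof -
  let ?S = "z *\<^sub>R proj_on V - T"
  have "bounded_below V ?S" unfolding bounded_below_def
    using c by (intro exI[of _ c]) (simp add: blinfun.bilinear_simps)
  moreover have "self_adjoint ?S" "operator_on V ?S"
    by (intro self_adjoint_diff self_adjoint_scaleR self_adjoint_proj_on assms
          operator_on_diff operator_on_scaleR operator_on_proj_on)+
  ultimately obtain R where R: "operator_on V R" "R o\<^sub>L ?S = proj_on V" "?S o\<^sub>L R = proj_on V"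
    using self_adjoint_bounded_below_invertible by blast
  have "proj_on V o\<^sub>L R o\<^sub>L proj_on V = R"
    by (rule blinfun_eqI) (simp add: operator_onD[OF R(1)])
  with R show ?thesis unfolding spectrum_def by blast
qed

lemma spectrum_le_norm:
  assumes "self_adjoint T" "operator_on V T" "z \<in> spectrum V T"
  shows "\<bar>z\<bar> \<le> norm T"
proof (rule ccontr)
  assume "\<not> \<bar>z\<bar> \<le> norm T"
  moreover have "(\<bar>z\<bar> - norm T) * norm f \<le> norm (z *\<^sub>R f - T f)" for f
    using norm_triangle_ineq2[of "z *\<^sub>R f" "T f"] norm_blinfun[of T f] by (simp add: left_diff_distrib)
  ultimately have "z \<notin> spectrum V T"
    by (intro not_in_spectrumI[OF assms(1,2), of "\<bar>z\<bar> - norm T"]) auto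
  with assms(3) show False by simp
qed

lemma spectrum_nonneg:
  assumes "self_adjoint T" "operator_on V T" "\<And>f. 0 \<le> T f \<bullet> f" "z \<in> spectrum V T"
  shows "0 \<le> z"
proof (rule ccontr)
  assume z: "\<not> 0 \<le> z"
  have "(- z) * norm f \<le> norm (z *\<^sub>R f - T f)" for f
  proof (cases "f = 0")
    case False
    have "(- z) * (norm f)\<^sup>2 \<le> (T f - z *\<^sub>R f) \<bullet> f"
      using assms(3)[of f] by (simp add: inner_diff_left power2_norm_eq_inner)
    also have "\<dots> \<le> norm (T f - z *\<^sub>R f) * norm f" by (rule norm_cauchy_schwarz)
    finally have "((- z) * norm f) * norm f \<le> norm (T f - z *\<^sub>R f) * norm f"
      by (simp only: power2_eq_square mult.assoc)
    then show ?thesis using False by (simp only: mult_le_cancel_right norm_minus_commute) auto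
  qed simp
  then have "z \<notin> spectrum V T"
    using z by (intro not_in_spectrumI[OF assms(1,2), of "- z"]) auto
  with assms(4) show False by simp
qed

lemma not_in_spectrum_bounded_below:
  assumes "r \<notin> spectrum V T"
  shows "bounded_below V (T - r *\<^sub>R proj_on V)"
proof -
  obtain R where R: "R o\<^sub>L (r *\<^sub>R proj_on V - T) = proj_on V"
    using assms by (auto simp: spectrum_def)
  have "1 / (norm R + 1) * norm f \<le> norm ((T - r *\<^sub>R proj_on V) f)" if f: "proj_on V f = f" for f
  proof -
    have "f = R ((r *\<^sub>R proj_on V - T) f)"
      using arg_cong[OF R, of "\<lambda>T. blinfun_apply T f"] f by simp
    then have "norm f \<le> norm R * norm ((r *\<^sub>R proj_on V - T) f)" using norm_blinfun by metis
    also have "\<dots> \<le> (norm R + 1) * norm ((r *\<^sub>R proj_on V - T) f)" by (intro mult_right_mono) auto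
    also have "norm ((r *\<^sub>R proj_on V - T) f) = norm ((T - r *\<^sub>R proj_on V) f)"
      by (simp add: blinfun.bilinear_simps norm_minus_commute)
    finally show ?thesis by (simp add: pos_divide_le_eq add_nonneg_pos mult.commute)
  qed
  then show ?thesis unfolding bounded_below_def
    by (intro exI[of _ "1 / (norm R + 1)"]) (auto simp: add_nonneg_pos)
qed

lemma bounded_below_compose:
  assumes "bounded_below V A" "bounded_below V B" "operator_on V B"
  shows "bounded_below V (A o\<^sub>L B)"
proof -
  obtain a where a: "a > 0" "\<And>f. proj_on V f = f \<Longrightarrow> a * norm f \<le> norm (A f)"
    using assms(1) by (auto simp: bounded_below_def)
  obtain b where b: "b > 0" "\<And>f. proj_on V f = f \<Longrightarrow> b * norm f \<le> norm (B f)"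
    using assms(2) by (auto simp: bounded_below_def)
  have "a * b * norm f \<le> norm ((A o\<^sub>L B) f)" if f: "proj_on V f = f" for f
  proof -
    have "a * (b * norm f) \<le> a * norm (B f)" using a b(2)[OF f] by (intro mult_left_mono) auto
    also have "\<dots> \<le> norm (A (B f))" by (rule a(2)) (rule operator_onD[OF assms(3)])
    finally show ?thesis by (simp add: mult.assoc)
  qed
  then show ?thesis unfolding bounded_below_def using a b by (intro exI[of _ "a * b"]) auto
qed


subsection \<open>Polynomials of operators\<close>

lemma poly_op_eq_sum:
  assumes "degree p \<le> n"
  shows "poly_op V p T = (\<Sum>i\<le>n. coeff p i *\<^sub>R (((o\<^sub>L) T ^^ i) (proj_on V)))"
  unfolding poly_op_def
  by (rule sum.mono_neutral_left) (use assms in \<open>auto simp: coeff_eq_0\<close>)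

lemma poly_op_0 [simp]: "poly_op V 0 T = 0"
  by (simp add: poly_op_def)

lemma poly_op_add: "poly_op V (p + q) T = poly_op V p T + poly_op V q T"
proof -
  let ?n = "max (degree p) (degree q)"
  have "degree (p + q) \<le> ?n" by (rule degree_add_le) auto
  then show ?thesis
    by (simp add: poly_op_eq_sum[of _ ?n] scaleR_add_left sum.distrib)
qed

lemma poly_op_smult: "poly_op V (smult a p) T = a *\<^sub>R poly_op V p T"
proof -
  have "degree (smult a p) \<le> degree p" by (rule degree_smult_le)
  then show ?thesis by (simp add: poly_op_eq_sum[of _ "degree p"] scaleR_sum_right)
qed

lemma poly_op_diff: "poly_op V (p - q) T = poly_op V p T - poly_op V q T"
  using poly_op_add[of V "p - q" q T] by simp

lemma poly_op_pCons: "poly_op V (pCons a p) T = a *\<^sub>R proj_on V + (T o\<^sub>L poly_op V p T)"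
proof -
  have "degree (pCons a p) \<le> Suc (degree p)" by (rule degree_pCons_le)
  then have "poly_op V (pCons a p) T = (\<Sum>i\<le>Suc (degree p). coeff (pCons a p) i *\<^sub>R (((o\<^sub>L) T ^^ i) (proj_on V)))"
    by (rule poly_op_eq_sum)
  also have "\<dots> = a *\<^sub>R proj_on V + (\<Sum>i\<le>degree p. coeff p i *\<^sub>R (T o\<^sub>L ((o\<^sub>L) T ^^ i) (proj_on V)))"
    by (subst sum.atMost_Suc_shift) simp
  also have "(\<Sum>i\<le>degree p. coeff p i *\<^sub>R (T o\<^sub>L ((o\<^sub>L) T ^^ i) (proj_on V))) = T o\<^sub>L poly_op V p T"
    by (simp add: poly_op_def bounded_bilinear.sum_right[OF bounded_bilinear_blinfun_compose]
        bounded_bilinear.scaleR_right[OF bounded_bilinear_blinfun_compose])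
  finally show ?thesis .
qed

lemma poly_op_1: "poly_op V 1 T = proj_on V"
  by (simp add: poly_op_pCons one_pCons)

lemma operator_on_poly_op:
  assumes "operator_on V T"
  shows "operator_on V (poly_op V p T)"
proof (induction p)
  case 0 then show ?case by (simp add: operator_on_def)
next
  case (pCons a p)
  then show ?case unfolding poly_op_pCons
    by (intro operator_on_add operator_on_scaleR operator_on_compose assms operator_on_proj_on)
qed

lemma poly_op_mult:
  assumes "operator_on V T"
  shows "poly_op V (p * q) T = poly_op V p T o\<^sub>L poly_op V q T"
proof (induction p)
  case (pCons a p)
  show ?case
    by (rule blinfun_eqI)
      (simp add: mult_pCons_left poly_op_add poly_op_smult poly_op_pCons pCons(2) blinfun.bilinear_simps
        operator_onD[OF operator_on_poly_op[OF assms]])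
qed simp

lemma poly_op_X:
  assumes "operator_on V T"
  shows "poly_op V [:0, 1:] T = T"
  by (rule blinfun_eqI) (simp add: poly_op_pCons operator_onD[OF assms])

lemma poly_op_commute:
  assumes "operator_on V T"
  shows "T (poly_op V p T f) = poly_op V p T (T f)"
proof -
  have "poly_op V [:0, 1:] T o\<^sub>L poly_op V p T = poly_op V p T o\<^sub>L poly_op V [:0, 1:] T"
    by (simp only: poly_op_mult[OF assms, symmetric] mult.commute)
  then show ?thesis unfolding poly_op_X[OF assms]
    by (auto dest: arg_cong[of _ _ "\<lambda>S. blinfun_apply S f"])
qed

lemma self_adjoint_poly_op:
  assumes sa: "self_adjoint T" and on: "operator_on V T"
  shows "self_adjoint (poly_op V p T)"
proof (induction p)
  case 0 then show ?case by (simp add: self_adjoint_def)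
next
  case (pCons a p)
  have "self_adjoint (T o\<^sub>L poly_op V p T)"
    using self_adjointD[OF sa] self_adjointD[OF pCons(2)]
    by (simp add: self_adjoint_def poly_op_commute[OF on])
  then show ?case unfolding poly_op_pCons
    by (intro self_adjoint_add self_adjoint_scaleR self_adjoint_proj_on)
qed

text \<open>Turns polynomials in \<open>c *\<^sub>R proj_on V - T\<close> into polynomials in
  \<open>T\<close>, so that a Hamiltonian inherits its moments from the adjacency operator.\<close>

lemma poly_op_pcompose:
  assumes "operator_on V T"
  shows "poly_op V (pcompose p q) T = poly_op V p (poly_op V q T)"
proof (induction p)
  case (pCons a p)
  then show ?case
    by (simp add: pcompose_pCons poly_op_add poly_op_mult[OF assms] poly_op_pCons)
qed simp

text \<open>A complex root from the fundamental theorem of algebra either is real and splits off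
  linearly, or brings its conjugate along and splits off as a real quadratic. The local
  \<open>ev\<close> evaluates a real polynomial at a complex point.\<close>

lemma real_poly_root_cases:
  fixes p :: "real poly"
  assumes "degree p > 0"
  obtains (linear) r q where "p = [:- r, 1:] * q"
  | (quadratic) a b q where "b \<noteq> 0" "p = [:a\<^sup>2 + b\<^sup>2, - 2 * a, 1:] * q"
proof -
  define ev :: "complex \<Rightarrow> real poly \<Rightarrow> complex" where "ev z p = poly (map_poly of_real p) z" for z p
  have ev0: "ev z 0 = 0" and evp: "ev z (pCons a p) = of_real a + z * ev z p" for z a p
    by (simp_all add: ev_def map_poly_pCons)
  have eva: "ev z (p + q) = ev z p + ev z q" for z p q
    by (induction p q rule: poly_induct2) (simp_all add: ev0 evp algebra_simps)
  have evs: "ev z (smult c p) = of_real c * ev z p" for z c p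
    by (induction p) (simp_all add: ev0 evp algebra_simps)
  have evm: "ev z (p * q) = ev z p * ev z q" for z p q
    by (induction p) (simp_all add: ev0 evp eva evs algebra_simps)
  have evr: "ev (of_real r) p = of_real (poly p r)" for r p
    by (induction p) (simp_all add: ev0 evp)
  have "degree (map_poly of_real p :: complex poly) = degree p" by (rule degree_map_poly) simp
  then have "\<not> constant (poly (map_poly of_real p :: complex poly))"
    using assms by (simp add: constant_degree)
  then obtain z where z: "ev z p = 0" unfolding ev_def using fundamental_theorem_of_algebra by blast
  show thesis
  proof (cases "Im z = 0")
    case True
    then have "z = of_real (Re z)" by (simp add: complex_eq_iff)
    then have "poly p (Re z) = 0" using z evr[of "Re z" p] by simp
    then show thesis using linear by (auto simp: poly_eq_0_iff_dvd elim: dvdE)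
  next
    case False
    \<comment> \<open>The real quadratic with roots \<open>z\<close> and its conjugate. The
      remainder modulo it has degree at most 1 and vanishes at the nonreal \<open>z\<close>, so it
      is 0.\<close>
    let ?q = "[:(Re z)\<^sup>2 + (Im z)\<^sup>2, - 2 * Re z, 1:]"
    define r where "r = p mod ?q"
    have "r = 0 \<or> degree r < degree ?q" unfolding r_def by (rule degree_mod_less) simp
    then have "degree r \<le> 1" by auto
    then obtain r0 r1 where r: "r = [:r0, r1:]"
      by (cases r rule: pCons_cases) (metis One_nat_def Suc_le_mono degree_eq_zeroE degree_pCons_eq_if le_zero_eq pCons_0_0)
    have "p = ?q * (p div ?q) + r" unfolding r_def by (rule mult_div_mod_eq[symmetric])
    then have "ev z p = ev z ?q * ev z (p div ?q) + ev z r" by (metis eva evm)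
    moreover have "ev z ?q = 0" by (simp add: evp ev0 complex_eq_iff power2_eq_square algebra_simps)
    ultimately have "ev z r = 0" using z by simp
    then have "r1 = 0 \<and> r0 = 0" using False by (auto simp: r evp ev0 complex_eq_iff)
    then have "p = ?q * (p div ?q)" using \<open>p = ?q * (p div ?q) + r\<close> r by simp
    then show thesis by (rule quadratic[OF False])
  qed
qed

text \<open>Induction on the degree, peeling off one real factor at a time. A real root of
  \<open>p\<close> lies off the spectrum, so its factor is bounded below; a quadratic factor with
  nonreal roots is bounded below for every self-adjoint \<open>T\<close>.\<close>

lemma bounded_below_poly_op:
  assumes sa: "self_adjoint T" and on: "operator_on V T"
    and "p \<noteq> 0" "\<And>r. r \<in> spectrum V T \<Longrightarrow> poly p r \<noteq> 0"
  shows "bounded_below V (poly_op V p T)"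
  using assms(3,4)
proof (induction "degree p" arbitrary: p rule: less_induct)
  case less
  show ?case
  proof (cases "degree p = 0")
    case True
    then obtain a where a: "p = [:a:]" "a \<noteq> 0" using less.prems(1) by (metis degree_eq_zeroE pCons_0_0)
    then show ?thesis unfolding bounded_below_def
      by (intro exI[of _ "\<bar>a\<bar>"]) (simp add: poly_op_pCons blinfun.bilinear_simps)
  next
    case False
    have step: ?thesis if p: "p = s * q" and s: "degree s > 0" "bounded_below V (poly_op V s T)" for s q
    proof -
      have "q \<noteq> 0" "s \<noteq> 0" using less.prems(1) p by auto
      then have "degree q < degree p" using s(1) p by (simp add: degree_mult_eq)
      moreover have "poly q r \<noteq> 0" if "r \<in> spectrum V T" for r using less.prems(2)[OF that] p by simp
      ultimately have "bounded_below V (poly_op V q T)" using less.hyps \<open>q \<noteq> 0\<close> by blast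
      then show ?thesis unfolding p poly_op_mult[OF on]
        by (intro bounded_below_compose s operator_on_poly_op on)
    qed
    from False have "degree p > 0" by simp
    then show ?thesis
    proof (cases rule: real_poly_root_cases)
      case (linear r q)
      have "poly p r = 0" by (simp add: linear)
      then have "r \<notin> spectrum V T" using less.prems(2) by blast
      then have "bounded_below V (T - r *\<^sub>R proj_on V)" by (rule not_in_spectrum_bounded_below)
      also have "T - r *\<^sub>R proj_on V = poly_op V [:- r, 1:] T"
        by (rule blinfun_eqI) (simp add: poly_op_pCons blinfun.bilinear_simps operator_onD[OF on])
      finally show ?thesis by (rule step[OF linear, rotated]) simp
    next
      case (quadratic a b q)
      have "b\<^sup>2 * norm f \<le> norm (poly_op V [:a\<^sup>2 + b\<^sup>2, - 2 * a, 1:] T f)" if f: "proj_on V f = f" for f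
      proof (cases "f = 0")
        case False
        let ?g = "poly_op V [:a\<^sup>2 + b\<^sup>2, - 2 * a, 1:] T f"
        have g: "?g = (a\<^sup>2 + b\<^sup>2) *\<^sub>R f - (2 * a) *\<^sub>R T f + T (T f)"
          using f by (simp add: poly_op_pCons blinfun.bilinear_simps operator_onD[OF on])
        have "T (T f) \<bullet> f = T f \<bullet> T f" by (rule self_adjointD[OF sa])
        \<comment> \<open>Completing the square: the factor is (T - a)^2 + b^2, which is why b^2
          serves as the lower bound.\<close>
        then have "?g \<bullet> f = (norm (T f - a *\<^sub>R f))\<^sup>2 + b\<^sup>2 * (norm f)\<^sup>2"
          unfolding g power2_norm_eq_inner
          by (simp add: inner_add_left inner_diff_left inner_diff_right inner_commute algebra_simps power2_eq_square)
        then have "b\<^sup>2 * (norm f)\<^sup>2 \<le> ?g \<bullet> f" by simp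
        also have "\<dots> \<le> norm ?g * norm f" by (rule norm_cauchy_schwarz)
        finally show ?thesis using False by (simp add: power2_eq_square mult.assoc[symmetric])
      qed simp
      then have "bounded_below V (poly_op V [:a\<^sup>2 + b\<^sup>2, - 2 * a, 1:] T)"
        unfolding bounded_below_def using quadratic(1) by (intro exI[of _ "b\<^sup>2"]) auto
      then show ?thesis by (rule step[OF quadratic(2), rotated]) simp
    qed
  qed
qed

text \<open>If L, the norm of S = p(T), exceeded M, then L^2 - p^2 would have no zero on the
  spectrum and L^2 - S^2 would be bounded below. For self-adjoint S this pushes the norm of S
  strictly below L. A positive degree ensures that L^2 - p^2 is not the zero polynomial.\<close>

lemma norm_poly_op_le_nonconstant:
  assumes sa: "self_adjoint T" and on: "operator_on V T"
    and deg: "degree p > 0" and M: "0 \<le> M" "\<And>r. r \<in> spectrum V T \<Longrightarrow> \<bar>poly p r\<bar> \<le> M"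
  shows "norm (poly_op V p T) \<le> M"
proof (rule ccontr)
  define S where "S = poly_op V p T"
  define L where "L = norm S"
  assume "\<not> norm (poly_op V p T) \<le> M"
  then have L: "M < L" "0 < L" using M(1) by (auto simp: L_def S_def)
  have Ssa: "self_adjoint S" unfolding S_def by (rule self_adjoint_poly_op[OF sa on])
  have Son: "operator_on V S" unfolding S_def by (rule operator_on_poly_op[OF on])
  let ?q = "[:L\<^sup>2:] - p * p"
  have q: "poly ?q r \<noteq> 0" if "r \<in> spectrum V T" for r
  proof -
    have "\<bar>poly p r\<bar>\<^sup>2 \<le> M\<^sup>2" using M(2)[OF that] by (intro power_mono) auto
    also have "\<dots> < L\<^sup>2" using L M(1) by (intro power_strict_mono) auto
    finally show ?thesis by (simp add: power2_eq_square)
  qed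
  have "?q \<noteq> 0"
  proof
    assume q0: "?q = 0"
    then have "degree (p * p) = 0" by (metis degree_pCons_0 eq_iff_diff_eq_0)
    then show False using deg by (cases "p = 0") (auto simp: degree_mult_eq)
  qed
  have "bounded_below V (poly_op V ?q T)"
    by (rule bounded_below_poly_op[OF sa on \<open>?q \<noteq> 0\<close> q])
  then obtain c where c: "c > 0" "\<And>f. proj_on V f = f \<Longrightarrow> c * norm f \<le> norm (poly_op V ?q T f)"
    by (auto simp: bounded_below_def)
  \<comment> \<open>The relative gain in the estimate below: at most c^2/L^4, and at most 1 so that
    \<open>sqrt (1 - b)\<close> is meaningful.\<close>
  define b where "b = min 1 (c\<^sup>2 / L ^ 4)"
  have b: "0 < b" "b \<le> 1" "b * L ^ 4 \<le> c\<^sup>2" using c(1) L(2) by (auto simp: b_def min_def field_simps)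
  \<comment> \<open>Expanding |L^2 f - S^2 f|^2 and using |S^2 f| \<le> L |S f| leaves at most L^4
    |f|^2 - L^2 |S f|^2; comparing with the lower bound c^2 |f|^2 makes |S f| strictly smaller than
    L |f|, uniformly in f.\<close>
  have bound: "norm (S f) \<le> sqrt (1 - b) * L * norm f" for f
  proof -
    let ?f = "proj_on V f"
    have g: "poly_op V ?q T ?f = L\<^sup>2 *\<^sub>R ?f - S (S ?f)"
      by (simp add: poly_op_diff poly_op_pCons poly_op_mult[OF on] blinfun.bilinear_simps S_def)
    have "S (S ?f) \<bullet> ?f = S ?f \<bullet> S ?f" by (rule self_adjointD[OF Ssa])
    then have "(norm (L\<^sup>2 *\<^sub>R ?f - S (S ?f)))\<^sup>2 = L ^ 4 * (norm ?f)\<^sup>2 - 2 * L\<^sup>2 * (norm (S ?f))\<^sup>2 + (norm (S (S ?f)))\<^sup>2"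
      unfolding power2_norm_eq_inner
      by (simp add: inner_diff_left inner_diff_right inner_commute algebra_simps power2_eq_square power4_eq_xxxx)
    also have "(norm (S (S ?f)))\<^sup>2 \<le> (L * norm (S ?f))\<^sup>2"
      unfolding L_def by (intro power_mono norm_blinfun) auto
    finally have "(norm (L\<^sup>2 *\<^sub>R ?f - S (S ?f)))\<^sup>2 \<le> L ^ 4 * (norm ?f)\<^sup>2 - L\<^sup>2 * (norm (S ?f))\<^sup>2"
      by (simp add: power_mult_distrib)
    moreover have "(c * norm ?f)\<^sup>2 \<le> (norm (L\<^sup>2 *\<^sub>R ?f - S (S ?f)))\<^sup>2"
      using c(2)[of ?f] c(1) g by (intro power_mono) auto
    moreover have "b * L ^ 4 * (norm ?f)\<^sup>2 \<le> c\<^sup>2 * (norm ?f)\<^sup>2" using b(3) by (intro mult_right_mono) auto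
    ultimately have "L\<^sup>2 * (norm (S ?f))\<^sup>2 \<le> L\<^sup>2 * ((1 - b) * L\<^sup>2 * (norm ?f)\<^sup>2)"
      by (simp add: power_mult_distrib algebra_simps power2_eq_square power4_eq_xxxx)
    then have "(norm (S ?f))\<^sup>2 \<le> (1 - b) * L\<^sup>2 * (norm ?f)\<^sup>2" using L(2) by simp
    also have "\<dots> = (sqrt (1 - b) * L * norm ?f)\<^sup>2" using b by (simp add: power_mult_distrib)
    finally have "norm (S ?f) \<le> sqrt (1 - b) * L * norm ?f"
      using b L(2) by (simp add: power2_le_iff_abs_le)
    also have "\<dots> \<le> sqrt (1 - b) * L * norm f"
      using b L(2) by (intro mult_left_mono norm_proj_on_le) auto
    finally show ?thesis by (simp add: operator_onD[OF Son])
  qed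
  have "L \<le> sqrt (1 - b) * L"
    using norm_blinfun_bound[OF _ bound] b L(2) by (simp add: L_def)
  moreover have "sqrt (1 - b) < 1" using b by (simp add: real_sqrt_lt_1_iff)
  ultimately show False using L(2) by simp
qed

lemma norm_poly_op_le:
  assumes sa: "self_adjoint T" and on: "operator_on V T"
    and M: "0 \<le> M" "\<And>r. r \<in> spectrum V T \<Longrightarrow> \<bar>poly p r\<bar> \<le> M"
  shows "norm (poly_op V p T) \<le> M"
proof (cases "degree p = 0")
  case False
  then show ?thesis by (intro norm_poly_op_le_nonconstant[OF sa on _ M]) auto
next
  case True
  then obtain a where a: "p = [:a:]" by (metis degree_eq_zeroE)
  then have S: "poly_op V p T = a *\<^sub>R proj_on V" by (simp add: poly_op_pCons)
  show ?thesis
  proof (cases "spectrum V T = {}")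
    case False
    then have "\<bar>a\<bar> \<le> M" using M(2) a by auto
    moreover have "\<bar>a\<bar> * norm (proj_on V) \<le> \<bar>a\<bar> * 1" by (intro mult_left_mono norm_proj_on_blinfun) auto
    ultimately show ?thesis by (simp add: S)
  next
    case True
    \<comment> \<open>With an empty spectrum the nonconstant bound, applied to the polynomial x with
      bound 0, gives \<open>T = 0\<close>. Since 0 is then no spectral value of the zero operator,
      the identity of the subspace vanishes and the constant case is trivial.\<close>
    have "norm (poly_op V [:0, 1:] T) \<le> 0"
      by (rule norm_poly_op_le_nonconstant[OF sa on]) (auto simp: True)
    then have "T = 0" by (simp add: poly_op_X[OF on])
    moreover have "0 \<notin> spectrum V T" using True by simp
    ultimately have "proj_on V = 0" by (auto simp: spectrum_def)
    then show ?thesis using M(1) by (simp add: S)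
  qed
qed


subsection \<open>Continuous functional calculus\<close>

lemma weierstrass_poly:
  fixes \<phi> :: "real \<Rightarrow> real"
  assumes "continuous_on {a..b} \<phi>" "0 < e"
  obtains p :: "real poly" where "\<And>x. x \<in> {a..b} \<Longrightarrow> \<bar>\<phi> x - poly p x\<bar> < e"
proof -
  obtain g where g: "real_polynomial_function g" "\<And>x. x \<in> {a..b} \<Longrightarrow> \<bar>\<phi> x - g x\<bar> < e"
    using Stone_Weierstrass_real_polynomial_function[OF compact_Icc assms] by blast
  obtain c n where c: "g = (\<lambda>x. \<Sum>i\<le>n. c i * x ^ i)"
    using real_polynomial_function_imp_sum[OF g(1)] by blast
  have "poly (\<Sum>i\<le>n. monom (c i) i) x = g x" for x by (simp add: c poly_sum poly_monom)
  then show ?thesis using g(2) by (intro that[of "\<Sum>i\<le>n. monom (c i) i"]) simp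
qed

lemma norm_poly_op_diff_le:
  assumes "self_adjoint T" "operator_on V T"
    and "\<And>x. x \<in> spectrum V T \<Longrightarrow> \<bar>poly p x - poly q x\<bar> \<le> M" "0 \<le> M"
  shows "norm (poly_op V p T - poly_op V q T) \<le> M"
  unfolding poly_op_diff[symmetric] by (rule norm_poly_op_le) (use assms in auto)

text \<open>Resolves the definite description and gives the one estimate used later. Weierstrass
  approximation supplies a sequence, the norm bound makes its operators Cauchy, and the same bound
  forces every other admissible sequence to the same limit.\<close>

lemma functional_calculus_approx:
  assumes sa: "self_adjoint T" and on: "operator_on V T" and \<phi>: "continuous_on UNIV \<phi>"
    and p: "\<And>x. x \<in> spectrum V T \<Longrightarrow> \<bar>\<phi> x - poly p x\<bar> \<le> e" and e: "0 \<le> e"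
  shows "norm (functional_calculus V \<phi> T - poly_op V p T) \<le> e"
proof -
  let ?d = "\<lambda>k. inverse (real (Suc k))"
  have "\<exists>q. \<forall>x\<in>{- norm T..norm T}. \<bar>\<phi> x - poly q x\<bar> < ?d k" for k
  proof -
    have "continuous_on {- norm T..norm T} \<phi>" using \<phi> continuous_on_subset by blast
    then obtain p where "\<And>x. x \<in> {- norm T..norm T} \<Longrightarrow> \<bar>\<phi> x - poly p x\<bar> < ?d k"
      using weierstrass_poly[of _ _ _ "?d k"] by (metis of_nat_0_less_iff positive_imp_inverse_positive zero_less_Suc)
    then show ?thesis by blast
  qed
  then obtain q where q0: "\<And>k x. x \<in> {- norm T..norm T} \<Longrightarrow> \<bar>\<phi> x - poly (q k) x\<bar> < ?d k" by metis
  have q: "\<bar>\<phi> x - poly (q k) x\<bar> < ?d k" if "x \<in> spectrum V T" for x k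
    using spectrum_le_norm[OF sa on that] by (intro q0) (auto simp: abs_le_iff)
  have d0: "?d \<longlonglongrightarrow> 0" by (rule LIMSEQ_inverse_real_of_nat)
  have unif: "uniform_limit (spectrum V T) (\<lambda>k. poly (q k)) \<phi> sequentially"
  proof (rule uniform_limitI)
    fix r :: real assume "0 < r"
    then have "\<forall>\<^sub>F k in sequentially. ?d k < r" using d0 order_tendstoD(2) by blast
    then show "\<forall>\<^sub>F k in sequentially. \<forall>x\<in>spectrum V T. dist (poly (q k) x) (\<phi> x) < r"
      by eventually_elim (use q in \<open>force simp: dist_real_def abs_minus_commute intro: less_trans\<close>)
  qed
  have close: "norm (poly_op V (q k) T - poly_op V (q l) T) \<le> ?d k + ?d l" for k l
  proof (rule norm_poly_op_diff_le[OF sa on])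
    fix x assume "x \<in> spectrum V T"
    then show "\<bar>poly (q k) x - poly (q l) x\<bar> \<le> ?d k + ?d l" using q[of x k] q[of x l] by linarith
  qed auto
  have "Cauchy (\<lambda>k. poly_op V (q k) T)"
  proof (rule metric_CauchyI)
    fix r :: real assume "0 < r"
    then have "\<forall>\<^sub>F k in sequentially. ?d k < r / 2" using d0 order_tendstoD(2)[of ?d 0 _ "r / 2"] by auto
    then obtain M where M: "\<And>k. k \<ge> M \<Longrightarrow> ?d k < r / 2" by (auto simp: eventually_sequentially)
    have "dist (poly_op V (q k) T) (poly_op V (q l) T) < r" if "k \<ge> M" "l \<ge> M" for k l
      using close[of k l] M[OF that(1)] M[OF that(2)] by (simp add: dist_norm)
    then show "\<exists>M. \<forall>m\<ge>M. \<forall>n\<ge>M. dist (poly_op V (q m) T) (poly_op V (q n) T) < r" by blast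
  qed
  then obtain S where S: "(\<lambda>k. poly_op V (q k) T) \<longlonglongrightarrow> S"
    using Cauchy_convergent_iff convergent_def by blast
  have lim: "(\<lambda>k. poly_op V (u k) T) \<longlonglongrightarrow> S"
    if u: "uniform_limit (spectrum V T) (\<lambda>k. poly (u k)) \<phi> sequentially" for u
  proof -
    have "(\<lambda>k. poly_op V (u k) T - poly_op V (q k) T) \<longlonglongrightarrow> 0"
    proof (rule tendstoI)
      fix r :: real assume r: "0 < r"
      have "\<forall>\<^sub>F k in sequentially. \<forall>x\<in>spectrum V T. dist (poly (u k) x) (\<phi> x) < r / 4"
        using u r by (intro uniform_limitD) auto
      moreover have "\<forall>\<^sub>F k in sequentially. ?d k < r / 4" using r d0 order_tendstoD(2)[of ?d 0 _ "r / 4"] by auto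
      ultimately show "\<forall>\<^sub>F k in sequentially. dist (poly_op V (u k) T - poly_op V (q k) T) 0 < r"
      proof eventually_elim
        case (elim k)
        have "norm (poly_op V (u k) T - poly_op V (q k) T) \<le> r / 2"
        proof (rule norm_poly_op_diff_le[OF sa on])
          fix x assume x: "x \<in> spectrum V T"
          have "\<bar>poly (u k) x - \<phi> x\<bar> < r / 4" using elim(1) x by (simp add: dist_real_def)
          then show "\<bar>poly (u k) x - poly (q k) x\<bar> \<le> r / 2" using q[OF x, of k] elim(2) by linarith
        qed (use r in auto)
        then show ?case using r by simp
      qed
    qed
    from tendsto_add[OF this S] show ?thesis by simp
  qed
  \<comment> \<open>Uniqueness needs at least one admissible sequence, since otherwise every
    operator would satisfy the description; \<open>q\<close> is that sequence.\<close>
  have "functional_calculus V \<phi> T = S"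
    unfolding functional_calculus_def
    by (rule the_equality) (use lim unif S LIMSEQ_unique in blast)+
  moreover have "norm (S - poly_op V p T) \<le> e"
  proof (rule LIMSEQ_le)
    show "(\<lambda>k. norm (poly_op V (q k) T - poly_op V p T)) \<longlonglongrightarrow> norm (S - poly_op V p T)"
      by (intro tendsto_intros S)
    show "(\<lambda>k. e + ?d k) \<longlonglongrightarrow> e" using tendsto_add[OF tendsto_const d0, of e] by simp
    have "norm (poly_op V (q k) T - poly_op V p T) \<le> e + ?d k" for k
    proof (rule norm_poly_op_diff_le[OF sa on])
      fix x assume x: "x \<in> spectrum V T"
      show "\<bar>poly (q k) x - poly p x\<bar> \<le> e + ?d k" using q[OF x, of k] p[OF x] by linarith
    qed (use e in auto)
    then show "\<exists>N. \<forall>n\<ge>N. norm (poly_op V (q n) T - poly_op V p T) \<le> e + ?d n" by blast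
  qed
  ultimately show ?thesis by simp
qed


subsection \<open>A moment problem on a compact interval\<close>

lemma continuous_on_poly_self: "continuous_on S (poly p)" for p :: "real poly"
  using continuous_on_poly[OF continuous_on_id, of S p] by simp

lemma borel_measurable_poly: "poly p \<in> borel_measurable borel" for p :: "real poly"
  by (rule borel_measurable_continuous_onI[OF continuous_on_poly_self])

text \<open>Hausdorff's construction: positivity on Bernstein polynomials gives discrete probability
  measures on the grid k/n, which integrate p to the value of \<open>\<Lambda>\<close> at the n-th
  Bernstein approximation of p. Tightness yields a weakly convergent subsequence, and its limit has
  the required moments.\<close>

lemma moment_problem_unit_interval:
  fixes \<Lambda> :: "real poly \<Rightarrow> real"
  assumes add: "\<And>p q. \<Lambda> (p + q) = \<Lambda> p + \<Lambda> q" and smult: "\<And>c p. \<Lambda> (smult c p) = c * \<Lambda> p"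
    and pos: "\<And>p. (\<And>x. x \<in> {0..1} \<Longrightarrow> 0 \<le> poly p x) \<Longrightarrow> 0 \<le> \<Lambda> p" and one: "\<Lambda> 1 = 1"
  obtains N where "real_distribution N" "AE x in N. x \<in> {0..1}" "\<And>p. (\<integral>x. poly p x \<partial>N) = \<Lambda> p"
proof -
  have \<Lambda>0: "\<Lambda> 0 = 0" using smult[of 0 0] by simp
  have sum\<Lambda>: "\<Lambda> (sum F S) = (\<Sum>i\<in>S. \<Lambda> (F i))" for F and S :: "nat set"
    by (induction S rule: infinite_finite_induct) (auto simp: \<Lambda>0 add)
  \<comment> \<open>Positivity with \<open>\<Lambda> 1 = 1\<close> makes \<open>\<Lambda>\<close>
    contractive for the supremum norm on [0, 1], so it passes to uniform limits of
    polynomials.\<close>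
  have bnd: "\<bar>\<Lambda> p - \<Lambda> q\<bar> \<le> e" if "\<And>x. x \<in> {0..1} \<Longrightarrow> \<bar>poly p x - poly q x\<bar> \<le> e" for p q e
  proof -
    have "0 \<le> \<Lambda> (smult e 1 + smult (-1) (p + smult (-1) q))" by (rule pos) (use that in force)
    moreover have "0 \<le> \<Lambda> (smult e 1 + (p + smult (-1) q))" by (rule pos) (use that in force)
    ultimately show ?thesis unfolding add smult one by (simp add: abs_le_iff)
  qed
  define bern :: "nat \<Rightarrow> nat \<Rightarrow> real poly" where
    "bern n k = smult (of_nat (n choose k)) ([:0, 1:] ^ k * [:1, - 1:] ^ (n - k))" for n k
  have bern: "poly (bern n k) x = Bernstein n k x" for n k x
    by (simp add: bern_def Bernstein_def)
  have wpos: "0 \<le> \<Lambda> (bern n k)" for n k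
    by (rule pos) (simp add: bern Bernstein_nonneg)
  have wsum: "(\<Sum>k\<le>n. \<Lambda> (bern n k)) = 1" for n
  proof -
    have "(\<Sum>k\<le>n. bern n k) = 1"
      by (simp add: poly_eq_poly_eq_iff[symmetric] fun_eq_iff poly_sum bern)
    then show ?thesis using sum\<Lambda>[of "bern n" "{..n}"] one by simp
  qed
  define \<mu> where "\<mu> n = distr (point_measure {..n} (\<lambda>k. ennreal (\<Lambda> (bern n k)))) borel (\<lambda>k. real k / real n)" for n
  have int: "integral\<^sup>L (\<mu> n) f = (\<Sum>k\<le>n. \<Lambda> (bern n k) * f (real k / real n))"
    if "f \<in> borel_measurable borel" for n and f :: "real \<Rightarrow> real"
    unfolding \<mu>_def using that
    by (subst integral_distr) (auto simp: lebesgue_integral_point_measure_finite wpos measurable_point_measure_eq1)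
  have rd: "real_distribution (\<mu> n)" for n
  proof -
    have "prob_space (point_measure {..n} (\<lambda>k. ennreal (\<Lambda> (bern n k))))"
      by (rule prob_spaceI)
        (simp add: emeasure_point_measure_finite space_point_measure sum_ennreal wpos wsum)
    then show ?thesis unfolding \<mu>_def
      by (intro prob_space.real_distribution_distr) (simp_all add: measurable_point_measure_eq1)
  qed
  have AE01: "AE x in \<mu> n. x \<in> {0..1}" for n
    unfolding \<mu>_def
    by (subst AE_distr_iff) (auto simp: measurable_point_measure_eq1 AE_point_measure divide_le_eq_1)
  \<comment> \<open>Tightness is phrased with half-open intervals; the left end -1 keeps the grid
    point 0 inside.\<close>
  have "tight \<mu>" unfolding tight_def
  proof (intro conjI allI impI)
    fix e :: real assume e: "0 < e"
    have "1 - e < measure (\<mu> n) {-1<..1}" for n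
    proof -
      interpret real_distribution "\<mu> n" by (rule rd)
      have "prob {-1<..1} = 1" by (rule prob_eq_1[THEN iffD2]) (use AE01[of n] in auto)
      then show ?thesis using e by simp
    qed
    then show "\<exists>a b. a < b \<and> (\<forall>n. 1 - e < measure (\<mu> n) {a<..b})"
      by (intro exI[of _ "-1"] exI[of _ 1]) auto
  qed (rule rd)
  then obtain r N where r: "strict_mono r" and N: "real_distribution N" "weak_conv_m (\<mu> \<circ> id \<circ> r) N"
    using tight_imp_convergent_subsubsequence[of \<mu> id] by (auto simp: strict_mono_def)
  interpret N: real_distribution N by (rule N)
  have conv: "(\<lambda>n. integral\<^sup>L (\<mu> (r n)) f) \<longlonglongrightarrow> integral\<^sup>L N f"
    if "continuous_on UNIV f" "\<And>x. norm (f x) \<le> B" for f :: "real \<Rightarrow> real" and B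
    using weak_conv_imp_integral_bdd_continuous_conv[OF _ N(1) N(2), of f B] rd that
    by (auto simp: continuous_on_eq_continuous_at)
  \<comment> \<open>Clamping to [0, 1] turns polynomials into bounded continuous test functions, as
    weak convergence requires, without changing them where the measures live.\<close>
  define cl :: "real \<Rightarrow> real" where "cl x = max 0 (min 1 x)" for x
  have clc: "continuous_on UNIV cl" unfolding cl_def by (intro continuous_intros)
  have cl: "cl x = x" if "x \<in> {0..1}" for x using that by (simp add: cl_def)
  have cl01: "cl x \<in> {0..1}" for x by (simp add: cl_def)
  have AEN: "AE x in N. x \<in> {0..1}"
  proof -
    \<comment> \<open>A bounded continuous function whose zero set is exactly [0, 1]; its vanishing
      integral survives the weak limit and confines N to [0, 1].\<close>
    let ?f = "\<lambda>x. min 1 \<bar>x - cl x\<bar>"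
    have c: "continuous_on UNIV ?f" by (intro continuous_intros clc)
    then have [measurable]: "?f \<in> borel_measurable borel" by (rule borel_measurable_continuous_onI)
    have "integral\<^sup>L (\<mu> n) ?f = (\<integral>x. 0 \<partial>\<mu> n)" for n
      by (rule integral_cong_AE) (use AE01[of n] rd[of n] in \<open>auto simp: cl real_distribution.events_eq_borel
        cong: measurable_cong_sets\<close>)
    then have "(\<lambda>n. 0) \<longlonglongrightarrow> integral\<^sup>L N ?f" using conv[OF c, of 1] by simp
    then have "integral\<^sup>L N ?f = 0" using LIMSEQ_const_iff by metis
    moreover have "integrable N ?f" by (rule N.integrable_const_bound[of _ 1]) auto
    ultimately have "AE x in N. ?f x = 0" by (subst (asm) integral_nonneg_eq_0_iff_AE) auto
    then show ?thesis
    proof eventually_elim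
      case (elim x)
      then have "x = cl x" by (auto simp: min_def split: if_splits)
      then show ?case using cl01[of x] by simp
    qed
  qed
  have moments: "(\<integral>x. poly p x \<partial>N) = \<Lambda> p" for p
  proof -
    let ?f = "\<lambda>x. poly p (cl x)"
    have c: "continuous_on UNIV ?f" by (intro continuous_intros clc)
    then have [measurable]: "?f \<in> borel_measurable borel" by (rule borel_measurable_continuous_onI)
    have "compact (poly p ` {0..1})" by (intro compact_continuous_image continuous_intros) auto
    then have "bounded (poly p ` {0..1})" by (rule compact_imp_bounded)
    then obtain B where "\<forall>x\<in>{0..1}. norm (poly p x) \<le> B" by (auto simp: bounded_iff)
    then have "norm (?f x) \<le> B" for x using cl01 by blast
    then have lim1: "(\<lambda>n. integral\<^sup>L (\<mu> (r n)) ?f) \<longlonglongrightarrow> integral\<^sup>L N ?f" by (rule conv[OF c])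
    have lim2: "(\<lambda>n. integral\<^sup>L (\<mu> n) ?f) \<longlonglongrightarrow> \<Lambda> p"
    proof (rule LIMSEQ_I)
      fix e :: real assume e: "0 < e"
      obtain M where M: "\<And>n x. M \<le> n \<Longrightarrow> x \<in> {0..1} \<Longrightarrow>
          \<bar>poly p x - (\<Sum>k\<le>n. poly p (k / n) * Bernstein n k x)\<bar> < e / 2"
        using Bernstein_Weierstrass[of "poly p" "e / 2"] e continuous_on_poly_self by fastforce
      have "norm (integral\<^sup>L (\<mu> n) ?f - \<Lambda> p) < e" if "n \<ge> M" for n
      proof -
        have "integral\<^sup>L (\<mu> n) ?f = (\<Sum>k\<le>n. \<Lambda> (smult (poly p (real k / real n)) (bern n k)))"
        proof (subst int, simp, rule sum.cong[OF refl])
          fix k assume "k \<in> {..n}"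
          then have "cl (real k / real n) = real k / real n" by (intro cl) (auto simp: divide_le_eq_1)
          then show "\<Lambda> (bern n k) * ?f (real k / real n) = \<Lambda> (smult (poly p (real k / real n)) (bern n k))"
            by (simp add: smult)
        qed
        also have "\<dots> = \<Lambda> (\<Sum>k\<le>n. smult (poly p (real k / real n)) (bern n k))" by (simp add: sum\<Lambda>)
        finally have "\<bar>integral\<^sup>L (\<mu> n) ?f - \<Lambda> p\<bar> \<le> e / 2"
        proof (simp only:, intro bnd)
          fix x :: real assume "x \<in> {0..1}"
          from M[OF that this]
          show "\<bar>poly (\<Sum>k\<le>n. smult (poly p (real k / real n)) (bern n k)) x - poly p x\<bar> \<le> e / 2"
            by (simp add: poly_sum bern abs_minus_commute)
        qed
        then show ?thesis using e by simp
      qed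
      then show "\<exists>no. \<forall>n\<ge>no. norm (integral\<^sup>L (\<mu> n) ?f - \<Lambda> p) < e" by blast
    qed
    have "integral\<^sup>L N ?f = \<Lambda> p"
      using LIMSEQ_unique[OF lim1] LIMSEQ_subseq_LIMSEQ[OF lim2 r] by (simp add: comp_def)
    moreover have "(\<integral>x. poly p x \<partial>N) = integral\<^sup>L N ?f"
    proof (rule integral_cong_AE)
      show "AE x in N. poly p x = ?f x" using AEN by eventually_elim (simp add: cl)
      show "poly p \<in> borel_measurable N"
        by (simp add: borel_measurable_poly)
    qed simp
    ultimately show ?thesis by simp
  qed
  show ?thesis by (rule that[OF N(1) AEN moments])
qed

lemma moment_problem:
  fixes \<Lambda> :: "real poly \<Rightarrow> real"
  assumes "a < b"
    and add: "\<And>p q. \<Lambda> (p + q) = \<Lambda> p + \<Lambda> q" and smult: "\<And>c p. \<Lambda> (smult c p) = c * \<Lambda> p"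
    and pos: "\<And>p. (\<And>x. x \<in> {a..b} \<Longrightarrow> 0 \<le> poly p x) \<Longrightarrow> 0 \<le> \<Lambda> p" and one: "\<Lambda> 1 = 1"
  obtains N where "real_distribution N" "AE x in N. x \<in> {a..b}" "\<And>p. (\<integral>x. poly p x \<partial>N) = \<Lambda> p"
proof -
  \<comment> \<open>\<open>?u\<close> maps [a, b] affinely onto [0, 1] and \<open>?w\<close> is its
    inverse: \<open>?u\<close> transports the functional, \<open>?w\<close> the measure
    back.\<close>
  let ?u = "[:- a / (b - a), 1 / (b - a):]" and ?w = "[:a, b - a:]"
  define \<Lambda>' where "\<Lambda>' p = \<Lambda> (pcompose p ?u)" for p
  have uw: "pcompose ?w ?u = [:0, 1:]" using assms(1) by (simp add: pcompose_pCons field_simps)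
  obtain N where N: "real_distribution N" "AE x in N. x \<in> {0..1}" "\<And>p. (\<integral>x. poly p x \<partial>N) = \<Lambda>' p"
  proof (rule moment_problem_unit_interval[of \<Lambda>'])
    fix p :: "real poly" assume p: "\<And>x. x \<in> {0..1} \<Longrightarrow> 0 \<le> poly p x"
    show "0 \<le> \<Lambda>' p" unfolding \<Lambda>'_def
    proof (rule pos)
      fix x assume "x \<in> {a..b}"
      then have "(x - a) / (b - a) \<in> {0..1}" using assms(1) by (auto simp: divide_simps)
      then show "0 \<le> poly (pcompose p ?u) x"
        using p[of "(x - a) / (b - a)"] by (simp add: poly_pcompose diff_divide_distrib)
    qed
  qed (auto simp: \<Lambda>'_def pcompose_add pcompose_smult add smult one pcompose_1)
  interpret N: real_distribution N by (rule N(1))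
  let ?N = "distr N borel (\<lambda>t. a + (b - a) * t)"
  show ?thesis
  proof
    show "real_distribution ?N" by (rule N.real_distribution_distr) simp
    show "AE x in ?N. x \<in> {a..b}"
    proof (subst AE_distr_iff)
      show "AE t in N. a + (b - a) * t \<in> {a..b}"
        using N(2)
      proof eventually_elim
        case (elim t)
        then have "0 \<le> (b - a) * t" "(b - a) * t \<le> (b - a) * 1"
          using assms(1) by (auto intro!: mult_left_mono)
        then show ?case by auto
      qed
    qed auto
    fix p :: "real poly"
    have m: "poly p \<in> borel_measurable borel"
      by (rule borel_measurable_poly)
    have "(\<integral>x. poly p x \<partial>?N) = (\<integral>t. poly p (a + (b - a) * t) \<partial>N)"
      by (rule integral_distr) (use m in auto)
    also have "\<dots> = (\<integral>t. poly (pcompose p ?w) t \<partial>N)" by (simp add: poly_pcompose mult.commute)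
    also have "\<dots> = \<Lambda> (pcompose p (pcompose ?w ?u))" by (simp only: N(3) \<Lambda>'_def pcompose_assoc)
    finally show "(\<integral>x. poly p x \<partial>?N) = \<Lambda> p" by (simp only: uw pcompose_idR)
  qed
qed


subsection \<open>The spectral measure\<close>

lemma trace_on_diff: "trace_on S (A - B) = trace_on S A - trace_on S B"
  by (simp add: trace_on_def blinfun.bilinear_simps sum_subtractf)

lemma trace_on_add: "trace_on S (A + B) = trace_on S A + trace_on S B"
  by (simp add: trace_on_def blinfun.bilinear_simps sum.distrib)

lemma trace_on_scaleR: "trace_on S (r *\<^sub>R A) = r *\<^sub>R trace_on S A"
  by (simp add: trace_on_def blinfun.bilinear_simps scaleR_sum_right)

lemma cmod_trace_on_le: "cmod (trace_on S A) \<le> real (card S) * norm A"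
proof -
  have "cmod (trace_on S A) \<le> (\<Sum>v\<in>S. cmod (coord (A (basis_vector v)) v))"
    unfolding trace_on_def by (rule norm_sum)
  also have "\<dots> \<le> (\<Sum>v\<in>S. norm A)"
  proof (rule sum_mono)
    fix v
    show "cmod (coord (A (basis_vector v)) v) \<le> norm A"
      using cmod_coord_le_norm[of "A (basis_vector v)" v] norm_blinfun[of A "basis_vector v"] by simp
  qed
  finally show ?thesis by simp
qed

text \<open>The uniqueness half of \<open>spectral_measure\<close>. Testing with the constant 1
  makes M a probability measure; testing with cosines and sines identifies the characteristic
  functions, and Levy's theorem concludes.\<close>

lemma real_distribution_eqI_continuous:
  fixes M N :: "real measure"
  assumes N: "real_distribution N" and M: "sets M = sets borel"
    and eq: "\<And>\<phi>::real \<Rightarrow> real. continuous_on UNIV \<phi> \<Longrightarrow> integrable M \<phi> \<and> integral\<^sup>L M \<phi> = integral\<^sup>L N \<phi>"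
  shows "M = N"
proof -
  interpret N: real_distribution N by (rule N)
  have "integrable M (\<lambda>_. 1::real)" using eq by auto
  then have "emeasure M (space M) < \<infinity>" by (auto simp: integrable_iff_bounded)
  then interpret M: finite_measure M by (intro finite_measureI) auto
  have "measure M (space M) = 1" using eq[of "\<lambda>_. 1"] N.prob_space by simp
  then have "prob_space M" by (intro prob_spaceI) (simp add: M.emeasure_eq_measure)
  then have rM: "real_distribution M"
    using M by (simp add: real_distribution_def real_distribution_axioms_def)
  interpret M: real_distribution M by (rule rM)
  have "char M = char N"
  proof
    fix t :: real
    have c: "continuous_on UNIV (\<lambda>x. cos (t * x))" "continuous_on UNIV (\<lambda>x. sin (t * x))"
      by (auto intro!: continuous_intros)
    have "char L t = complex_of_real (\<integral>x. cos (t * x) \<partial>L) + \<i> * complex_of_real (\<integral>x. sin (t * x) \<partial>L)"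
      if "real_distribution L" for L
    proof -
      interpret L: real_distribution L by (rule that)
      have "integrable L (\<lambda>x. cos (t * x))" "integrable L (\<lambda>x. sin (t * x))"
        by (rule L.integrable_const_bound[of _ 1]; simp)+
      moreover have "char L t = (\<integral>x. complex_of_real (cos (t * x)) + \<i> * complex_of_real (sin (t * x)) \<partial>L)"
        by (simp only: char_def exp_Euler cos_of_real sin_of_real)
      ultimately show ?thesis by simp
    qed
    then show "char M t = char N t" using N rM eq[OF c(1)] eq[OF c(2)] by simp
  qed
  then show ?thesis by (rule Levy_uniqueness[OF rM N])
qed

text \<open>Moments suffice: the normalized trace is at most the operator norm, so approximating a
  continuous function by a polynomial changes both the traces and the integral by at most
  e/3.\<close>

lemma spectral_measure_eqI:
  assumes sa: "self_adjoint T" and on: "operator_on V T"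
    and N: "real_distribution N" "AE x in N. x \<in> {a..b}"
    and moments: "\<And>p. (\<lambda>n. trace_on (K n) (poly_op V p T) / of_nat (card (K n)))
                        \<longlonglongrightarrow> complex_of_real (\<integral>x. poly p x \<partial>N)"
  shows "spectral_measure V K T = N"
proof -
  interpret N: real_distribution N by (rule N)
  let ?tr = "\<lambda>A n. trace_on (K n) A / of_nat (card (K n))"
  have tr: "cmod (?tr A n) \<le> norm A" for A n
    using cmod_trace_on_le[of "K n" A]
    by (cases "card (K n) = 0") (auto simp: norm_divide field_simps)
  have trd: "?tr (A - B) n = ?tr A n - ?tr B n" for A B n by (simp add: trace_on_diff diff_divide_distrib)
  \<comment> \<open>Large enough for [-c, c] to contain both the carrier of N and the spectrum of T,
    so one polynomial approximation serves both sides.\<close>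
  define c where "c = \<bar>a\<bar> + \<bar>b\<bar> + norm T"
  have AEc: "AE x in N. x \<in> {- c..c}"
    using N(2)
  proof eventually_elim
    case (elim x)
    then show ?case using norm_ge_zero[of T] unfolding c_def atLeastAtMost_iff by linarith
  qed
  have spc: "x \<in> {- c..c}" if "x \<in> spectrum V T" for x
    using spectrum_le_norm[OF sa on that] by (auto simp: c_def)
  have int: "integrable N \<phi>" if "continuous_on UNIV \<phi>" for \<phi> :: "real \<Rightarrow> real"
  proof -
    have "compact (\<phi> ` {- c..c})"
      using that continuous_on_subset by (intro compact_continuous_image) auto
    then have "bounded (\<phi> ` {- c..c})" by (rule compact_imp_bounded)
    then obtain B where B: "\<forall>x\<in>{- c..c}. norm (\<phi> x) \<le> B" by (auto simp: bounded_iff)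
    show ?thesis
    proof (rule N.integrable_const_bound[of _ B])
      show "AE x in N. norm (\<phi> x) \<le> B" using AEc by eventually_elim (use B in blast)
      show "\<phi> \<in> borel_measurable N" using borel_measurable_continuous_onI[OF that] by simp
    qed
  qed
  have lim: "?tr (functional_calculus V \<phi> T) \<longlonglongrightarrow> complex_of_real (integral\<^sup>L N \<phi>)"
    if \<phi>: "continuous_on UNIV \<phi>" for \<phi>
  proof (rule tendstoI)
    fix e :: real assume e: "0 < e"
    have "continuous_on {- c..c} \<phi>" using \<phi> continuous_on_subset by blast
    then obtain p where p: "\<And>x. x \<in> {- c..c} \<Longrightarrow> \<bar>\<phi> x - poly p x\<bar> < e / 3"
      using weierstrass_poly[of "- c" c \<phi> "e / 3"] e by auto
    have pc: "continuous_on UNIV (poly p)" by (rule continuous_on_poly_self)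
    have fc: "norm (functional_calculus V \<phi> T - poly_op V p T) \<le> e / 3"
      by (rule functional_calculus_approx[OF sa on \<phi>]) (use p[OF spc] e in \<open>auto intro: less_imp_le\<close>)
    have "\<bar>integral\<^sup>L N (poly p) - integral\<^sup>L N \<phi>\<bar> \<le> e / 3"
    proof -
      have "integral\<^sup>L N (poly p) - integral\<^sup>L N \<phi> = (\<integral>x. poly p x - \<phi> x \<partial>N)"
        using int[OF \<phi>] int[OF pc] by simp
      also have "norm \<dots> \<le> (\<integral>x. norm (poly p x - \<phi> x) \<partial>N)" by (rule integral_norm_bound)
      also have "\<dots> \<le> (\<integral>x. e / 3 \<partial>N)"
      proof (rule integral_mono_AE)
        show "AE x in N. norm (poly p x - \<phi> x) \<le> e / 3"
          using AEc
        proof eventually_elim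
          case (elim x)
          then show ?case using p[OF elim] by (simp add: abs_minus_commute)
        qed
        show "integrable N (\<lambda>x. norm (poly p x - \<phi> x))"
          using int[OF \<phi>] int[OF pc] by (intro integrable_norm Bochner_Integration.integrable_diff)
      qed simp
      finally show ?thesis using N.prob_space by simp
    qed
    then have pi: "dist (complex_of_real (integral\<^sup>L N (poly p))) (complex_of_real (integral\<^sup>L N \<phi>)) \<le> e / 3"
      by (simp add: dist_real_def)
    have "\<forall>\<^sub>F n in sequentially. dist (?tr (poly_op V p T) n) (complex_of_real (integral\<^sup>L N (poly p))) < e / 3"
      using moments[of p] e by (intro tendstoD) auto
    then show "\<forall>\<^sub>F n in sequentially. dist (?tr (functional_calculus V \<phi> T) n) (complex_of_real (integral\<^sup>L N \<phi>)) < e"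
    proof eventually_elim
      case (elim n)
      have "dist (?tr (functional_calculus V \<phi> T) n) (?tr (poly_op V p T) n) \<le> e / 3"
        using tr[of n "functional_calculus V \<phi> T - poly_op V p T"] fc unfolding trd dist_norm by linarith
      moreover have "dist w z < e" if "dist w x \<le> e / 3" "dist x y < e / 3" "dist y z \<le> e / 3"
        for w x y z :: complex
        using that dist_triangle[of w z x] dist_triangle[of x z y] by linarith
      ultimately show ?case using elim pi by blast
    qed
  qed
  show ?thesis unfolding spectral_measure_def
  proof (rule the_equality)
    show "sets N = sets borel \<and> (\<forall>\<phi>. continuous_on UNIV \<phi> \<longrightarrow> integrable N \<phi> \<and>
            ?tr (functional_calculus V \<phi> T) \<longlonglongrightarrow> complex_of_real (integral\<^sup>L N \<phi>))"
      using int lim by simp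
  next
    fix M
    assume M: "sets M = sets borel \<and> (\<forall>\<phi>. continuous_on UNIV \<phi> \<longrightarrow> integrable M \<phi> \<and>
            ?tr (functional_calculus V \<phi> T) \<longlonglongrightarrow> complex_of_real (integral\<^sup>L M \<phi>))"
    show "M = N"
    proof (rule real_distribution_eqI_continuous[OF N(1)])
      show "sets M = sets borel" using M by simp
      fix \<phi> :: "real \<Rightarrow> real" assume \<phi>: "continuous_on UNIV \<phi>"
      have "complex_of_real (integral\<^sup>L M \<phi>) = complex_of_real (integral\<^sup>L N \<phi>)"
        by (rule LIMSEQ_unique[OF _ lim[OF \<phi>]]) (use M \<phi> in blast)
      then show "integrable M \<phi> \<and> integral\<^sup>L M \<phi> = integral\<^sup>L N \<phi>" using M \<phi> by simp
    qed
  qed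
qed

lemma spectral_measure_affine:
  assumes sa: "self_adjoint T" and on: "operator_on V T"
    and N: "real_distribution N" "AE x in N. x \<in> {a..b}"
    and moments: "\<And>p. (\<lambda>n. trace_on (K n) (poly_op V p T) / of_nat (card (K n)))
                        \<longlonglongrightarrow> complex_of_real (\<integral>x. poly p x \<partial>N)"
  shows "spectral_measure V K (c *\<^sub>R proj_on V - T) = distr N borel (\<lambda>x. c - x)"
proof (rule spectral_measure_eqI)
  interpret N: real_distribution N by (rule N)
  show "self_adjoint (c *\<^sub>R proj_on V - T)"
    by (intro self_adjoint_diff self_adjoint_scaleR self_adjoint_proj_on sa)
  show "operator_on V (c *\<^sub>R proj_on V - T)"
    by (intro operator_on_diff operator_on_scaleR operator_on_proj_on on)
  show "real_distribution (distr N borel (\<lambda>x. c - x))" by (rule N.real_distribution_distr) simp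
  show "AE x in distr N borel (\<lambda>x. c - x). x \<in> {c - b..c - a}"
    using N(2) by (subst AE_distr_iff) auto
  fix p :: "real poly"
  have "poly_op V p (c *\<^sub>R proj_on V - T) = poly_op V (pcompose p [:c, - 1:]) T"
  proof -
    have "poly_op V [:c, - 1:] T = c *\<^sub>R proj_on V - T"
      by (rule blinfun_eqI) (simp add: poly_op_pCons blinfun.bilinear_simps operator_onD[OF on])
    then show ?thesis by (simp add: poly_op_pcompose[OF on])
  qed
  moreover have "(\<integral>x. poly p x \<partial>distr N borel (\<lambda>x. c - x)) = (\<integral>x. poly (pcompose p [:c, - 1:]) x \<partial>N)"
    by (subst integral_distr) (auto simp: borel_measurable_poly poly_pcompose intro!: Bochner_Integration.integral_cong)
  ultimately show "(\<lambda>n. trace_on (K n) (poly_op V p (c *\<^sub>R proj_on V - T)) / of_nat (card (K n)))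
      \<longlonglongrightarrow> complex_of_real (\<integral>x. poly p x \<partial>distr N borel (\<lambda>x. c - x))"
    using moments by simp
qed


section \<open>Adjacency operators\<close>

abbreviation nbrs :: "'v graph \<Rightarrow> 'v \<Rightarrow> 'v set" where
  "nbrs X v \<equiv> {w. adj X v w}"

lemma adj_sym: "adj X u v \<longleftrightarrow> adj X v u"
  by (simp add: adj_def insert_commute)

lemma adj_verts: "is_graph X \<Longrightarrow> adj X u v \<Longrightarrow> u \<in> verts X \<and> v \<in> verts X"
  unfolding is_graph_def adj_def by (metis doubleton_eq_iff)

lemma nbrs_eq_empty: "is_graph X \<Longrightarrow> v \<notin> verts X \<Longrightarrow> nbrs X v = {}"
  using adj_verts[of X] by auto

lemma is_graph_degree_bound:
  assumes "is_graph X"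
  obtains d where "\<And>v. finite (nbrs X v)" "\<And>v. card (nbrs X v) \<le> d"
proof -
  obtain d where d: "\<And>v. v \<in> verts X \<Longrightarrow> finite (nbrs X v) \<and> card (nbrs X v) \<le> d"
    using assms by (auto simp: is_graph_def)
  have "finite (nbrs X v) \<and> card (nbrs X v) \<le> d" for v
    using d nbrs_eq_empty[OF assms, of v] by (cases "v \<in> verts X") auto
  then show ?thesis using that by blast
qed

lemma finite_nbrs: "is_graph X \<Longrightarrow> finite (nbrs X v)"
  by (metis is_graph_degree_bound)

text \<open>Cauchy-Schwarz at each vertex costs one factor d; after exchanging the sums each w is
  counted at most d times, which costs the other. This shows that neighbour sums stay square
  summable and that the resulting operator is bounded.\<close>

lemma sum_squares_nbrs_le:
  fixes f :: "'v ell2"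
  assumes X: "is_graph X" and d: "\<And>v. card (nbrs X v) \<le> d" and S: "finite S"
  shows "(\<Sum>v\<in>S. (cmod (\<Sum>w\<in>nbrs X v. coord f w))\<^sup>2) \<le> (norm f * real d)\<^sup>2"
proof -
  note fin = finite_nbrs[OF X]
  define U where "U = (\<Union>v\<in>S. nbrs X v)"
  have U: "finite U" using S fin by (auto simp: U_def)
  have "(\<Sum>v\<in>S. (cmod (\<Sum>w\<in>nbrs X v. coord f w))\<^sup>2) \<le> (\<Sum>v\<in>S. real d * (\<Sum>w\<in>nbrs X v. (cmod (coord f w))\<^sup>2))"
  proof (rule sum_mono)
    fix v
    have "(cmod (\<Sum>w\<in>nbrs X v. coord f w))\<^sup>2 \<le> (\<Sum>w\<in>nbrs X v. cmod (coord f w))\<^sup>2"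
      by (intro power_mono norm_sum) auto
    also have "\<dots> \<le> (\<Sum>w\<in>nbrs X v. (cmod (coord f w))\<^sup>2) * real (card (nbrs X v))"
      by (rule sum_squared_le_sum_of_squares)
    also have "\<dots> \<le> (\<Sum>w\<in>nbrs X v. (cmod (coord f w))\<^sup>2) * real d"
      using d by (intro mult_left_mono sum_nonneg) auto
    finally show "(cmod (\<Sum>w\<in>nbrs X v. coord f w))\<^sup>2 \<le> real d * (\<Sum>w\<in>nbrs X v. (cmod (coord f w))\<^sup>2)"
      by (simp add: mult.commute)
  qed
  also have "\<dots> = real d * (\<Sum>v\<in>S. \<Sum>w\<in>{w\<in>U. adj X v w}. (cmod (coord f w))\<^sup>2)"
    unfolding sum_distrib_left[symmetric]
    by (intro arg_cong2[where f = "(*)"] refl sum.cong) (auto simp: U_def)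
  also have "(\<Sum>v\<in>S. \<Sum>w\<in>{w\<in>U. adj X v w}. (cmod (coord f w))\<^sup>2)
      = (\<Sum>w\<in>U. \<Sum>v\<in>{v\<in>S. adj X v w}. (cmod (coord f w))\<^sup>2)"
    by (rule sum.swap_restrict[OF S U])
  also have "real d * \<dots> \<le> real d * (\<Sum>w\<in>U. real d * (cmod (coord f w))\<^sup>2)"
  proof (intro mult_left_mono sum_mono)
    fix w
    have "card {v\<in>S. adj X v w} \<le> card (nbrs X w)"
      by (rule card_mono[OF fin]) (auto simp: adj_sym)
    also have "\<dots> \<le> d" by (rule d)
    finally show "(\<Sum>v\<in>{v\<in>S. adj X v w}. (cmod (coord f w))\<^sup>2) \<le> real d * (cmod (coord f w))\<^sup>2"
      by (simp add: mult_right_mono)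
  qed simp
  also have "\<dots> \<le> real d * (real d * (norm f)\<^sup>2)"
    unfolding sum_distrib_left[symmetric] using sum_coord_le_norm[OF U, of f]
    by (intro mult_left_mono) auto
  finally show ?thesis by (simp add: power_mult_distrib power2_eq_square mult_ac)
qed

lemma coord_adjacency:
  assumes X: "is_graph X"
  shows "coord (adjacency X f) v = (\<Sum>w\<in>nbrs X v. coord f w)"
proof -
  obtain d where d: "\<And>v. card (nbrs X v) \<le> d" using is_graph_degree_bound[OF X] by metis
  define A where "A f = Abs_ell2 (\<lambda>v. \<Sum>w\<in>nbrs X v. coord f w)" for f
  have c: "coord (A f) v = (\<Sum>w\<in>nbrs X v. coord f w)" for f v
    unfolding A_def
    by (subst coord_Abs_ell2, rule square_summableI, rule sum_squares_nbrs_le[OF X d]) auto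
  have "bounded_linear A"
  proof (rule bounded_linear_intro[where K = "real d"])
    show "A (f + g) = A f + A g" for f g by (rule ell2_eqI) (simp add: c sum.distrib)
    show "A (r *\<^sub>R f) = r *\<^sub>R A f" for r f by (rule ell2_eqI) (simp add: c scaleR_sum_right)
    show "norm (A f) \<le> norm f * real d" for f
      by (rule norm_ell2_leI) (use sum_squares_nbrs_le[OF X d] in \<open>auto simp: c\<close>)
  qed
  moreover have "adjacency X = Blinfun A" by (simp add: adjacency_def A_def[abs_def])
  ultimately show ?thesis by (simp add: bounded_linear_Blinfun_apply c)
qed

lemma tendsto_proj_on_finite_subsets: "((\<lambda>S. proj_on S f) \<longlongrightarrow> f) (finite_subsets_at_top UNIV)"
proof (rule tendstoI)
  fix e :: real assume "0 < e"
  then obtain S where S: "finite S" "\<And>T. S \<subseteq> T \<Longrightarrow> norm (f - proj_on T f) < e"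
    using norm_sub_proj_on_finite[of e f] by metis
  then show "\<forall>\<^sub>F S in finite_subsets_at_top UNIV. dist (proj_on S f) f < e"
    unfolding eventually_finite_subsets_at_top
    by (intro exI[of _ S]) (simp add: dist_norm norm_minus_commute)
qed

text \<open>On finitely supported vectors symmetry is the exchange of a finite double sum; density
  and continuity extend it.\<close>

lemma self_adjoint_adjacency:
  assumes X: "is_graph X"
  shows "self_adjoint (adjacency X)"
  unfolding self_adjoint_def
proof (intro allI)
  fix f g
  let ?A = "adjacency X" and ?F = "finite_subsets_at_top UNIV"
  have fs: "?A (proj_on S f) \<bullet> proj_on S g = (\<Sum>v\<in>S. \<Sum>w\<in>{w\<in>S. adj X v w}. coord f w \<bullet> coord g v)"
    if S: "finite S" for S f g
  proof -
    have "?A (proj_on S f) \<bullet> proj_on S g = (\<Sum>v\<in>S. coord (?A (proj_on S f)) v \<bullet> coord (proj_on S g) v)"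
      by (rule inner_ell2_finite_support[OF S]) simp
    also have "\<dots> = (\<Sum>v\<in>S. \<Sum>w\<in>{w\<in>S. adj X v w}. coord f w \<bullet> coord g v)"
    proof (rule sum.cong[OF refl])
      fix v assume "v \<in> S"
      have "(\<Sum>w\<in>nbrs X v. coord (proj_on S f) w) = (\<Sum>w\<in>{w\<in>S. adj X v w}. coord f w)"
        by (rule sum.mono_neutral_cong_right[OF finite_nbrs[OF X]]) auto
      then show "coord (?A (proj_on S f)) v \<bullet> coord (proj_on S g) v = (\<Sum>w\<in>{w\<in>S. adj X v w}. coord f w \<bullet> coord g v)"
        using \<open>v \<in> S\<close> by (simp add: coord_adjacency[OF X] inner_sum_left del: coord_proj_on) (simp)
    qed
    finally show ?thesis .
  qed
  have eq: "?A (proj_on S f) \<bullet> proj_on S g = proj_on S f \<bullet> ?A (proj_on S g)" if S: "finite S" for S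
  proof -
    have "?A (proj_on S f) \<bullet> proj_on S g = (\<Sum>v\<in>S. \<Sum>w\<in>{w\<in>S. adj X v w}. coord f w \<bullet> coord g v)" by (rule fs[OF S])
    also have "\<dots> = (\<Sum>w\<in>S. \<Sum>v\<in>{v\<in>S. adj X v w}. coord f w \<bullet> coord g v)"
      by (rule sum.swap_restrict[OF S S])
    also have "\<dots> = (\<Sum>w\<in>S. \<Sum>v\<in>{v\<in>S. adj X w v}. coord g v \<bullet> coord f w)"
      by (intro sum.cong refl) (auto simp: adj_sym inner_commute)
    also have "\<dots> = ?A (proj_on S g) \<bullet> proj_on S f" by (rule fs[OF S, symmetric])
    finally show ?thesis by (simp add: inner_commute)
  qed
  have l: "((\<lambda>S. ?A (proj_on S f) \<bullet> proj_on S g) \<longlongrightarrow> ?A f \<bullet> g) ?F"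
    by (intro tendsto_intros tendsto_proj_on_finite_subsets)
  have r: "((\<lambda>S. proj_on S f \<bullet> ?A (proj_on S g)) \<longlongrightarrow> f \<bullet> ?A g) ?F"
    by (intro tendsto_intros tendsto_proj_on_finite_subsets)
  have "((\<lambda>S. ?A (proj_on S f) \<bullet> proj_on S g) \<longlongrightarrow> f \<bullet> ?A g) ?F"
    using r by (rule Lim_transform_eventually) (auto intro!: eventually_finite_subsets_at_top_weakI simp: eq)
  then show "?A f \<bullet> g = f \<bullet> ?A g"
    using tendsto_unique[OF _ l] by simp
qed

lemma operator_on_adjacency:
  assumes X: "is_graph X"
  shows "operator_on (verts X) (adjacency X)"
  unfolding operator_on_def
proof (intro allI conjI; rule ell2_eqI)
  fix f v
  show "coord (proj_on (verts X) (adjacency X f)) v = coord (adjacency X f) v"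
    by (simp add: coord_adjacency[OF X] nbrs_eq_empty[OF X])
  show "coord (adjacency X (proj_on (verts X) f)) v = coord (adjacency X f) v"
    using adj_verts[OF X] by (auto simp: coord_adjacency[OF X] intro!: sum.cong)
qed

lemma adjacency_basis_vector:
  assumes X: "is_graph X"
  shows "adjacency X (basis_vector v) = (\<Sum>w\<in>nbrs X v. basis_vector w)"
proof (rule ell2_eqI)
  fix u
  have "coord (adjacency X (basis_vector v)) u = (if adj X u v then 1 else 0)"
    using finite_nbrs[OF X] by (simp add: coord_adjacency[OF X])
  moreover have "coord (\<Sum>w\<in>nbrs X v. basis_vector w) u = (if adj X v u then 1 else 0)"
    using finite_nbrs[OF X] by simp
  ultimately show "coord (adjacency X (basis_vector v)) u = coord (\<Sum>w\<in>nbrs X v. basis_vector w) u"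
    by (simp add: adj_sym)
qed

text \<open>All entries are nonnegative, so replacing f by its modulus keeps the norm and does not
  decrease the absolute value of the form. Hence an upper bound for the form alone already bounds
  the norm; this puts the norm at the top of the form and E_0 at 0.\<close>

lemma norm_adjacency_le:
  assumes X: "is_graph X" and M: "0 \<le> M" "\<And>f. adjacency X f \<bullet> f \<le> M * (norm f)\<^sup>2"
  shows "norm (adjacency X) \<le> M"
proof (rule norm_self_adjoint_le[OF self_adjoint_adjacency[OF X] M(1)])
  fix f :: "'a ell2"
  define g where "g = Abs_ell2 (\<lambda>v. complex_of_real (cmod (coord f v)))"
  have g: "coord g v = complex_of_real (cmod (coord f v))" for v
    unfolding g_def by (subst coord_Abs_ell2) (use square_summable_coord[of f] in auto)
  have ng: "(norm g)\<^sup>2 = (norm f)\<^sup>2" by (simp add: norm_ell2_infsum g)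
  let ?A = "adjacency X"
  have "\<bar>\<Sum>\<^sub>\<infinity>v. coord (?A f) v \<bullet> coord f v\<bar> \<le> (\<Sum>\<^sub>\<infinity>v. coord (?A g) v \<bullet> coord g v)"
    unfolding real_norm_def[symmetric]
  proof (rule norm_infsum_le)
    show "((\<lambda>v. coord (?A f) v \<bullet> coord f v) has_sum (\<Sum>\<^sub>\<infinity>v. coord (?A f) v \<bullet> coord f v)) UNIV"
      by (rule has_sum_infsum[OF inner_ell2_summable])
    show "((\<lambda>v. coord (?A g) v \<bullet> coord g v) has_sum (\<Sum>\<^sub>\<infinity>v. coord (?A g) v \<bullet> coord g v)) UNIV"
      by (rule has_sum_infsum[OF inner_ell2_summable])
    fix v
    have "\<bar>coord (?A f) v \<bullet> coord f v\<bar> \<le> cmod (coord (?A f) v) * cmod (coord f v)"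
      by (rule Cauchy_Schwarz_ineq2)
    also have "\<dots> \<le> (\<Sum>w\<in>nbrs X v. cmod (coord f w)) * cmod (coord f v)"
      unfolding coord_adjacency[OF X] by (intro mult_right_mono norm_sum) auto
    also have "\<dots> = coord (?A g) v \<bullet> coord g v"
      by (simp add: coord_adjacency[OF X] g inner_complex_def)
    finally show "norm (coord (?A f) v \<bullet> coord f v) \<le> coord (?A g) v \<bullet> coord g v" by simp
  qed
  then have "\<bar>?A f \<bullet> f\<bar> \<le> ?A g \<bullet> g" by (simp add: inner_ell2_infsum)
  also have "\<dots> \<le> M * (norm f)\<^sup>2" using M(2)[of g] ng by simp
  finally show "\<bar>?A f \<bullet> f\<bar> \<le> M * (norm f)\<^sup>2" .
qed


section \<open>Closed walks along an exhaustion\<close>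

abbreviation adj_pow :: "'v graph \<Rightarrow> nat \<Rightarrow> 'v ell2 \<Rightarrow> 'v ell2" where
  "adj_pow X k \<equiv> blinfun_apply (adjacency X) ^^ k"

text \<open>The k-th diagonal entry count: a diagonal matrix element of the k-th power of the
  adjacency operator, hence the number of closed walks of length k at v.\<close>

definition walks :: "'v graph \<Rightarrow> nat \<Rightarrow> 'v \<Rightarrow> real" where
  "walks X k v = adj_pow X k (basis_vector v) \<bullet> basis_vector v"

text \<open>An inner boundary phrased by neighbourhoods rather than distances, so that it can be
  compared between two graphs vertex by vertex.\<close>

definition leak :: "'v graph \<Rightarrow> 'v set \<Rightarrow> 'v set" where
  "leak X K = {v \<in> K. \<not> nbrs X v \<subseteq> K}"

lemma finite_leak: "finite K \<Longrightarrow> finite (leak X K)"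
  by (simp add: leak_def)

lemma linear_adj_pow: "linear (adj_pow X k)"
proof (induction k)
  case 0 then show ?case by (simp add: linear_id[unfolded id_def])
next
  case (Suc k)
  have "linear (blinfun_apply (adjacency X))"
    using blinfun.bounded_linear_right bounded_linear.linear by blast
  from linear_compose[OF Suc this] show ?case by (simp add: comp_def)
qed

lemma norm_adj_pow_le: "norm (adj_pow X k f) \<le> norm (adjacency X) ^ k * norm f"
proof (induction k)
  case (Suc k)
  have "norm (adj_pow X (Suc k) f) \<le> norm (adjacency X) * norm (adj_pow X k f)"
    by (simp add: norm_blinfun)
  also have "\<dots> \<le> norm (adjacency X) * (norm (adjacency X) ^ k * norm f)"
    by (intro mult_left_mono Suc) auto
  finally show ?case by (simp add: mult.assoc)
qed simp

lemma abs_walks_le: "\<bar>walks X k v\<bar> \<le> norm (adjacency X) ^ k"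
proof -
  have "\<bar>walks X k v\<bar> \<le> norm (adj_pow X k (basis_vector v)) * norm (basis_vector v :: 'a ell2)"
    unfolding walks_def by (rule Cauchy_Schwarz_ineq2)
  also have "\<dots> \<le> norm (adjacency X) ^ k" using norm_adj_pow_le[of k X "basis_vector v"] by simp
  finally show ?thesis .
qed

text \<open>The walks of \<open>X\<close> confined to \<open>K\<close>; comparing \<open>X\<close> and \<open>Y\<close> through them keeps all error terms
  attached to vertices of \<open>K\<close>.\<close>

fun confined :: "'v graph \<Rightarrow> 'v set \<Rightarrow> nat \<Rightarrow> 'v \<Rightarrow> 'v ell2" where
  "confined X K 0 v = basis_vector v"
| "confined X K (Suc k) v = (\<Sum>w\<in>nbrs X v \<inter> K. confined X K k w)"

text \<open>Induction on the first step of a walk: the error at v consists of the earlier errors at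
  its neighbours inside K, plus a fresh error only where the neighbourhoods disagree. Since confined
  walks stay in K, the earlier errors are again summed over K, and C does not depend on K.\<close>

lemma confined_comparison:
  assumes X: "is_graph X" and Y: "is_graph Y"
  shows "\<exists>C\<ge>0. \<forall>K. finite K \<longrightarrow> (\<Sum>v\<in>K. norm (confined X K k v - adj_pow Y k (basis_vector v)))
            \<le> C * real (card {v \<in> K. nbrs X v \<inter> K \<noteq> nbrs Y v})"
proof (induction k)
  case 0 show ?case by (intro exI[of _ 0]) simp
next
  case (Suc k)
  obtain C where C: "0 \<le> C" "\<And>K. finite K \<Longrightarrow> (\<Sum>v\<in>K. norm (confined X K k v - adj_pow Y k (basis_vector v)))
            \<le> C * real (card {v \<in> K. nbrs X v \<inter> K \<noteq> nbrs Y v})"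
    using Suc by blast
  obtain d where d: "\<And>v. card (nbrs X v) \<le> d" using is_graph_degree_bound[OF X] by metis
  obtain d' where d': "\<And>v. card (nbrs Y v) \<le> d'" using is_graph_degree_bound[OF Y] by metis
  \<comment> \<open>Fresh error at a bad vertex: the two neighbour sums consist of at most d and d'
    unit vectors, and k further steps in Y multiply by at most the k-th power of the norm.\<close>
  let ?M = "norm (adjacency Y) ^ k * (real d + real d')"
  let ?e = "\<lambda>K v. norm (confined X K k v - adj_pow Y k (basis_vector v))"
  have "(\<Sum>v\<in>K. norm (confined X K (Suc k) v - adj_pow Y (Suc k) (basis_vector v)))
       \<le> (real d * C + ?M) * real (card {v \<in> K. nbrs X v \<inter> K \<noteq> nbrs Y v})" if K: "finite K" for K
  proof -
    let ?B = "{v \<in> K. nbrs X v \<inter> K \<noteq> nbrs Y v}"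
    have step: "norm (confined X K (Suc k) v - adj_pow Y (Suc k) (basis_vector v))
        \<le> (\<Sum>w\<in>{w\<in>K. adj X v w}. ?e K w) + (if v \<in> ?B then ?M else 0)" if v: "v \<in> K" for v
    proof -
      let ?a = "\<Sum>w\<in>nbrs X v \<inter> K. basis_vector w" and ?b = "\<Sum>w\<in>nbrs Y v. basis_vector w"
      have "adj_pow Y (Suc k) (basis_vector v) = adj_pow Y k ?b"
        by (simp add: funpow_swap1 adjacency_basis_vector[OF Y])
      then have "confined X K (Suc k) v - adj_pow Y (Suc k) (basis_vector v)
          = (confined X K (Suc k) v - adj_pow Y k ?a) + (adj_pow Y k (?a - ?b))"
        by (simp add: linear_diff[OF linear_adj_pow])
      also have "confined X K (Suc k) v - adj_pow Y k ?a
          = (\<Sum>w\<in>{w\<in>K. adj X v w}. confined X K k w - adj_pow Y k (basis_vector w))"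
        by (simp add: linear_sum[OF linear_adj_pow] sum_subtractf Int_def conj_commute)
      finally have "norm (confined X K (Suc k) v - adj_pow Y (Suc k) (basis_vector v))
          \<le> norm (\<Sum>w\<in>{w\<in>K. adj X v w}. confined X K k w - adj_pow Y k (basis_vector w))
            + norm (adj_pow Y k (?a - ?b))"
        by (simp only: norm_triangle_ineq)
      moreover have "norm (\<Sum>w\<in>{w\<in>K. adj X v w}. confined X K k w - adj_pow Y k (basis_vector w))
          \<le> (\<Sum>w\<in>{w\<in>K. adj X v w}. ?e K w)" by (rule norm_sum)
      moreover have "norm (adj_pow Y k (?a - ?b)) \<le> (if v \<in> ?B then ?M else 0)"
      proof (cases "v \<in> ?B")
        case True
        have "norm (?a :: 'a ell2) \<le> (\<Sum>w\<in>nbrs X v \<inter> K. 1)"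
          by (rule order_trans[OF norm_sum]) simp
        also have "\<dots> \<le> real d"
          using d[of v] card_mono[OF finite_nbrs[OF X], of "nbrs X v \<inter> K" v] by simp
        finally have a: "norm (?a :: 'a ell2) \<le> real d" .
        have "norm (?b :: 'a ell2) \<le> (\<Sum>w\<in>nbrs Y v. 1)"
          by (rule order_trans[OF norm_sum]) simp
        also have "\<dots> \<le> real d'" using d'[of v] by simp
        finally have b: "norm (?b :: 'a ell2) \<le> real d'" .
        have "norm (?a - ?b :: 'a ell2) \<le> real d + real d'"
          using norm_triangle_ineq4[of ?a ?b] a b by linarith
        then have "norm (adjacency Y) ^ k * norm (?a - ?b :: 'a ell2) \<le> ?M"
          by (intro mult_left_mono) auto
        then show ?thesis using True norm_adj_pow_le[of k Y "?a - ?b"] by simp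
      next
        case False
        then have "?a = ?b" using v by auto
        then show ?thesis using False linear_0[OF linear_adj_pow] by (simp only: diff_self) simp
      qed
      ultimately show ?thesis by linarith
    qed
    have "(\<Sum>v\<in>K. norm (confined X K (Suc k) v - adj_pow Y (Suc k) (basis_vector v)))
      \<le> (\<Sum>v\<in>K. (\<Sum>w\<in>{w\<in>K. adj X v w}. ?e K w) + (if v \<in> ?B then ?M else 0))"
      by (rule sum_mono) (rule step)
    also have "\<dots> = (\<Sum>v\<in>K. \<Sum>w\<in>{w\<in>K. adj X v w}. ?e K w) + (\<Sum>v\<in>K. if v \<in> ?B then ?M else 0)"
      by (rule sum.distrib)
    also have "(\<Sum>v\<in>K. if v \<in> ?B then ?M else 0) = ?M * real (card ?B)"
    proof -
      have "(\<Sum>v\<in>K. if v \<in> ?B then ?M else 0) = (\<Sum>v\<in>?B. ?M)"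
        by (rule sum.mono_neutral_cong_right[OF K]) auto
      then show ?thesis by simp
    qed
    also have "(\<Sum>v\<in>K. \<Sum>w\<in>{w\<in>K. adj X v w}. ?e K w) = (\<Sum>w\<in>K. \<Sum>v\<in>{v\<in>K. adj X v w}. ?e K w)"
      by (rule sum.swap_restrict[OF K K])
    also have "\<dots> \<le> (\<Sum>w\<in>K. real d * ?e K w)"
    proof (rule sum_mono)
      fix w
      have "card {v\<in>K. adj X v w} \<le> card (nbrs X w)"
        by (rule card_mono[OF finite_nbrs[OF X]]) (auto simp: adj_sym)
      also have "\<dots> \<le> d" by (rule d)
      finally show "(\<Sum>v\<in>{v\<in>K. adj X v w}. ?e K w) \<le> real d * ?e K w"
        by (simp add: mult_right_mono)
    qed
    also have "\<dots> \<le> real d * (C * real (card ?B))"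
      unfolding sum_distrib_left[symmetric] by (intro mult_left_mono C(2) K) simp
    finally show ?thesis by (simp add: algebra_simps)
  qed
  then show ?case using C(1) by (intro exI[of _ "real d * C + ?M"]) auto
qed

text \<open>Walks of X confined to J lie between the two counts: against X they err only at leaks,
  against Y only at leaks or changed neighbourhoods.\<close>

lemma walks_comparison:
  assumes X: "is_graph X" and Y: "is_graph Y"
  obtains C where "0 \<le> C" "\<And>J. finite J \<Longrightarrow> \<bar>(\<Sum>v\<in>J. walks X k v) - (\<Sum>v\<in>J. walks Y k v)\<bar>
            \<le> C * real (card {v \<in> J. v \<in> leak X J \<or> nbrs X v \<noteq> nbrs Y v})"
proof -
  obtain C1 where C1: "0 \<le> C1" "\<And>K. finite K \<Longrightarrow> (\<Sum>v\<in>K. norm (confined X K k v - adj_pow X k (basis_vector v)))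
            \<le> C1 * real (card {v \<in> K. nbrs X v \<inter> K \<noteq> nbrs X v})"
    using confined_comparison[OF X X, of k] by blast
  obtain C2 where C2: "0 \<le> C2" "\<And>K. finite K \<Longrightarrow> (\<Sum>v\<in>K. norm (confined X K k v - adj_pow Y k (basis_vector v)))
            \<le> C2 * real (card {v \<in> K. nbrs X v \<inter> K \<noteq> nbrs Y v})"
    using confined_comparison[OF X Y, of k] by blast
  show ?thesis
  proof
    show "0 \<le> C1 + C2" using C1 C2 by simp
    fix J :: "'a set" assume J: "finite J"
    let ?B = "{v \<in> J. v \<in> leak X J \<or> nbrs X v \<noteq> nbrs Y v}"
    have "\<bar>walks X k v - walks Y k v\<bar> \<le> norm (confined X J k v - adj_pow X k (basis_vector v))
        + norm (confined X J k v - adj_pow Y k (basis_vector v))" for v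
    proof -
      have "walks X k v - walks Y k v = (adj_pow X k (basis_vector v) - adj_pow Y k (basis_vector v)) \<bullet> basis_vector v"
        by (simp add: walks_def inner_diff_left)
      also have "\<bar>\<dots>\<bar> \<le> norm (adj_pow X k (basis_vector v) - adj_pow Y k (basis_vector v)) * norm (basis_vector v :: 'a ell2)"
        by (rule Cauchy_Schwarz_ineq2)
      also have "\<dots> = norm ((confined X J k v - adj_pow Y k (basis_vector v)) - (confined X J k v - adj_pow X k (basis_vector v)))"
        by simp
      also have "\<dots> \<le> norm (confined X J k v - adj_pow Y k (basis_vector v)) + norm (confined X J k v - adj_pow X k (basis_vector v))"
        by (rule norm_triangle_ineq4)
      finally show ?thesis by linarith
    qed
    then have "(\<Sum>v\<in>J. \<bar>walks X k v - walks Y k v\<bar>) \<le> (\<Sum>v\<in>J. norm (confined X J k v - adj_pow X k (basis_vector v))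
        + norm (confined X J k v - adj_pow Y k (basis_vector v)))"
      by (intro sum_mono)
    also have "\<dots> \<le> C1 * real (card {v \<in> J. nbrs X v \<inter> J \<noteq> nbrs X v}) + C2 * real (card {v \<in> J. nbrs X v \<inter> J \<noteq> nbrs Y v})"
      unfolding sum.distrib by (intro add_mono C1 C2 J)
    also have "\<dots> \<le> C1 * real (card ?B) + C2 * real (card ?B)"
      by (intro add_mono mult_left_mono C1 C2 of_nat_mono card_mono) (use J in \<open>auto simp: leak_def\<close>)
    finally have "(\<Sum>v\<in>J. \<bar>walks X k v - walks Y k v\<bar>) \<le> (C1 + C2) * real (card ?B)"
      by (simp add: distrib_right)
    moreover have "\<bar>(\<Sum>v\<in>J. walks X k v) - (\<Sum>v\<in>J. walks Y k v)\<bar> \<le> (\<Sum>v\<in>J. \<bar>walks X k v - walks Y k v\<bar>)"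
      unfolding sum_subtractf[symmetric] by (rule sum_abs)
    ultimately show "\<bar>(\<Sum>v\<in>J. walks X k v) - (\<Sum>v\<in>J. walks Y k v)\<bar> \<le> (C1 + C2) * real (card ?B)" by linarith
  qed
qed

section \<open>Averages along an exhaustion and their stability\<close>

lemma exhaustion_eventually_superset:
  assumes K: "exhaustion X K" and S: "finite S" "S \<subseteq> verts X"
  shows "\<forall>\<^sub>F n in sequentially. S \<subseteq> K n"
proof -
  have "\<forall>x\<in>S. \<forall>\<^sub>F n in sequentially. x \<in> K n"
  proof
    fix x assume "x \<in> S"
    then have "x \<in> (\<Union>n. K n)" using K S(2) by (auto simp: exhaustion_def)
    then obtain m where "x \<in> K m" by blast
    moreover have "K m \<subseteq> K n" if "m \<le> n" for n using K that by (simp add: exhaustion_def incseq_def)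
    ultimately show "\<forall>\<^sub>F n in sequentially. x \<in> K n" unfolding eventually_sequentially by blast
  qed
  then show ?thesis using eventually_ball_finite[OF S(1)] by (simp add: subset_iff Ball_def)
qed

lemma exhaustion_card_at_top:
  assumes K: "exhaustion X K" and "infinite (verts X)"
  shows "filterlim (\<lambda>n. real (card (K n))) at_top sequentially"
proof (rule filterlim_compose[OF filterlim_real_sequentially], unfold filterlim_at_top, intro allI)
  fix N :: nat
  obtain S where S: "S \<subseteq> verts X" "finite S" "card S = N"
    using infinite_arbitrarily_large[OF assms(2)] by metis
  show "\<forall>\<^sub>F n in sequentially. N \<le> card (K n)"
    using exhaustion_eventually_superset[OF K S(2,1)]
    by eventually_elim (use S(3) K card_mono in \<open>auto simp: exhaustion_def\<close>)
qed

text \<open>The common bookkeeping of the three cases of the induction: numerators may change by a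
  multiple of o(a) plus a constant, denominators by a constant, and a tends to infinity.\<close>

lemma density_limit_perturb:
  fixes a b x y l :: "nat \<Rightarrow> real"
  assumes x: "(\<lambda>n. x n / a n) \<longlonglongrightarrow> m" and l: "(\<lambda>n. l n / a n) \<longlonglongrightarrow> 0"
    and a: "filterlim a at_top sequentially"
    and y: "\<And>n. \<bar>y n - x n\<bar> \<le> C * l n + c" and b: "\<And>n. \<bar>b n - a n\<bar> \<le> c'"
  shows "(\<lambda>n. y n / b n) \<longlonglongrightarrow> m"
proof -
  have inv: "(\<lambda>n. 1 / a n) \<longlonglongrightarrow> 0"
    using tendsto_inverse_0_at_top[OF a] by (simp add: inverse_eq_divide)
  have pos: "\<forall>\<^sub>F n in sequentially. a n > 0" using a by (simp add: filterlim_at_top_dense)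
  have "(\<lambda>n. (y n - x n) / a n) \<longlonglongrightarrow> 0"
  proof (rule Lim_null_comparison)
    show "(\<lambda>n. C * (l n / a n) + c * (1 / a n)) \<longlonglongrightarrow> 0"
      using tendsto_add[OF tendsto_mult_left[OF l, of C] tendsto_mult_left[OF inv, of c]] by simp
    show "\<forall>\<^sub>F n in sequentially. norm ((y n - x n) / a n) \<le> C * (l n / a n) + c * (1 / a n)"
      using pos
    proof eventually_elim
      case (elim n)
      then have "\<bar>y n - x n\<bar> / a n \<le> (C * l n + c) / a n" using y by (intro divide_right_mono) auto
      then show ?case using elim by (simp add: add_divide_distrib)
    qed
  qed
  from tendsto_add[OF this x] have ya: "(\<lambda>n. y n / a n) \<longlonglongrightarrow> m" by (simp add: diff_divide_distrib)
  have "(\<lambda>n. (b n - a n) / a n) \<longlonglongrightarrow> 0"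
  proof (rule Lim_null_comparison)
    show "(\<lambda>n. c' * (1 / a n)) \<longlonglongrightarrow> 0" using tendsto_mult_left[OF inv, of c'] by simp
    show "\<forall>\<^sub>F n in sequentially. norm ((b n - a n) / a n) \<le> c' * (1 / a n)"
      using pos by eventually_elim (use b in \<open>auto intro: divide_right_mono\<close>)
  qed
  from tendsto_add[OF this tendsto_const[of 1]]
  have "(\<lambda>n. (b n - a n) / a n + 1) \<longlonglongrightarrow> 1" by simp
  moreover have "\<forall>\<^sub>F n in sequentially. (b n - a n) / a n + 1 = b n / a n"
    using pos by eventually_elim (simp add: field_simps)
  ultimately have "(\<lambda>n. b n / a n) \<longlonglongrightarrow> 1" by (rule Lim_transform_eventually)
  from tendsto_divide[OF ya this] have "(\<lambda>n. (y n / a n) / (b n / a n)) \<longlonglongrightarrow> m" by simp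
  moreover have "\<forall>\<^sub>F n in sequentially. (y n / a n) / (b n / a n) = y n / b n"
    using pos by eventually_elim simp
  ultimately show ?thesis by (rule Lim_transform_eventually)
qed

text \<open>The invariant of the induction over \<open>essentially_periodic\<close>, inherited under
  both kinds of perturbation. Infinitely many vertices force \<open>card (K n)\<close> to infinity,
  which makes finite changes negligible.\<close>

definition homogeneous :: "'v graph \<Rightarrow> (nat \<Rightarrow> 'v set) \<Rightarrow> bool" where
  "homogeneous X K \<longleftrightarrow> is_graph X \<and> infinite (verts X) \<and> exhaustion X K
     \<and> (\<lambda>n. real (card (leak X (K n))) / real (card (K n))) \<longlonglongrightarrow> 0
     \<and> (\<forall>k. convergent (\<lambda>n. (\<Sum>v\<in>K n. walks X k v) / real (card (K n))))"


lemma homogeneousD: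
  assumes "homogeneous X K"
  shows "is_graph X" "infinite (verts X)" "exhaustion X K" "\<And>n. finite (K n)"
    "(\<lambda>n. real (card (leak X (K n))) / real (card (K n))) \<longlonglongrightarrow> 0"
    "filterlim (\<lambda>n. real (card (K n))) at_top sequentially"
  using assms exhaustion_card_at_top by (auto simp: homogeneous_def exhaustion_def)

text \<open>For self-adjoint D the trace of D^2 over K is the sum of the squared norms of D on basis
  vectors, and the entries of D are 0 or of modulus 1.\<close>

lemma mismatch_le_trace:
  assumes X: "is_graph X" and Y: "is_graph Y" and K: "finite K"
  defines "D \<equiv> adjacency X - adjacency Y"
  shows "real (card {v \<in> K. nbrs X v \<noteq> nbrs Y v}) \<le> Re (trace_on K (D o\<^sub>L D))"
proof -
  have "self_adjoint D" unfolding D_def by (intro self_adjoint_diff self_adjoint_adjacency X Y)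
  then have tr: "Re (trace_on K (D o\<^sub>L D)) = (\<Sum>v\<in>K. (norm (D (basis_vector v)))\<^sup>2)"
    unfolding trace_on_def Re_sum
    by (intro sum.cong refl) (simp add: inner_basis_vector[symmetric] self_adjointD power2_norm_eq_inner)
  have "1 \<le> (norm (D (basis_vector v)))\<^sup>2" if ne: "nbrs X v \<noteq> nbrs Y v" for v
  proof -
    obtain w where w: "adj X v w \<noteq> adj Y v w" using ne by auto
    have "coord (adjacency Z (basis_vector v)) w = (if adj Z v w then 1 else 0)" if "is_graph Z" for Z
      using finite_nbrs[OF that] by (simp add: adjacency_basis_vector[OF that])
    then have "cmod (coord (D (basis_vector v)) w) = 1"
      using w X Y by (auto simp: D_def blinfun.bilinear_simps)
    then have "1 \<le> norm (D (basis_vector v))" using cmod_coord_le_norm by metis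
    then show ?thesis by simp
  qed
  then have "(\<Sum>v\<in>{v \<in> K. nbrs X v \<noteq> nbrs Y v}. 1) \<le> (\<Sum>v\<in>{v \<in> K. nbrs X v \<noteq> nbrs Y v}. (norm (D (basis_vector v)))\<^sup>2)"
    by (intro sum_mono) auto
  also have "\<dots> \<le> (\<Sum>v\<in>K. (norm (D (basis_vector v)))\<^sup>2)" by (rule sum_mono2[OF K]) auto
  finally show ?thesis by (simp add: tr)
qed

lemma density_zero_mismatch:
  assumes X: "homogeneous X K" and Y: "density_zero_perturbation K X Y"
  shows "(\<lambda>n. (real (card (leak X (K n))) + real (card {v \<in> K n. nbrs X v \<noteq> nbrs Y v})) / real (card (K n))) \<longlonglongrightarrow> 0"
proof -
  note X' = homogeneousD[OF X]
  let ?D = "adjacency X - adjacency Y"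
  have "(\<lambda>n. trace_on (K n) (?D o\<^sub>L ?D) / of_nat (card (K n))) \<longlonglongrightarrow> 0"
    using Y by (simp add: density_zero_perturbation_def essentially_zero_def)
  from tendsto_Re[OF this] have "(\<lambda>n. Re (trace_on (K n) (?D o\<^sub>L ?D)) / real (card (K n))) \<longlonglongrightarrow> 0"
    by (simp add: Re_divide_of_nat)
  then have "(\<lambda>n. real (card {v \<in> K n. nbrs X v \<noteq> nbrs Y v}) / real (card (K n))) \<longlonglongrightarrow> 0"
  proof (rule Lim_null_comparison[rotated], intro always_eventually allI)
    fix n
    have "real (card {v \<in> K n. nbrs X v \<noteq> nbrs Y v}) \<le> Re (trace_on (K n) (?D o\<^sub>L ?D))"
      using Y by (intro mismatch_le_trace X') (simp add: density_zero_perturbation_def)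
    then show "norm (real (card {v \<in> K n. nbrs X v \<noteq> nbrs Y v}) / real (card (K n)))
        \<le> Re (trace_on (K n) (?D o\<^sub>L ?D)) / real (card (K n))"
      by (simp add: divide_right_mono)
  qed
  from tendsto_add[OF X'(5) this] show ?thesis by (simp add: add_divide_distrib)
qed

text \<open>The limit itself is preserved, beyond mere convergence. This is what later gives X and Y
  one and the same N.\<close>

lemma density_zero_walks:
  assumes X: "homogeneous X K" and Y: "density_zero_perturbation K X Y"
    and m: "(\<lambda>n. (\<Sum>v\<in>K n. walks X k v) / real (card (K n))) \<longlonglongrightarrow> m"
  shows "(\<lambda>n. (\<Sum>v\<in>K n. walks Y k v) / real (card (K n))) \<longlonglongrightarrow> m"
proof -
  note X' = homogeneousD[OF X]
  have Yg: "is_graph Y" using Y by (simp add: density_zero_perturbation_def)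
  obtain C where C: "0 \<le> C" "\<And>J. finite J \<Longrightarrow> \<bar>(\<Sum>v\<in>J. walks X k v) - (\<Sum>v\<in>J. walks Y k v)\<bar>
            \<le> C * real (card {v \<in> J. v \<in> leak X J \<or> nbrs X v \<noteq> nbrs Y v})"
    by (rule walks_comparison[OF X'(1) Yg, where k = k]) blast
  show ?thesis
  proof (rule density_limit_perturb[OF m density_zero_mismatch[OF X Y] X'(6)])
    fix n
    let ?M = "{v \<in> K n. nbrs X v \<noteq> nbrs Y v}"
    have "card {v \<in> K n. v \<in> leak X (K n) \<or> nbrs X v \<noteq> nbrs Y v} \<le> card (leak X (K n) \<union> ?M)"
      by (rule card_mono) (use X'(4)[of n] finite_leak[of "K n" X] in auto)
    also have "\<dots> \<le> card (leak X (K n)) + card ?M" by (rule card_Un_le)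
    finally have "C * real (card {v \<in> K n. v \<in> leak X (K n) \<or> nbrs X v \<noteq> nbrs Y v})
        \<le> C * real (card (leak X (K n)) + card ?M)"
      using C(1) by (intro mult_left_mono of_nat_mono)
    then show "\<bar>(\<Sum>v\<in>K n. walks Y k v) - (\<Sum>v\<in>K n. walks X k v)\<bar>
        \<le> C * (real (card (leak X (K n))) + real (card ?M)) + 0"
      using C(2)[OF X'(4)[of n]] by (simp add: abs_minus_commute)
    show "\<bar>real (card (K n)) - real (card (K n))\<bar> \<le> 0" by simp
  qed
qed

lemma homogeneous_density_zero:
  assumes X: "homogeneous X K" and Y: "density_zero_perturbation K X Y"
  shows "homogeneous Y K"
  unfolding homogeneous_def
proof (intro conjI allI)
  note X' = homogeneousD[OF X]
  show "is_graph Y" using Y by (simp add: density_zero_perturbation_def)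
  show "infinite (verts Y)" "exhaustion Y K"
    using Y X'(2,3) by (auto simp: density_zero_perturbation_def exhaustion_def)
  show "(\<lambda>n. real (card (leak Y (K n))) / real (card (K n))) \<longlonglongrightarrow> 0"
  proof (rule density_limit_perturb[OF _ density_zero_mismatch[OF X Y] X'(6), of "\<lambda>_. 0"])
    fix n
    have "card (leak Y (K n)) \<le> card (leak X (K n) \<union> {v \<in> K n. nbrs X v \<noteq> nbrs Y v})"
      by (rule card_mono) (use X'(4)[of n] finite_leak[of "K n" X] in \<open>auto simp: leak_def\<close>)
    also have "\<dots> \<le> card (leak X (K n)) + card {v \<in> K n. nbrs X v \<noteq> nbrs Y v}" by (rule card_Un_le)
    finally show "\<bar>real (card (leak Y (K n))) - 0\<bar>
        \<le> 1 * (real (card (leak X (K n))) + real (card {v \<in> K n. nbrs X v \<noteq> nbrs Y v})) + 0" by simp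
    show "\<bar>real (card (K n)) - real (card (K n))\<bar> \<le> 0" by simp
  qed simp
  fix k
  obtain m where "(\<lambda>n. (\<Sum>v\<in>K n. walks X k v) / real (card (K n))) \<longlonglongrightarrow> m"
    using X by (auto simp: homogeneous_def convergent_def)
  from density_zero_walks[OF X Y this]
  show "convergent (\<lambda>n. (\<Sum>v\<in>K n. walks Y k v) / real (card (K n)))" by (rule convergentI)
qed

text \<open>Walks are compared on the common core J n of K n and L n. Both sets exceed the core only
  inside a fixed finite set Z, where each walk count is bounded, so the rest contributes
  O(1).\<close>

lemma homogeneous_finite_perturbation:
  assumes X: "homogeneous X K" and pert: "finite_perturbation X K Y L"
  shows "homogeneous Y L"
proof -
  note X' = homogeneousD[OF X]
  have Y: "is_graph Y" and L: "exhaustion Y L" "\<And>n. finite (L n)" and LK: "\<And>n. L n \<inter> verts X = K n \<inter> verts Y"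
    and fin: "finite (sym_diff (verts X) (verts Y))" "finite (sym_diff (edges X) (edges Y))"
    using pert by (auto simp: finite_perturbation_def exhaustion_def)
  have KX: "K n \<subseteq> verts X" for n using X'(3) by (auto simp: exhaustion_def)
  have LY: "L n \<subseteq> verts Y" for n using L by (auto simp: exhaustion_def)
  \<comment> \<open>All vertices touched by the change: created or deleted ones and the endpoints of
    altered edges. Outside Z the two neighbourhoods agree.\<close>
  define Z where "Z = sym_diff (verts X) (verts Y) \<union> \<Union> (sym_diff (edges X) (edges Y))"
  have fe: "finite e" if e: "e \<in> edges W" "is_graph W" for e and W :: "'a graph"
  proof -
    obtain u v where "e = {u, v}" using e unfolding is_graph_def by blast
    then show ?thesis by simp
  qed
  have "finite (\<Union> (sym_diff (edges X) (edges Y)))"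
    by (rule finite_Union[OF fin(2)]) (use fe[OF _ X'(1)] fe[OF _ Y] in blast)
  then have Z: "finite Z" unfolding Z_def by (rule finite_UnI[OF fin(1)])
  have nZ: "nbrs X v = nbrs Y v" if "v \<notin> Z" for v
  proof -
    have "{v, w} \<in> edges X \<longleftrightarrow> {v, w} \<in> edges Y" for w
    proof (rule ccontr)
      assume "\<not> ?thesis"
      then have "{v, w} \<in> sym_diff (edges X) (edges Y)" by blast
      then have "v \<in> \<Union> (sym_diff (edges X) (edges Y))" by (rule UnionI) simp
      then show False using that by (simp add: Z_def)
    qed
    then show ?thesis by (simp add: adj_def)
  qed
  define J where "J n = K n \<inter> verts Y" for n
  have J: "finite (J n)" "J n \<subseteq> K n" "J n \<subseteq> L n" for n using X'(4) LK by (auto simp: J_def)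
  have KJ: "K n - J n \<subseteq> Z" and LJ: "L n - J n \<subseteq> Z" for n
    using KX[of n] LY[of n] LK[of n] by (auto simp: J_def Z_def)
  \<comment> \<open>Passing from K n to the core creates no new leak off Z: the neighbours stay in K
    n, and they belong to Y because they are also neighbours in Y.\<close>
  have closed: "nbrs X v \<subseteq> J n" if "v \<in> J n" "v \<notin> Z" "v \<notin> leak X (K n)" for v n
  proof -
    have "nbrs X v \<subseteq> K n" using that J by (auto simp: leak_def)
    moreover have "nbrs X v \<subseteq> verts Y" using nZ[OF that(2)] adj_verts[OF Y] by auto
    ultimately show ?thesis by (simp add: J_def)
  qed
  let ?z = "real (card Z)"
  have cd: "\<bar>real (card (L n)) - real (card (K n))\<bar> \<le> ?z" for n
  proof -
    have "card (K n) = card (J n) + card (K n - J n)" "card (L n) = card (J n) + card (L n - J n)"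
      using J X'(4)[of n] L(2)[of n] by (simp_all add: card_Diff_subset card_mono)
    moreover have "card (K n - J n) \<le> card Z" "card (L n - J n) \<le> card Z"
      by (intro card_mono Z KJ LJ)+
    ultimately show ?thesis by linarith
  qed
  have leakYL: "real (card (leak Y (L n))) \<le> real (card (leak X (K n))) + ?z" for n
  proof -
    have "leak Y (L n) \<subseteq> leak X (K n) \<union> Z"
    proof
      fix v assume v: "v \<in> leak Y (L n)"
      show "v \<in> leak X (K n) \<union> Z"
      proof (rule ccontr)
        assume n: "v \<notin> leak X (K n) \<union> Z"
        then have "v \<in> J n" using v LJ[of n] by (auto simp: leak_def)
        then have "nbrs Y v \<subseteq> L n" using closed[of v n] n nZ[of v] J(3)[of n] by auto
        then show False using v by (simp add: leak_def)
      qed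
    qed
    then have "card (leak Y (L n)) \<le> card (leak X (K n) \<union> Z)"
      by (intro card_mono) (use Z finite_leak[OF X'(4)] in auto)
    also have "\<dots> \<le> card (leak X (K n)) + card Z" by (rule card_Un_le)
    finally show ?thesis by simp
  qed
  show ?thesis unfolding homogeneous_def
  proof (intro conjI allI)
    show "is_graph Y" "exhaustion Y L" by fact+
    have "verts X \<subseteq> verts Y \<union> sym_diff (verts X) (verts Y)" by auto
    then show "infinite (verts Y)" using X'(2) fin(1) by (meson finite_UnI finite_subset)
    show "(\<lambda>n. real (card (leak Y (L n))) / real (card (L n))) \<longlonglongrightarrow> 0"
    proof (rule density_limit_perturb[OF _ X'(5) X'(6), of "\<lambda>_. 0"])
      show "\<bar>real (card (leak Y (L n))) - 0\<bar> \<le> 1 * real (card (leak X (K n))) + ?z" for n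
        using leakYL[of n] by simp
      show "\<bar>real (card (L n)) - real (card (K n))\<bar> \<le> ?z" for n by (rule cd)
    qed simp
    fix k
    obtain m where m: "(\<lambda>n. (\<Sum>v\<in>K n. walks X k v) / real (card (K n))) \<longlonglongrightarrow> m"
      using X by (auto simp: homogeneous_def convergent_def)
    obtain C where C: "0 \<le> C" "\<And>J. finite J \<Longrightarrow> \<bar>(\<Sum>v\<in>J. walks X k v) - (\<Sum>v\<in>J. walks Y k v)\<bar>
            \<le> C * real (card {v \<in> J. v \<in> leak X J \<or> nbrs X v \<noteq> nbrs Y v})"
      by (rule walks_comparison[OF X'(1) Y, where k = k]) blast
    have rest: "\<bar>(\<Sum>v\<in>S. walks W k v) - (\<Sum>v\<in>J n. walks W k v)\<bar> \<le> norm (adjacency W) ^ k * ?z"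
      if "finite S" "J n \<subseteq> S" "S - J n \<subseteq> Z" for S n and W :: "'a graph"
    proof -
      have "(\<Sum>v\<in>S. walks W k v) - (\<Sum>v\<in>J n. walks W k v) = (\<Sum>v\<in>S - J n. walks W k v)"
        using sum.subset_diff[OF that(2,1), of "walks W k"] by simp
      also have "\<bar>\<dots>\<bar> \<le> (\<Sum>v\<in>S - J n. norm (adjacency W) ^ k)"
        by (rule order_trans[OF sum_abs]) (intro sum_mono abs_walks_le)
      also have "\<dots> = norm (adjacency W) ^ k * real (card (S - J n))" by simp
      also have "\<dots> \<le> norm (adjacency W) ^ k * ?z"
        using card_mono[OF Z that(3)] by (intro mult_left_mono) auto
      finally show ?thesis .
    qed
    have "(\<lambda>n. (\<Sum>v\<in>L n. walks Y k v) / real (card (L n))) \<longlonglongrightarrow> m"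
    proof (rule density_limit_perturb[OF m X'(5) X'(6)])
      fix n
      have "{v \<in> J n. v \<in> leak X (J n) \<or> nbrs X v \<noteq> nbrs Y v} \<subseteq> leak X (K n) \<union> Z"
      proof (rule subsetI, rule ccontr)
        fix v assume v: "v \<in> {v \<in> J n. v \<in> leak X (J n) \<or> nbrs X v \<noteq> nbrs Y v}" "v \<notin> leak X (K n) \<union> Z"
        then have "nbrs X v \<subseteq> J n" "nbrs X v = nbrs Y v" using closed[of v n] nZ[of v] by blast+
        then show False using v(1) by (simp add: leak_def)
      qed
      then have "card {v \<in> J n. v \<in> leak X (J n) \<or> nbrs X v \<noteq> nbrs Y v} \<le> card (leak X (K n) \<union> Z)"
        by (intro card_mono) (use Z finite_leak[OF X'(4)] in auto)
      also have "\<dots> \<le> card (leak X (K n)) + card Z" by (rule card_Un_le)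
      finally have "C * real (card {v \<in> J n. v \<in> leak X (J n) \<or> nbrs X v \<noteq> nbrs Y v})
          \<le> C * real (card (leak X (K n)) + card Z)"
        using C(1) by (intro mult_left_mono of_nat_mono)
      then show "\<bar>(\<Sum>v\<in>L n. walks Y k v) - (\<Sum>v\<in>K n. walks X k v)\<bar>
          \<le> C * real (card (leak X (K n))) + (C * ?z + norm (adjacency X) ^ k * ?z + norm (adjacency Y) ^ k * ?z)"
        using C(2)[OF J(1)[of n]] rest[where S = "K n" and n = n and W = X, OF X'(4) J(2) KJ] rest[where S = "L n" and n = n and W = Y, OF L(2) J(3) LJ]
        by (simp add: distrib_left)
      show "\<bar>real (card (L n)) - real (card (K n))\<bar> \<le> ?z" by (rule cd)
    qed
    then show "convergent (\<lambda>n. (\<Sum>v\<in>L n. walks Y k v) / real (card (L n)))" by (rule convergentI)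
  qed
qed

section \<open>Periodic graphs: mean walk counts from a fundamental domain\<close>

lemma leak_subset_boundary:
  assumes X: "is_graph X"
  shows "leak X K \<subseteq> boundary X K"
proof
  fix v assume "v \<in> leak X K"
  then obtain w where v: "v \<in> K" and w: "adj X v w" "w \<notin> K" by (auto simp: leak_def)
  let ?R = "{(a, b). adj X a b}" and ?S = "verts X - K"
  let ?I = "{enat n | n. \<exists>w\<in>?S. (v, w) \<in> ?R ^^ n}"
  have wS: "w \<in> ?S" using w adj_verts[OF X] by auto
  have "Inf ?I \<le> 1"
  proof (rule Inf_lower)
    have "(v, w) \<in> ?R ^^ 1" using w by simp
    then show "1 \<in> ?I" using wS one_enat_def by blast
  qed
  moreover have "1 \<le> Inf ?I"
  proof (rule Inf_greatest)
    fix x assume "x \<in> ?I"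
    then obtain n u where x: "x = enat n" "u \<in> ?S" "(v, u) \<in> ?R ^^ n" by blast
    then have "n \<noteq> 0" using v by (cases n) auto
    then show "1 \<le> x" by (simp add: x one_enat_def)
  qed
  ultimately have "dist_to_set X v ?S = 1" unfolding dist_to_set_def by (rule antisym)
  then show "v \<in> boundary X K" using v by (simp add: boundary_def)
qed

lemma walks_automorphism:
  assumes X: "is_graph X" and g: "graph_automorphism X g" and v: "v \<in> verts X"
  shows "walks X k (g v) = walks X k v"
proof -
  have bij: "bij_betw g (verts X) (verts X)"
    and adj: "\<And>u v. u \<in> verts X \<Longrightarrow> v \<in> verts X \<Longrightarrow> adj X (g u) (g v) \<longleftrightarrow> adj X u v"
    using g by (auto simp: graph_automorphism_def Bij_def)
  have inj: "inj_on g (verts X)" and surj: "g ` verts X = verts X"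
    using bij by (auto simp: bij_betw_def)
  have nb: "nbrs X (g u) = g ` nbrs X u" if u: "u \<in> verts X" for u
  proof (intro equalityI subsetI)
    fix w assume w: "w \<in> nbrs X (g u)"
    then have "w \<in> verts X" using adj_verts[OF X] by auto
    then obtain x where "x \<in> verts X" "w = g x" using surj by blast
    then show "w \<in> g ` nbrs X u" using w adj u by auto
  next
    fix w assume "w \<in> g ` nbrs X u"
    then show "w \<in> nbrs X (g u)" using adj u adj_verts[OF X] by auto
  qed
  \<comment> \<open>The induction runs over all entries (u, v), because diagonal entries alone do
    not determine those of the next power.\<close>
  have "coord (adj_pow X k (basis_vector (g v))) (g u) = coord (adj_pow X k (basis_vector v)) u"
    if "u \<in> verts X" for u
    using that
  proof (induction k arbitrary: u)
    case 0
    then show ?case using inj v by (auto dest: inj_onD)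
  next
    case (Suc k)
    have sub: "nbrs X u \<subseteq> verts X" using adj_verts[OF X] by auto
    have "coord (adj_pow X (Suc k) (basis_vector (g v))) (g u)
        = (\<Sum>w\<in>g ` nbrs X u. coord (adj_pow X k (basis_vector (g v))) w)"
      by (simp add: coord_adjacency[OF X] nb[OF Suc.prems])
    also have "\<dots> = (\<Sum>w\<in>nbrs X u. coord (adj_pow X k (basis_vector (g v))) (g w))"
      by (subst sum.reindex[OF inj_on_subset[OF inj sub]]) simp
    also have "\<dots> = (\<Sum>w\<in>nbrs X u. coord (adj_pow X k (basis_vector v)) w)"
      by (rule sum.cong[OF refl]) (use Suc.IH sub in auto)
    also have "\<dots> = coord (adj_pow X (Suc k) (basis_vector v)) u"
      by (simp add: coord_adjacency[OF X])
    finally show ?case .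
  qed
  then show ?thesis using v by (simp add: walks_def inner_basis_vector)
qed

text \<open>Up to boundary vertices K n is a disjoint union of translates of F, and each translate
  has the same sum of walk counts. The mean is therefore that over F, with an error bounded by a
  multiple of the boundary ratio.\<close>

lemma homogeneous_periodic:
  assumes per: "periodic_amenable_graph X K"
  shows "homogeneous X K"
proof -
  let ?V = "verts X"
  let ?B = "BijGroup ?V"
  have X: "is_graph X" "infinite ?V" "exhaustion X K" "\<And>n. finite (K n)"
    and bd: "(\<lambda>n. real (card (boundary X (K n))) / real (card (K n))) \<longlonglongrightarrow> 0"
    using per by (auto simp: periodic_amenable_graph_def amenable_exhaustion_def exhaustion_def)
  obtain \<Gamma> F E where \<Gamma>: "subgroup \<Gamma> ?B" and aut: "\<And>g. g \<in> \<Gamma> \<Longrightarrow> graph_automorphism X g"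
    and free: "\<And>g v. g \<in> \<Gamma> \<Longrightarrow> v \<in> ?V \<Longrightarrow> g v = v \<Longrightarrow> g = \<one>\<^bsub>?B\<^esub>"
    and orb: "finite (orbit_of \<Gamma> ` ?V)"
    and F: "F \<subseteq> ?V" "\<And>v. v \<in> ?V \<Longrightarrow> \<exists>!w. w \<in> F \<inter> orbit_of \<Gamma> v"
    and E: "\<And>n. E n \<subseteq> \<Gamma>" "\<And>n. finite (E n)" "\<And>n. K n - boundary X (K n) \<subseteq> (\<Union>g\<in>E n. g ` F)"
      "\<And>n. (\<Union>g\<in>E n. g ` F) \<subseteq> K n"
  proof -
    from per obtain \<Gamma> F E where *: "subgroup \<Gamma> ?B" "\<forall>g\<in>\<Gamma>. graph_automorphism X g"
      "\<forall>g\<in>\<Gamma>. \<forall>v\<in>?V. g v = v \<longrightarrow> g = \<one>\<^bsub>?B\<^esub>" "finite (orbit_of \<Gamma> ` ?V)"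
      "F \<subseteq> ?V" "\<forall>v\<in>?V. \<exists>!w. w \<in> F \<inter> orbit_of \<Gamma> v"
      "\<forall>n. E n \<subseteq> \<Gamma> \<and> finite (E n) \<and> K n - boundary X (K n) \<subseteq> (\<Union>g\<in>E n. g ` F) \<and> (\<Union>g\<in>E n. g ` F) \<subseteq> K n"
      unfolding periodic_amenable_graph_def by (elim conjE exE)
    show thesis
      by (rule that[of \<Gamma> F E, OF *(1) _ _ *(4,5)])
        (erule bspec[OF *(2)] bspec[OF bspec[OF *(3)], THEN mp] bspec[OF *(6)] | use *(7) in blast)+
  qed
  interpret B: group ?B by (rule group_BijGroup)
  have \<Gamma>B: "g \<in> Bij ?V" if "g \<in> \<Gamma>" for g
    using subgroup.subset[OF \<Gamma>] that by (auto simp: BijGroup_def)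
  have mult: "(g \<otimes>\<^bsub>?B\<^esub> h) v = g (h v)" if "g \<in> \<Gamma>" "h \<in> \<Gamma>" "v \<in> ?V" for g h v
    using that \<Gamma>B by (simp add: BijGroup_def compose_def)
  have one: "\<one>\<^bsub>?B\<^esub> \<in> \<Gamma>" "\<And>v. v \<in> ?V \<Longrightarrow> \<one>\<^bsub>?B\<^esub> v = v"
    using subgroup.one_closed[OF \<Gamma>] by (auto simp: BijGroup_def)
  have self: "v \<in> orbit_of \<Gamma> v" if "v \<in> ?V" for v
  proof -
    have "v = \<one>\<^bsub>?B\<^esub> v" using one(2)[OF that] by simp
    then show ?thesis using one(1) unfolding orbit_of_def by blast
  qed
  have Funiq: "w = w'" if "w \<in> F" "w' \<in> F" "w' \<in> orbit_of \<Gamma> w" for w w'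
    using F(2)[of w] F(1) self[of w] that by blast
  \<comment> \<open>F meets every orbit exactly once, so it injects into the finite set of
    orbits.\<close>
  have finF: "finite F"
  proof (rule inj_on_finite[OF _ _ orb])
    show "inj_on (orbit_of \<Gamma>) F"
    proof (rule inj_onI)
      fix w w' assume "w \<in> F" "w' \<in> F" "orbit_of \<Gamma> w = orbit_of \<Gamma> w'"
      then show "w = w'" using Funiq[of w w'] self[of w'] F(1) by auto
    qed
    show "orbit_of \<Gamma> ` F \<subseteq> orbit_of \<Gamma> ` ?V" using F(1) by auto
  qed
  have "F \<noteq> {}"
  proof -
    obtain v where "v \<in> ?V" using X(2) by (metis ex_in_conv finite.emptyI)
    then show ?thesis using F(2) by blast
  qed
  then have cF: "card F > 0" using finF by (simp add: card_gt_0_iff)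
  \<comment> \<open>Translates do not overlap: if g w = g' w', then w and w' share an orbit and
    coincide in F, and the inverse of g' times g fixes w, hence is the identity by freeness.\<close>
  have inj: "inj_on (\<lambda>(g, w). g w) (\<Gamma> \<times> F)"
  proof (rule inj_onI, clarify)
    fix g w g' w' assume *: "g \<in> \<Gamma>" "w \<in> F" "g' \<in> \<Gamma>" "w' \<in> F" "g w = g' w'"
    let ?h = "inv\<^bsub>?B\<^esub> g'"
    have h: "?h \<in> \<Gamma>" using subgroup.m_inv_closed[OF \<Gamma> *(3)] .
    have car: "g \<in> carrier ?B" "g' \<in> carrier ?B" using subgroup.subset[OF \<Gamma>] * by auto
    have "?h (g w) = ?h (g' w')" using * by simp
    also have "\<dots> = (?h \<otimes>\<^bsub>?B\<^esub> g') w'" using mult[OF h *(3)] * F(1) by auto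
    also have "\<dots> = w'" using car * F(1) one(2) by (auto simp: B.l_inv)
    finally have hw: "(?h \<otimes>\<^bsub>?B\<^esub> g) w = w'" using mult[OF h *(1)] * F(1) by auto
    have hg: "?h \<otimes>\<^bsub>?B\<^esub> g \<in> \<Gamma>" using subgroup.m_closed[OF \<Gamma> h *(1)] .
    have "w' \<in> orbit_of \<Gamma> w" using hw hg by (auto simp: orbit_of_def)
    then have w: "w = w'" using Funiq * by blast
    then have "?h \<otimes>\<^bsub>?B\<^esub> g = \<one>\<^bsub>?B\<^esub>" using free[OF hg] hw * F(1) by auto
    then have "g = g'" using car by (metis B.inv_closed B.inv_equality B.inv_inv)
    then show "g = g' \<and> w = w'" using w by simp
  qed
  have leak0: "(\<lambda>n. real (card (leak X (K n))) / real (card (K n))) \<longlonglongrightarrow> 0"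
  proof (rule Lim_null_comparison[OF _ bd], intro always_eventually allI)
    fix n
    have "card (leak X (K n)) \<le> card (boundary X (K n))"
      by (rule card_mono[OF _ leak_subset_boundary[OF X(1)]]) (use X(4)[of n] in \<open>simp add: boundary_def\<close>)
    then show "norm (real (card (leak X (K n))) / real (card (K n)))
        \<le> real (card (boundary X (K n))) / real (card (K n))" by (simp add: divide_right_mono)
  qed
  have lim: "filterlim (\<lambda>n. real (card (K n))) at_top sequentially"
    by (rule exhaustion_card_at_top[OF X(3,2)])
  have "convergent (\<lambda>n. (\<Sum>v\<in>K n. walks X k v) / real (card (K n)))" for k
  proof -
    define m where "m = (\<Sum>w\<in>F. walks X k w) / real (card F)"
    let ?M = "norm (adjacency X) ^ k"
    have "(\<lambda>n. (m * real (card (K n))) / real (card (K n))) \<longlonglongrightarrow> m"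
    proof (rule Lim_transform_eventually[OF tendsto_const])
      have "\<forall>\<^sub>F n in sequentially. 0 < real (card (K n))"
        using lim unfolding filterlim_at_top_dense by blast
      then show "\<forall>\<^sub>F n in sequentially. m = (m * real (card (K n))) / real (card (K n))"
        by eventually_elim simp
    qed
    then have "(\<lambda>n. (\<Sum>v\<in>K n. walks X k v) / real (card (K n))) \<longlonglongrightarrow> m"
    proof (rule density_limit_perturb[OF _ bd lim])
      fix n
      define U where "U = (\<Union>g\<in>E n. g ` F)"
      have U: "U = (\<lambda>(g, w). g w) ` (E n \<times> F)" by (auto simp: U_def)
      have injE: "inj_on (\<lambda>(g, w). g w) (E n \<times> F)" by (rule inj_on_subset[OF inj]) (use E(1) in auto)
      have "(\<Sum>v\<in>U. walks X k v) = (\<Sum>(g, w)\<in>E n \<times> F. walks X k (g w))"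
        unfolding U by (subst sum.reindex[OF injE]) (simp add: case_prod_unfold)
      also have "\<dots> = (\<Sum>(g, w)\<in>E n \<times> F. walks X k w)"
      proof (rule sum.cong[OF refl], clarify)
        fix g w assume "g \<in> E n" "w \<in> F"
        then have "g \<in> \<Gamma>" "w \<in> ?V" using E(1)[of n] F(1) by auto
        then show "walks X k (g w) = walks X k w" by (rule walks_automorphism[OF X(1) aut])
      qed
      also have "\<dots> = real (card (E n)) * (\<Sum>w\<in>F. walks X k w)"
        by (simp add: sum.cartesian_product[symmetric])
      also have "\<dots> = m * real (card U)"
        using cF by (simp add: m_def U card_image[OF injE] card_cartesian_product)
      finally have sU: "(\<Sum>v\<in>U. walks X k v) = m * real (card U)" .
      have UK: "U \<subseteq> K n" "K n - U \<subseteq> boundary X (K n)" using E(3,4)[of n] by (auto simp: U_def)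
      have fb: "finite (boundary X (K n))" using X(4)[of n] by (simp add: boundary_def)
      have cU: "real (card (K n - U)) \<le> real (card (boundary X (K n)))"
        using card_mono[OF fb UK(2)] by simp
      have "(\<Sum>v\<in>K n. walks X k v) - m * real (card (K n)) = (\<Sum>v\<in>K n - U. walks X k v) - m * real (card (K n - U))"
        using sum.subset_diff[OF UK(1) X(4), of "walks X k"] sU card_Diff_subset[of U "K n"] card_mono[OF X(4) UK(1)]
          finite_subset[OF UK(1) X(4)] UK(1)
        by (simp add: of_nat_diff algebra_simps)
      moreover have "\<bar>\<Sum>v\<in>K n - U. walks X k v\<bar> \<le> ?M * real (card (K n - U))"
      proof -
        have "\<bar>\<Sum>v\<in>K n - U. walks X k v\<bar> \<le> (\<Sum>v\<in>K n - U. ?M)"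
          by (rule order_trans[OF sum_abs]) (intro sum_mono abs_walks_le)
        then show ?thesis by (simp add: mult.commute)
      qed
      moreover have "\<bar>m * real (card (K n - U))\<bar> = \<bar>m\<bar> * real (card (K n - U))" by (simp add: abs_mult)
      moreover have "(?M + \<bar>m\<bar>) * real (card (K n - U)) \<le> (?M + \<bar>m\<bar>) * real (card (boundary X (K n)))"
        using cU by (intro mult_left_mono) auto
      ultimately show "\<bar>(\<Sum>v\<in>K n. walks X k v) - m * real (card (K n))\<bar>
          \<le> (?M + \<bar>m\<bar>) * real (card (boundary X (K n))) + 0"
        by (simp only: distrib_right)
      show "\<bar>real (card (K n)) - real (card (K n))\<bar> \<le> 0" by simp
    qed
    then show ?thesis by (rule convergentI)
  qed
  then show ?thesis unfolding homogeneous_def using X leak0 by blast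
qed

lemma homogeneous_essentially_periodic: "essentially_periodic X K \<Longrightarrow> homogeneous X K"
  by (induction rule: essentially_periodic.induct)
    (blast intro: homogeneous_periodic homogeneous_density_zero homogeneous_finite_perturbation)+


section \<open>The integrated density of states\<close>

text \<open>The inner product defining \<open>walks\<close> sees only real parts; reality of the
  entries recovers the complex trace from it.\<close>

lemma coord_adj_pow_real:
  assumes "is_graph X"
  shows "coord (adj_pow X k (basis_vector v)) u \<in> \<real>"
  by (induction k arbitrary: u) (simp_all add: coord_adjacency[OF assms])

lemma trace_on_poly_op_adjacency:
  assumes X: "is_graph X" and K: "K \<subseteq> verts X"
  shows "trace_on K (poly_op (verts X) p (adjacency X))
    = complex_of_real (\<Sum>i\<le>degree p. coeff p i * (\<Sum>v\<in>K. walks X i v))"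
proof -
  have pow: "(((o\<^sub>L) (adjacency X) ^^ i) (proj_on (verts X))) (basis_vector v) = adj_pow X i (basis_vector v)"
    if "v \<in> K" for i v
  proof (induction i)
    case 0
    show ?case using K that by (auto intro!: ell2_eqI)
  qed simp
  have "coord (adj_pow X i (basis_vector v)) v = complex_of_real (walks X i v)" for i v
    using coord_adj_pow_real[OF X, of i v v] by (simp add: walks_def inner_basis_vector of_real_Re)
  then have "coord (poly_op (verts X) p (adjacency X) (basis_vector v)) v
      = complex_of_real (\<Sum>i\<le>degree p. coeff p i * walks X i v)" if "v \<in> K" for v
    by (simp add: poly_op_def blinfun.sum_left blinfun.scaleR_left pow[OF that] scaleR_conv_of_real)
  then have "trace_on K (poly_op (verts X) p (adjacency X))
      = complex_of_real (\<Sum>v\<in>K. \<Sum>i\<le>degree p. coeff p i * walks X i v)"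
    by (simp add: trace_on_def)
  also have "(\<Sum>v\<in>K. \<Sum>i\<le>degree p. coeff p i * walks X i v) = (\<Sum>i\<le>degree p. coeff p i * (\<Sum>v\<in>K. walks X i v))"
    by (subst sum.swap) (simp add: sum_distrib_left)
  finally show ?thesis .
qed

lemma trace_poly_adjacency_limit:
  assumes X: "homogeneous X K"
    and m: "\<And>k. (\<lambda>n. (\<Sum>v\<in>K n. walks X k v) / real (card (K n))) \<longlonglongrightarrow> m k"
  shows "(\<lambda>n. trace_on (K n) (poly_op (verts X) p (adjacency X)) / of_nat (card (K n)))
    \<longlonglongrightarrow> complex_of_real (\<Sum>i\<le>degree p. coeff p i * m i)"
proof -
  note X' = homogeneousD[OF X]
  have KV: "K n \<subseteq> verts X" for n using X'(3) by (auto simp: exhaustion_def)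
  have "trace_on (K n) (poly_op (verts X) p (adjacency X)) / of_nat (card (K n))
      = complex_of_real (\<Sum>i\<le>degree p. coeff p i * ((\<Sum>v\<in>K n. walks X i v) / real (card (K n))))" for n
  proof -
    have "trace_on (K n) (poly_op (verts X) p (adjacency X)) / of_nat (card (K n))
        = complex_of_real ((\<Sum>i\<le>degree p. coeff p i * (\<Sum>v\<in>K n. walks X i v)) / real (card (K n)))"
      by (simp only: trace_on_poly_op_adjacency[OF X'(1) KV] of_real_divide of_real_of_nat_eq)
    also have "(\<Sum>i\<le>degree p. coeff p i * (\<Sum>v\<in>K n. walks X i v)) / real (card (K n))
        = (\<Sum>i\<le>degree p. coeff p i * ((\<Sum>v\<in>K n. walks X i v) / real (card (K n))))"
      by (subst sum_divide_distrib) simp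
    finally show ?thesis .
  qed
  then show ?thesis
    by (simp only:) (intro tendsto_of_real tendsto_sum tendsto_mult_left m)
qed

text \<open>No square root of p is taken: if B bounds p on the interval, then B - p has values in
  [0, B] there, so the norm bound gives ((B - p)(T) f, f) \<le> B |f|^2.\<close>

lemma poly_op_nonneg:
  assumes sa: "self_adjoint T" and on: "operator_on V T" and M: "norm T \<le> M"
    and p: "\<And>x. x \<in> {- M..M} \<Longrightarrow> 0 \<le> poly p x" and f: "proj_on V f = f"
  shows "0 \<le> poly_op V p T f \<bullet> f"
proof -
  have "compact (poly p ` {- M..M})" by (intro compact_continuous_image continuous_on_poly_self) auto
  then have "bounded (poly p ` {- M..M})" by (rule compact_imp_bounded)
  then obtain B0 where B0: "\<forall>x\<in>{- M..M}. norm (poly p x) \<le> B0" by (auto simp: bounded_iff)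
  define B where "B = max 0 B0"
  have B: "0 \<le> B" "\<And>x. x \<in> {- M..M} \<Longrightarrow> poly p x \<le> B" using B0 by (force simp: B_def)+
  let ?q = "[:B:] - p"
  have "norm (poly_op V ?q T) \<le> B"
  proof (rule norm_poly_op_le[OF sa on B(1)])
    fix r assume "r \<in> spectrum V T"
    then have "r \<in> {- M..M}" using spectrum_le_norm[OF sa on, of r] M by (auto simp: abs_le_iff)
    then show "\<bar>poly ?q r\<bar> \<le> B" using B p by auto
  qed
  then have "norm (poly_op V ?q T f) \<le> B * norm f"
    by (meson norm_blinfun order_trans mult_right_mono norm_ge_zero)
  then have "norm (poly_op V ?q T f) * norm f \<le> B * norm f * norm f" by (intro mult_right_mono) auto
  moreover have "poly_op V ?q T f \<bullet> f \<le> norm (poly_op V ?q T f) * norm f" by (rule norm_cauchy_schwarz)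
  moreover have "poly_op V ?q T f = B *\<^sub>R f - poly_op V p T f"
    using f by (simp add: poly_op_diff poly_op_pCons blinfun.bilinear_simps)
  ultimately show ?thesis
    by (simp add: inner_diff_left power2_norm_eq_inner[symmetric] power2_eq_square mult.assoc)
qed

text \<open>The functional is the limit of normalized traces of p(A), positive by
  \<open>poly_op_nonneg\<close> on basis vectors. M may exceed the norm so that the interval is
  nondegenerate even for a graph without edges.\<close>

lemma density_of_states_exists:
  assumes X: "homogeneous X K" and M: "norm (adjacency X) \<le> M" "0 < M"
    and m: "\<And>k. (\<lambda>n. (\<Sum>v\<in>K n. walks X k v) / real (card (K n))) \<longlonglongrightarrow> m k"
  obtains N where "real_distribution N" "AE x in N. x \<in> {- M..M}"
    "\<And>p. (\<integral>x. poly p x \<partial>N) = (\<Sum>i\<le>degree p. coeff p i * m i)"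
proof -
  note X' = homogeneousD[OF X]
  define \<Lambda> where "\<Lambda> p = (\<Sum>i\<le>degree p. coeff p i * m i)" for p
  define t where "t p n = Re (trace_on (K n) (poly_op (verts X) p (adjacency X))) / real (card (K n))" for p n
  have lim: "t p \<longlonglongrightarrow> \<Lambda> p" for p
    using tendsto_Re[OF trace_poly_adjacency_limit[OF X m, of p]]
    by (simp add: t_def[abs_def] \<Lambda>_def Re_divide_of_nat)
  have KV: "K n \<subseteq> verts X" for n using X'(3) by (auto simp: exhaustion_def)
  have nn: "0 \<le> \<Lambda> p" if p: "\<And>x. x \<in> {- M..M} \<Longrightarrow> 0 \<le> poly p x" for p
  proof (rule LIMSEQ_le_const[OF lim], intro exI allI impI)
    fix n
    have "0 \<le> Re (coord (poly_op (verts X) p (adjacency X) (basis_vector v)) v)" if "v \<in> K n" for v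
      unfolding inner_basis_vector[symmetric]
      by (rule poly_op_nonneg[OF self_adjoint_adjacency[OF X'(1)] operator_on_adjacency[OF X'(1)] M(1) p])
        (use that KV[of n] in \<open>auto intro!: ell2_eqI\<close>)
    then show "0 \<le> t p n" unfolding t_def trace_on_def Re_sum by (intro divide_nonneg_nonneg sum_nonneg) auto
  qed
  have one: "\<Lambda> 1 = 1"
  proof -
    have "\<forall>\<^sub>F n in sequentially. 0 < real (card (K n))"
      using X'(6) unfolding filterlim_at_top_dense by blast
    then have "\<forall>\<^sub>F n in sequentially. t 1 n = 1"
    proof eventually_elim
      case (elim n)
      have "trace_on (K n) (proj_on (verts X)) = of_nat (card (K n))"
        using KV[of n] by (simp add: trace_on_def subset_iff)
      then show ?case using elim by (simp add: t_def poly_op_1)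
    qed
    from Lim_transform_eventually[OF lim this] show ?thesis by (simp add: LIMSEQ_const_iff)
  qed
  show ?thesis
  proof (rule moment_problem[of "- M" M \<Lambda>])
    \<comment> \<open>Linearity is read off from the traces through uniqueness of limits, as the
      coefficient formula runs up to varying degrees.\<close>
    show "\<Lambda> (p + q) = \<Lambda> p + \<Lambda> q" for p q
    proof (rule LIMSEQ_unique[OF lim])
      have "t (p + q) = (\<lambda>n. t p n + t q n)"
        by (simp add: t_def fun_eq_iff poly_op_add trace_on_add add_divide_distrib)
      then show "t (p + q) \<longlonglongrightarrow> \<Lambda> p + \<Lambda> q" by (simp add: tendsto_add[OF lim lim])
    qed
    show "\<Lambda> (smult c p) = c * \<Lambda> p" for c p
    proof (rule LIMSEQ_unique[OF lim])
      have "t (smult c p) = (\<lambda>n. c * t p n)"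
        by (simp add: t_def fun_eq_iff poly_op_smult trace_on_scaleR)
      then show "t (smult c p) \<longlonglongrightarrow> c * \<Lambda> p" by (simp add: tendsto_mult_left[OF lim])
    qed
    show "0 \<le> \<Lambda> p" if "\<And>x. x \<in> {- M..M} \<Longrightarrow> 0 \<le> poly p x" for p using nn that by blast
    show "\<Lambda> 1 = 1" by (rule one)
    show "- M < M" using M(2) by simp
    fix N assume "real_distribution N" "AE x in N. x \<in> {- M..M}" "\<And>p. (\<integral>x. poly p x \<partial>N) = \<Lambda> p"
    then show thesis using that by (simp add: \<Lambda>_def)
  qed
qed

text \<open>Points below \<open>lo\<close> have a null neighbourhood. The infimum also needs a
  nonempty support: otherwise, by Lindelof, countably many null open sets would cover the
  line.\<close>

lemma Inf_measure_support_ge: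
  assumes "real_distribution M" and lo: "AE x in M. lo \<le> x"
  shows "lo \<le> Inf (measure_support M)"
proof (rule cInf_greatest)
  interpret real_distribution M by fact
  show "measure_support M \<noteq> {}"
  proof
    assume "measure_support M = {}"
    then have "\<forall>h. \<exists>U. open U \<and> h \<in> U \<and> emeasure M U = 0"
      by (auto simp: measure_support_def not_gr_zero)
    then obtain U where U: "\<And>h. open (U h)" "\<And>h. h \<in> U h" "\<And>h. emeasure M (U h) = 0" by metis
    obtain F where F: "F \<subseteq> range U" "countable F" "\<Union> F = \<Union> (range U)"
      using Lindelof[of "range U"] U(1) by auto
    have "(\<Union>u\<in>F. u) \<in> null_sets M"
      by (rule null_sets_UN'[OF F(2)]) (use F(1) U in \<open>auto intro!: null_setsI\<close>)
    then have "\<Union> F \<in> null_sets M" by simp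
    moreover have "\<Union> F = UNIV" using U(2) F(3) by auto
    ultimately show False using emeasure_space_1 by (auto dest: null_setsD1)
  qed
  fix h assume h: "h \<in> measure_support M"
  show "lo \<le> h"
  proof (rule ccontr)
    assume "\<not> lo \<le> h"
    then have "0 < emeasure M {..<lo}" using h by (auto simp: measure_support_def)
    moreover have "emeasure M {..<lo} = 0"
      using lo by (subst (asm) AE_iff_measurable[of "{..<lo}"]) auto
    ultimately show False by simp
  qed
qed


section \<open>The bottom of the compressed Hamiltonians\<close>

text \<open>The polynomial norm(S) - x lies between 0 and norm(S) - t on the spectrum, t its
  infimum. The norm bound transfers this to the operator and hence to the form. An empty spectrum
  would bound the identity by 0.\<close>

lemma Inf_spectrum_le_form:
  assumes sa: "self_adjoint S" and on: "operator_on V S" and "V \<noteq> {}"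
  shows "spectrum V S \<noteq> {}" "proj_on V f = f \<Longrightarrow> Inf (spectrum V S) * (norm f)\<^sup>2 \<le> S f \<bullet> f"
proof -
  show ne: "spectrum V S \<noteq> {}"
  proof
    assume "spectrum V S = {}"
    then have "norm (poly_op V 1 S) \<le> 0" by (intro norm_poly_op_le[OF sa on]) auto
    then have P: "proj_on V = 0" by (simp add: poly_op_1)
    obtain v where "v \<in> V" using assms(3) by blast
    then have "coord (proj_on V (basis_vector v)) v = 1" by simp
    then show False by (simp add: P)
  qed
  define t where "t = Inf (spectrum V S)"
  have bb: "bdd_below (spectrum V S)"
    by (rule bdd_belowI[of _ "- norm S"]) (drule spectrum_le_norm[OF sa on], linarith)
  have t: "t \<le> r" "r \<le> norm S" if "r \<in> spectrum V S" for r
    using cInf_lower[OF that bb] spectrum_le_norm[OF sa on that] by (auto simp: t_def)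
  have "t \<le> norm S" using ne t by force
  then have "norm (poly_op V [:norm S, - 1:] S) \<le> norm S - t"
    by (intro norm_poly_op_le[OF sa on]) (use t in force)+
  then have "norm (poly_op V [:norm S, - 1:] S f) \<le> (norm S - t) * norm f"
    by (meson norm_blinfun order_trans mult_right_mono norm_ge_zero)
  then have "norm (poly_op V [:norm S, - 1:] S f) * norm f \<le> (norm S - t) * norm f * norm f"
    by (intro mult_right_mono) auto
  moreover have "poly_op V [:norm S, - 1:] S f \<bullet> f \<le> norm (poly_op V [:norm S, - 1:] S f) * norm f"
    by (rule norm_cauchy_schwarz)
  moreover assume f: "proj_on V f = f"
  have "poly_op V [:norm S, - 1:] S f = norm S *\<^sub>R f - S f"
    using f by (simp add: poly_op_pCons blinfun.bilinear_simps)
  ultimately show "Inf (spectrum V S) * (norm f)\<^sup>2 \<le> S f \<bullet> f"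
    by (simp add: t_def inner_diff_left power2_norm_eq_inner[symmetric] power2_eq_square algebra_simps)
qed

lemma exhaustion_proj_on_tendsto:
  assumes K: "exhaustion X K"
  shows "(\<lambda>n. proj_on (K n) f) \<longlonglongrightarrow> proj_on (verts X) f"
proof (rule tendstoI)
  fix e :: real assume "0 < e"
  let ?f = "proj_on (verts X) f"
  obtain S where S: "finite S" "\<And>T. S \<subseteq> T \<Longrightarrow> norm (?f - proj_on T ?f) < e"
    using norm_sub_proj_on_finite[OF \<open>0 < e\<close>, of ?f] by metis
  have KV: "K n \<subseteq> verts X" for n using K by (auto simp: exhaustion_def)
  have "\<forall>\<^sub>F n in sequentially. S \<inter> verts X \<subseteq> K n"
    by (rule exhaustion_eventually_superset[OF K]) (use S(1) in auto)
  then show "\<forall>\<^sub>F n in sequentially. dist (proj_on (K n) f) ?f < e"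
  proof eventually_elim
    case (elim n)
    \<comment> \<open>Adding the complement of the vertex set changes nothing, as \<open>?f\<close>
      vanishes there, and it makes the set contain all of \<open>S\<close>, which may leave the
      vertex set.\<close>
    have "proj_on (K n) f = proj_on (K n \<union> - verts X) ?f"
      by (rule ell2_eqI) (use KV[of n] in auto)
    moreover have "S \<subseteq> K n \<union> - verts X" using elim by auto
    ultimately show ?case using S(2)[of "K n \<union> - verts X"] by (simp add: dist_norm norm_minus_commute)
  qed
qed

lemma adjacency_near_extremal:
  assumes X: "is_graph X" and "0 < e" "0 < norm (adjacency X)"
  obtains f where "proj_on (verts X) f = f" "(norm (adjacency X) - e) * (norm f)\<^sup>2 < adjacency X f \<bullet> f"
proof -
  \<comment> \<open>Truncated at 0 because \<open>norm_adjacency_le\<close> takes nonnegative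
    bounds; it still lies below the norm, so its form inequality must fail at some f.\<close>
  define M where "M = max 0 (norm (adjacency X) - e)"
  have M: "0 \<le> M" "M < norm (adjacency X)" using assms by (auto simp: M_def)
  then obtain f where f: "M * (norm f)\<^sup>2 < adjacency X f \<bullet> f"
    using norm_adjacency_le[OF X M(1)] by (meson not_le)
  let ?f = "proj_on (verts X) f"
  note on = operator_onD[OF operator_on_adjacency[OF X]]
  have "(norm (adjacency X) - e) * (norm ?f)\<^sup>2 \<le> M * (norm ?f)\<^sup>2"
    by (intro mult_right_mono) (auto simp: M_def)
  also have "\<dots> \<le> M * (norm f)\<^sup>2" using M(1) by (intro mult_left_mono power_mono norm_proj_on_le) auto
  also have "\<dots> < adjacency X f \<bullet> f" by (rule f)
  also have "\<dots> = adjacency X ?f \<bullet> ?f" by (simp add: inner_proj_on[symmetric] on)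
  finally show ?thesis by (intro that[of ?f]) simp_all
qed

lemma hamiltonian_form:
  assumes X: "is_graph X"
  shows "self_adjoint (hamiltonian X)" "operator_on (verts X) (hamiltonian X)" "0 \<le> hamiltonian X f \<bullet> f"
    "proj_on (verts X) f = f \<Longrightarrow> hamiltonian X f \<bullet> f = norm (adjacency X) * (norm f)\<^sup>2 - adjacency X f \<bullet> f"
proof -
  let ?A = "adjacency X" and ?P = "proj_on (verts X)"
  show "self_adjoint (hamiltonian X)" unfolding hamiltonian_def
    by (intro self_adjoint_diff self_adjoint_scaleR self_adjoint_proj_on self_adjoint_adjacency X)
  show on: "operator_on (verts X) (hamiltonian X)" unfolding hamiltonian_def
    by (intro operator_on_diff operator_on_scaleR operator_on_proj_on operator_on_adjacency X)
  have eq: "hamiltonian X f \<bullet> f = norm ?A * (norm f)\<^sup>2 - ?A f \<bullet> f" if "?P f = f" for f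
    using that by (simp add: hamiltonian_def blinfun.bilinear_simps inner_diff_left power2_norm_eq_inner)
  then show "?P f = f \<Longrightarrow> hamiltonian X f \<bullet> f = norm ?A * (norm f)\<^sup>2 - ?A f \<bullet> f" .
  have "?A g \<bullet> g \<le> norm ?A * (norm g)\<^sup>2" for g
  proof -
    have "?A g \<bullet> g \<le> norm (?A g) * norm g" by (rule norm_cauchy_schwarz)
    also have "\<dots> \<le> norm ?A * norm g * norm g" by (intro mult_right_mono norm_blinfun) auto
    finally show ?thesis by (simp add: power2_eq_square mult.assoc)
  qed
  then have "0 \<le> hamiltonian X (?P f) \<bullet> ?P f" using eq[of "?P f"] by simp
  then show "0 \<le> hamiltonian X f \<bullet> f"
    by (simp add: inner_proj_on[symmetric] operator_onD[OF on])
qed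

text \<open>Positivity of the Hamiltonian bounds every compressed spectrum below by 0. Above, the
  truncations of a near-extremal vector eventually have Rayleigh quotient under e, and the bottom of
  the spectrum lies under that quotient.\<close>

lemma E0_hamiltonian:
  assumes X: "is_graph X" and K: "exhaustion X K" and A: "0 < norm (adjacency X)"
  shows "E0 K (hamiltonian X) = 0"
proof -
  let ?H = "hamiltonian X"
  define S where "S n = proj_on (K n) o\<^sub>L ?H o\<^sub>L proj_on (K n)" for n
  have Ssa: "self_adjoint (S n)" for n
    using self_adjointD[OF hamiltonian_form(1)[OF X]]
    by (simp add: self_adjoint_def S_def inner_proj_on)
  have Son: "operator_on (K n) (S n)" for n by (simp add: operator_on_def S_def)
  have Snn: "0 \<le> S n f \<bullet> f" for n f
    using hamiltonian_form(3)[OF X, of "proj_on (K n) f"] by (simp add: S_def inner_proj_on)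
  have KV: "K n \<subseteq> verts X" for n using K by (auto simp: exhaustion_def)
  have "(\<lambda>n. Inf (spectrum (K n) (S n))) \<longlonglongrightarrow> 0"
  proof (rule tendstoI)
    fix e :: real assume e: "0 < e"
    obtain f where f: "proj_on (verts X) f = f" "(norm (adjacency X) - e) * (norm f)\<^sup>2 < adjacency X f \<bullet> f"
      using adjacency_near_extremal[OF X e A] by metis
    have "?H f \<bullet> f < e * (norm f)\<^sup>2"
      using f(2) unfolding hamiltonian_form(4)[OF X f(1)] by (simp add: left_diff_distrib)
    moreover have "(\<lambda>n. e * (norm (proj_on (K n) f))\<^sup>2 - ?H (proj_on (K n) f) \<bullet> proj_on (K n) f)
        \<longlonglongrightarrow> e * (norm f)\<^sup>2 - ?H f \<bullet> f"
      using exhaustion_proj_on_tendsto[OF K, of f] unfolding f(1) by (intro tendsto_intros)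
    ultimately have "\<forall>\<^sub>F n in sequentially. 0 < e * (norm (proj_on (K n) f))\<^sup>2 - ?H (proj_on (K n) f) \<bullet> proj_on (K n) f"
      by (intro order_tendstoD(1)) auto
    then show "\<forall>\<^sub>F n in sequentially. dist (Inf (spectrum (K n) (S n))) 0 < e"
    proof eventually_elim
      case (elim n)
      let ?g = "proj_on (K n) f" and ?s = "Inf (spectrum (K n) (S n))"
      have Sg: "S n ?g \<bullet> ?g = ?H ?g \<bullet> ?g" by (simp add: S_def inner_proj_on)
      \<comment> \<open>The strict inequality in \<open>elim\<close> fails for the zero vector; so
        the truncation is nonzero and \<open>K n\<close> is nonempty.\<close>
      have g: "?g \<noteq> 0" using elim by auto
      then have ne: "K n \<noteq> {}" by (auto intro!: ell2_eqI)
      note sp = Inf_spectrum_le_form[OF Ssa Son ne]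
      have "?s * (norm ?g)\<^sup>2 < e * (norm ?g)\<^sup>2" using sp(2)[of ?g] elim Sg by simp
      then have "?s < e" using g by simp
      moreover have "0 \<le> ?s"
        by (rule cInf_greatest[OF sp(1)]) (rule spectrum_nonneg[OF Ssa Son Snn])
      ultimately show ?case by (simp add: dist_real_def)
    qed
  qed
  then show ?thesis unfolding E0_def S_def by (rule limI)
qed

theorem proposition7p1:
  fixes X Y :: "'v graph" and K :: "nat \<Rightarrow> 'v set"
  assumes "essentially_periodic X K"
    and "density_zero_perturbation K X Y"
    and "norm (adjacency Y) > norm (adjacency X)"
  shows "hidden_spectrum Y K \<and>
         (let \<mu> = norm (adjacency X) - norm (adjacency Y)
          in \<mu> < 0 \<and> (\<forall>\<beta>>0. critical_density Y K \<beta> = particle_density X K \<beta> \<mu>))"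
proof -
  let ?a = "norm (adjacency X)" and ?b = "norm (adjacency Y)" and ?V = "verts X"
  have X: "homogeneous X K" by (rule homogeneous_essentially_periodic) fact
  have Y: "homogeneous Y K" by (rule homogeneous_density_zero[OF X]) fact
  have VY: "verts Y = ?V" using assms(2) by (simp add: density_zero_perturbation_def)
  note X' = homogeneousD[OF X] and Y' = homogeneousD[OF Y]
  \<comment> \<open>The midpoint is positive even if A_X = 0, as the moment problem needs, and lies
    below the norm of A_Y, so that a gap \<open>?b - M\<close> remains.\<close>
  define M where "M = (?a + ?b) / 2"
  have "0 < ?b" by (rule le_less_trans[OF norm_ge_zero assms(3)])
  then have M: "?a \<le> M" "0 < M" "M < ?b" using assms(3) by (simp_all add: M_def add_nonneg_pos)
  obtain m where mX: "\<And>k. (\<lambda>n. (\<Sum>v\<in>K n. walks X k v) / real (card (K n))) \<longlonglongrightarrow> m k"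
    using X unfolding homogeneous_def convergent_def by metis
  have mY: "(\<lambda>n. (\<Sum>v\<in>K n. walks Y k v) / real (card (K n))) \<longlonglongrightarrow> m k" for k
    by (rule density_zero_walks[OF X assms(2) mX])
  obtain N where N: "real_distribution N" "AE x in N. x \<in> {- M..M}"
    "\<And>p. (\<integral>x. poly p x \<partial>N) = (\<Sum>i\<le>degree p. coeff p i * m i)"
    using density_of_states_exists[OF X M(1,2) mX] by blast
  interpret N: real_distribution N by (rule N)
  have NX: "spectral_measure ?V K (hamiltonian X) = distr N borel (\<lambda>x. ?a - x)"
    unfolding hamiltonian_def
    by (rule spectral_measure_affine[OF self_adjoint_adjacency[OF X'(1)] operator_on_adjacency[OF X'(1)] N(1,2)])
      (simp only: N(3) trace_poly_adjacency_limit[OF X mX])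
  have NY: "spectral_measure ?V K (hamiltonian Y) = distr N borel (\<lambda>x. ?b - x)"
    unfolding hamiltonian_def VY[symmetric]
    by (rule spectral_measure_affine[OF self_adjoint_adjacency[OF Y'(1)] operator_on_adjacency[OF Y'(1)] N(1,2)])
      (simp only: N(3) trace_poly_adjacency_limit[OF Y mY])
  have "?b - M \<le> Em (verts Y) K (hamiltonian Y)"
    unfolding Em_def VY NY
  proof (rule Inf_measure_support_ge)
    show "real_distribution (distr N borel (\<lambda>x. ?b - x))" by (rule N.real_distribution_distr) simp
    show "AE x in distr N borel (\<lambda>x. ?b - x). ?b - M \<le> x"
      using N(2) by (subst AE_distr_iff) auto
  qed
  moreover have "E0 K (hamiltonian Y) = 0"
    by (rule E0_hamiltonian[OF Y'(1,3)]) (use M in linarith)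
  ultimately have "hidden_spectrum Y K" unfolding hidden_spectrum_def using M by linarith
  \<comment> \<open>Both densities become integrals over the same N, and (b - x) - 0 = (a - x) - (a
    - b) makes the integrands equal.\<close>
  moreover have "critical_density Y K \<beta> = particle_density X K \<beta> (?a - ?b)" for \<beta>
    unfolding critical_density_def particle_density_def VY NX NY
    by (subst (1 2) nn_integral_distr) (simp_all add: algebra_simps)
  ultimately show ?thesis using assms(3) by (simp add: Let_def)
qed

end
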